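(* Let $n\ge1$ and let $F\in\mathbb{K}_{\mathbb{R}}[x_1,\dots,x_{n+1}]$ be such that $f=\mathrm{Trop}(F)$ is non-singular. Then $$\frac{\sigma_{2n}}{\sigma_n}\int_{V^{\mathbb{R}}(f)}|k|\;=\;\int_{V(f)}|K| .$$
   Context: Constants: $\sigma_m$ is the volume of the unit sphere $S^m\subset\mathbb{R}^{m+1}$, and $a_n=\pi\,\sigma_{2n}/\sigma_{2n+1}$; $ds$ is the canonical volume form on $\mathbb{RP}^n$, with $\mathrm{vol}(\mathbb{RP}^n)=\sigma_n/2$, and $\mathrm{vol}(\mathbb{CP}^n)=\sigma_{2n+1}/\sigma_1$. $\mathbb{K}$ is the field of locally convergent generalised Puiseux series $\xi(t)=\sum_{r\in R}\beta_r t^r$ ($R\subset\mathbb{R}$ well-ordered, $\beta_r\in\mathbb{C}$, convergent for small $t>0$); $\mathbb{K}_{\mathbb{R}}\subset\mathbb{K}$ is the subfield of series with real coefficients; $\mathrm{val}(\xi)=-\min\{r:\beta_r\ne0\}$ for $\xi\ne0$. For $F=\sum_\alpha c_\alpha x^\alpha$, $F_t$ is obtained by evaluating the coefficients at small $t>0$, and $\mathrm{Trop}(F)(X)=\max_\alpha\{\mathrm{val}(c_\alpha)+X\cdot\alpha\}$ (max over exponents with $c_\alpha\neq0$), with Newton polytope $\triangle_f=\triangle_F$. $V(f)\subset\mathbb{R}^{n+1}$ is the set of points where the maximum is attained at least twice. For $\omega\in\mathbb{R}^{n+1}$, $In_\omega f$ is the sum of the monomials of $f$ attaining the maximum at $\omega$.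 The Newton polytopes $\triangle_{In_\omega f}$, $\omega\in\mathbb{R}^{n+1}$, are the cells of a regular subdivision $\Gamma_f$ of $\triangle_f$. $f$ is non-singular if all maximal dimensional cells of $\Gamma_f$ are primitive simplices of dimension $n+1$, i.e. lattice simplices of volume $1/(n+1)!$. Real total curvature: let $\mathbb{R}V(F_t)$ be the zero set of $F_t$ in $(\mathbb{R}^* )^{n+1}$ (non-singular for $t>0$ small), $\gamma_t^{\mathbb{R}}:\mathbb{R}V(F_t)\to\mathbb{RP}^n$, $x\mapsto[x_i\,\partial F_t/\partial x_i]_{i=1}^{n+1}$ the logarithmic Gauss map, and $\mathcal{A}^{\mathbb{R}}(F_t)$ the real amoeba (image of $\mathbb{R}V(F_t)$ under $x\mapsto(\log_t|x_i|)_i$), whose total curvature is $\int_{\mathcal{A}^{\mathbb{R}}(F_t)}|k|=\int_{\mathbb{RP}^n}\#(\gamma_t^{\mathbb{R}})^{-1}(\beta)\,ds$. Then $\int_{V^{\mathbb{R}}(f)}|k|:=\limsup_{t\to0^+}\int_{\mathcal{A}^{\mathbb{R}}(F_t)}|k|$. Complex total curvature: $\int_{V(f)}K:=(-1)^n a_n\,(n+1)!\,\mathrm{vol}(\triangle_f)\,\mathrm{vol}(\mathbb{CP}^n)$ (which equals $(-1)^na_n\int_{\mathbb{CP}^n}\#\gamma_t^{-1}(\beta)\,dp$ for small $t>0$, where $\gamma_t$ is the complex logarithmic Gauss map on the zero set of $F_t$ in $(\mathbb{C}^* )^{n+1}$ and $dp$ the canonical volume form), and $\int_{V(f)}|K|=(-1)^n\int_{V(f)}K$.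 *)

theory Defs
  imports "HOL-Analysis.Analysis" "HOL-Library.Poly_Mapping"
begin

section \<open>Volumes of spheres and projective spaces\<close>

text \<open>The volume \<open>\<sigma>\<^sub>m\<close> of the unit sphere of dimension \<open>m\<close>, which is \<open>m + 1\<close> times the
  volume of the unit ball of dimension \<open>m + 1\<close>; see \<open>emeasure_sphere_measure\<close> below.\<close>

definition sphere_vol :: "nat \<Rightarrow> real" where
  "sphere_vol m = real (m + 1) * unit_ball_vol (real (m + 1))"

definition CP_vol :: "nat \<Rightarrow> real" where
  "CP_vol n = sphere_vol (2 * n + 1) / sphere_vol 1"

definition curvature_const :: "nat \<Rightarrow> real" where
  "curvature_const n = pi * sphere_vol (2 * n) / sphere_vol (2 * n + 1)"

text \<open>The surface measure of the unit sphere, by radial projection of Lebesgue measure: the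
  measure of \<open>A\<close> is \<open>DIM('a)\<close> times the volume of the cone \<open>{r *\<^sub>R v | v \<in> A \<and> 0 < r < 1}\<close>.\<close>

definition sphere_measure :: "'a::euclidean_space measure" where
  "sphere_measure = scale_measure (of_nat DIM('a))
     (distr (restrict_space lborel (ball 0 1 - {0})) (restrict_space borel (sphere 0 1)) sgn)"

text \<open>Real projective space as the set of lines through the origin, with the sigma-algebra and
  the measure induced from the unit sphere. The map from the sphere is two-to-one and locally
  isometric, whence the factor \<open>1/2\<close>.\<close>

definition proj_space :: "'a::euclidean_space set set" where
  "proj_space = {span {v} |v. v \<noteq> 0}"

definition proj_algebra :: "'a::euclidean_space set measure" where
  "proj_algebra = sigma proj_space
     {A. A \<subseteq> proj_space \<and> {v \<in> sphere 0 1. span {v} \<in> A} \<in> sets borel}"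

definition proj_measure :: "'a::euclidean_space set measure" where
  "proj_measure = scale_measure (1 / 2) (distr sphere_measure proj_algebra (\<lambda>v. span {v}))"

lemma space_sphere_measure [simp]: "space sphere_measure = sphere 0 1"
  by (simp add: sphere_measure_def space_scale_measure space_restrict_space)

lemma sets_sphere_measure [simp]: "sets sphere_measure = sets (restrict_space borel (sphere 0 1))"
  by (simp add: sphere_measure_def)

lemma measurable_sgn_sphere:
  "sgn \<in> restrict_space lborel (ball 0 1 - {0}) \<rightarrow>\<^sub>M
     restrict_space borel (sphere 0 1 :: 'a::euclidean_space set)"
  by (intro measurable_restrict_space2 measurable_restrict_space1)
     (auto simp: space_restrict_space norm_sgn)

lemma emeasure_sphere_measure:
  "emeasure sphere_measure (sphere 0 1 :: 'a::euclidean_space set) = sphere_vol (DIM('a) - 1)"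
proof -
  have B: "ball 0 1 - {0 :: 'a} \<in> sets lborel" by simp
  have "emeasure (restrict_space lborel (ball 0 1 - {0 :: 'a})) (ball 0 1 - {0}) =
        emeasure lborel (ball 0 1 - {0 :: 'a})"
    using B by (subst emeasure_restrict_space) auto
  also have "\<dots> = emeasure lborel (ball 0 1 :: 'a set)"
    by (rule emeasure_Diff_null_set) (auto simp: null_sets_def)
  also have "\<dots> = ennreal (unit_ball_vol (real DIM('a)))"
    by (simp add: emeasure_ball)
  finally have *: "emeasure (restrict_space lborel (ball 0 1 - {0 :: 'a})) (ball 0 1 - {0}) =
    ennreal (unit_ball_vol (real DIM('a)))" .
  have pre: "sgn -` sphere 0 1 \<inter> (ball 0 1 - {0}) = ball 0 1 - {0 :: 'a}"
    by (auto simp: norm_sgn)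
  have sp: "sphere (0::'a) 1 \<in> sets (restrict_space borel (sphere 0 1))"
    by (simp add: sets_restrict_space_iff)
  have "emeasure (distr (restrict_space lborel (ball 0 1 - {0}))
           (restrict_space borel (sphere 0 1)) sgn) (sphere (0::'a) 1)
        = ennreal (unit_ball_vol (real DIM('a)))"
    using * pre by (subst emeasure_distr[OF measurable_sgn_sphere sp])
                   (simp add: space_restrict_space)
  thus ?thesis
    by (simp add: sphere_measure_def sphere_vol_def ennreal_mult' ennreal_of_nat_eq_real_of_nat
             flip: of_nat_Suc)
qed

lemma emeasure_proj_measure:
  "emeasure proj_measure (proj_space :: 'a::euclidean_space set set) = sphere_vol (DIM('a) - 1) / 2"
proof -
  have sp: "span {v} \<in> proj_space" if "v \<in> sphere 0 1" for v :: 'a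
    using that by (auto simp: proj_space_def intro!: exI[of _ v])
  have m: "(\<lambda>v. span {v}) \<in> sphere_measure \<rightarrow>\<^sub>M (proj_algebra :: 'a set measure)"
    unfolding proj_algebra_def
  proof (rule measurable_measure_of)
    fix A :: "'a set set"
    assume "A \<in> {A. A \<subseteq> proj_space \<and> {v \<in> sphere 0 1. span {v} \<in> A} \<in> sets borel}"
    moreover have "(\<lambda>v. span {v}) -` A \<inter> space sphere_measure = {v \<in> sphere 0 1. span {v} \<in> A}"
      by auto
    ultimately show "(\<lambda>v. span {v}) -` A \<inter> space sphere_measure \<in> sets sphere_measure"
      by (auto simp: sets_restrict_space_iff)
  qed (use sp in auto)
  have ps: "proj_space \<in> sets (proj_algebra :: 'a set measure)"
    using sets.top[of "proj_algebra :: 'a set measure"]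
    by (simp add: proj_algebra_def space_measure_of_conv)
  have "(\<lambda>v. span {v}) -` proj_space \<inter> sphere 0 1 = sphere (0::'a) 1"
    using sp by auto
  then have "emeasure (distr sphere_measure proj_algebra (\<lambda>v. span {v})) (proj_space :: 'a set set)
      = ennreal (sphere_vol (DIM('a) - 1))"
    by (subst emeasure_distr[OF m ps]) (simp add: emeasure_sphere_measure)
  then show ?thesis
    by (simp add: proj_measure_def divide_ennreal_def mult.commute sphere_vol_def
          ennreal_divide_numeral[symmetric])
qed


section \<open>Locally convergent generalised Puiseux series\<close>

text \<open>A series is given by its coefficient function on all real exponents; convergence is
  unconditional, the support having no canonical enumeration. The paper's field \<open>\<bbbK>\<close> is
  \<open>complex puiseux\<close>, its subfield \<open>\<bbbK>\<^sub>\<real>\<close> is \<open>real puiseux\<close>.\<close>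

typedef (overloaded) 'a::real_normed_field puiseux =
  "{c :: real \<Rightarrow> 'a. wfp_on {r. c r \<noteq> 0} (<) \<and>
     (\<forall>\<^sub>F t in at_right 0. (\<lambda>r. c r * of_real (t powr r)) summable_on UNIV)}"
  morphisms puiseux_coeff Abs_puiseux
  by (rule exI[of _ "\<lambda>_. 0"]) (simp add: wfp_on_iff_ex_minimal)

setup_lifting type_definition_puiseux

instantiation puiseux :: (real_normed_field) zero
begin
lift_definition zero_puiseux :: "'a puiseux" is "\<lambda>_. 0"
  by (simp add: wfp_on_iff_ex_minimal)
instance ..
end

definition puiseux_eval :: "'a::real_normed_field puiseux \<Rightarrow> real \<Rightarrow> 'a" where
  "puiseux_eval \<xi> t = (\<Sum>\<^sub>\<infinity>r. puiseux_coeff \<xi> r * of_real (t powr r))"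

text \<open>Only meaningful for \<open>\<xi> \<noteq> 0\<close>.\<close>

definition puiseux_val :: "'a::real_normed_field puiseux \<Rightarrow> real" where
  "puiseux_val \<xi> = - (LEAST r. puiseux_coeff \<xi> r \<noteq> 0)"


section \<open>Polynomials\<close>

text \<open>Polynomials with coefficients in \<open>'a\<close> in the variables \<open>x\<^sub>i\<close>, \<open>i :: 'v\<close>, are finitely
  supported coefficient functions on exponents.\<close>

type_synonym ('v, 'a) mpolynomial = "('v \<Rightarrow>\<^sub>0 nat) \<Rightarrow>\<^sub>0 'a"

definition exponent_vec :: "('v \<Rightarrow>\<^sub>0 nat) \<Rightarrow> real ^ 'v" where
  "exponent_vec \<alpha> = (\<chi> i. real (Poly_Mapping.lookup \<alpha> i))"

definition mpoly_fun :: "('v::finite, real) mpolynomial \<Rightarrow> real ^ 'v \<Rightarrow> real" where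
  "mpoly_fun p x = (\<Sum>\<alpha>\<in>Poly_Mapping.keys p. Poly_Mapping.lookup p \<alpha> *
     (\<Prod>i\<in>UNIV. (x $ i) ^ Poly_Mapping.lookup \<alpha> i))"

text \<open>\<open>F\<^sub>t\<close>.\<close>

definition mpoly_at :: "('v, real puiseux) mpolynomial \<Rightarrow> real \<Rightarrow> ('v, real) mpolynomial" where
  "mpoly_at F t = Poly_Mapping.map (\<lambda>\<xi>. puiseux_eval \<xi> t) F"


section \<open>Tropical polynomials\<close>

text \<open>A tropical polynomial is a finite partial map from exponents to real coefficients; the
  exponents outside its domain have coefficient \<open>-\<infinity>\<close>.\<close>

type_synonym 'v tpolynomial = "('v \<Rightarrow>\<^sub>0 nat) \<rightharpoonup> real"

definition Trop :: "('v, 'a::real_normed_field puiseux) mpolynomial \<Rightarrow> 'v tpolynomial" where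
  "Trop F = (\<lambda>\<alpha>. if \<alpha> \<in> Poly_Mapping.keys F
     then Some (puiseux_val (Poly_Mapping.lookup F \<alpha>)) else None)"

definition trop_monomial :: "'v::finite tpolynomial \<Rightarrow> ('v \<Rightarrow>\<^sub>0 nat) \<Rightarrow> real ^ 'v \<Rightarrow> real" where
  "trop_monomial f \<alpha> X = the (f \<alpha>) + X \<bullet> exponent_vec \<alpha>"

definition trop_fun :: "'v::finite tpolynomial \<Rightarrow> real ^ 'v \<Rightarrow> real" where
  "trop_fun f X = (MAX \<alpha>\<in>dom f. trop_monomial f \<alpha> X)"

definition initial_form :: "real ^ 'v \<Rightarrow> 'v::finite tpolynomial \<Rightarrow> 'v tpolynomial" where
  "initial_form \<omega> f = f |` {\<alpha>. trop_monomial f \<alpha> \<omega> = trop_fun f \<omega>}"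

definition newton_polytope :: "'v::finite tpolynomial \<Rightarrow> (real ^ 'v) set" where
  "newton_polytope f = convex hull (exponent_vec ` dom f)"

definition subdivision_cells :: "'v::finite tpolynomial \<Rightarrow> (real ^ 'v) set set" where
  "subdivision_cells f = range (\<lambda>\<omega>. newton_polytope (initial_form \<omega> f))"

definition primitive_simplex :: "(real ^ 'v) set \<Rightarrow> bool" where
  "primitive_simplex C \<longleftrightarrow>
     int CARD('v) simplex C \<and>
     (\<forall>v. v extreme_point_of C \<longrightarrow> (\<forall>i. v $ i \<in> \<int>)) \<and>
     measure lborel C = 1 / fact CARD('v)"

definition trop_nonsingular :: "'v::finite tpolynomial \<Rightarrow> bool" where
  "trop_nonsingular f \<longleftrightarrow>
     (\<forall>C\<in>subdivision_cells f.
        (\<forall>D\<in>subdivision_cells f. aff_dim D \<le> aff_dim C) \<longrightarrow> primitive_simplex C)"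


section \<open>Total curvatures\<close>

definition real_zero_set :: "('v::finite, real) mpolynomial \<Rightarrow> (real ^ 'v) set" where
  "real_zero_set p = {x. (\<forall>i. x $ i \<noteq> 0) \<and> mpoly_fun p x = 0}"

text \<open>The line spanned by \<open>(x\<^sub>i \<partial>p/\<partial>x\<^sub>i)\<^sub>i\<close>; at a singular point of the zero set this is \<open>{0}\<close>,
  which is not an element of \<open>proj_space\<close>.\<close>

definition log_gauss_map :: "('v::finite, real) mpolynomial \<Rightarrow> real ^ 'v \<Rightarrow> (real ^ 'v) set" where
  "log_gauss_map p x =
     span {\<chi> i. x $ i * frechet_derivative (mpoly_fun p) (at x) (axis i 1)}"

text \<open>The total curvature of the real amoeba of \<open>p\<close>. The value of the counting measure is the
  number of elements, and is infinite for infinite fibres.\<close>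

definition real_amoeba_curvature :: "('v::finite, real) mpolynomial \<Rightarrow> ennreal" where
  "real_amoeba_curvature p =
     (\<integral>\<^sup>+\<beta>. emeasure (count_space UNIV) {x \<in> real_zero_set p. log_gauss_map p x = \<beta>} \<partial>proj_measure)"

definition real_total_curvature :: "('v::finite, real puiseux) mpolynomial \<Rightarrow> ennreal" where
  "real_total_curvature F = Limsup (at_right 0) (\<lambda>t. real_amoeba_curvature (mpoly_at F t))"

text \<open>\<open>\<integral>K\<close> and \<open>\<integral>\<bar>K\<bar>\<close> over the tropical hypersurface in dimension \<open>n + 1 = CARD('v)\<close>.\<close>

definition total_curvature :: "nat \<Rightarrow> 'v::finite tpolynomial \<Rightarrow> real" where
  "total_curvature n f =
     (- 1) ^ n * curvature_const n * fact (n + 1) * measure lborel (newton_polytope f) * CP_vol n"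

definition total_abs_curvature :: "nat \<Rightarrow> 'v::finite tpolynomial \<Rightarrow> real" where
  "total_abs_curvature n f = (- 1) ^ n * total_curvature n f"

end

theory Submission
  imports Defs "HOL-Computational_Algebra.Polynomial"
begin

text \<open>
  Write \<open>N = n + 1\<close>, let \<open>\<Delta>\<close> be the Newton polytope and \<open>M = N! vol(\<Delta>)\<close>. Since
  \<open>\<sigma>\<^sub>1 = 2\<pi>\<close>, the constants satisfy \<open>a\<^sub>n vol(CP\<^sup>n) = \<sigma>\<^sub>2\<^sub>n / 2\<close>, so the theorem says that the real total
  curvature equals \<open>M\<close> times \<open>vol(RP\<^sup>n) = \<sigma>\<^sub>n / 2\<close>. It holds because, for small \<open>t\<close>, the
  fibres of the real logarithmic Gauss map have exactly \<open>M\<close> points, except over a set of lines of small measure.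
  The two inequalities have independent proofs.

  A fibre has at most \<open>M\<close> points, for every \<open>t\<close> and almost every line \<open>[v]\<close>
  (\<open>kushnirenko_gauss_bound\<close>). Let \<open>p\<close> be the polynomial, \<open>L\<close> its logarithmic gradient and \<open>g\<close> a further
  linear combination of the monomials. The products of total degree \<open>m\<close> in \<open>p\<close>, in the components of
  \<open>L\<close> and in \<open>g\<close>, with \<open>g\<close> occurring to a power less than \<open>D\<close>, number about \<open>D m\<^sup>N / N!\<close>, while they
  are polynomials supported on the at most about \<open>vol(\<Delta>) m\<^sup>N\<close> lattice points of \<open>m\<Delta>\<close>. If \<open>D > M\<close>, they satisfy a
  linear relation. Divided by the largest possible power of \<open>p\<close> and read at a point where \<open>p = 0\<close> and
  \<open>L = \<lambda>v\<close>, this relation is an equation of degree less than \<open>D\<close> for \<open>g / \<lambda>\<close> whose coefficients are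
  homogeneous polynomials in \<open>v\<close>, not all identically zero. For almost every \<open>v\<close> it is therefore a
  nontrivial equation, and a suitable \<open>g\<close> separates the points of the fibre.

  For small \<open>t\<close>, outside a set of lines of arbitrarily small measure, a fibre has at least one point for each
  full-dimensional cell of the subdivision (\<open>many_preimages\<close>). Near the cell with vertices
  \<open>\<alpha>\<^sub>0, \<dots>, \<alpha>\<^sub>N\<close>, dual to \<open>\<omega>\<close>, the substitution \<open>x = t\<^sup>-\<^sup>\<omega> y\<close> makes all the other
  monomials negligible. The remaining \<open>N + 1\<close> terms are prescribed up to a common factor by the
  barycentric coordinates of \<open>v\<close>. As the simplex is primitive, the signs of \<open>y\<close> can be chosen to match, and the
  logarithms of the terms are affine coordinates of \<open>log |y|\<close>; Brouwer's theorem absorbs the negligible terms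
  (\<open>perturbed_simplex_solution\<close>). Different cells give different points since different
  monomials dominate there. Finally the cells cover \<open>\<Delta>\<close> and a full-dimensional one has volume \<open>1 / N!\<close>, so there
  are at least \<open>M\<close> of them (\<open>volume_le_card_full_cells\<close>).
\<close>

section \<open>Monomials and exponents\<close>

definition mon :: "('v::finite \<Rightarrow>\<^sub>0 nat) \<Rightarrow> real ^ 'v \<Rightarrow> real" where
  "mon \<alpha> x = (\<Prod>i\<in>UNIV. (x $ i) ^ Poly_Mapping.lookup \<alpha> i)"

lemma mon_0 [simp]: "mon 0 x = 1"
  by (simp add: mon_def)

lemma mon_add: "mon (\<alpha> + \<beta>) x = mon \<alpha> x * mon \<beta> x"
  by (simp add: mon_def lookup_add power_add prod.distrib)

lemma mon_nonzero: "(\<And>i. x $ i \<noteq> 0) \<Longrightarrow> mon \<alpha> x \<noteq> 0"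
  by (simp add: mon_def)

lemma exponent_vec_add: "exponent_vec (\<alpha> + \<beta>) = exponent_vec \<alpha> + exponent_vec \<beta>"
  by (simp add: exponent_vec_def lookup_add vec_eq_iff)

lemma exponent_vec_inject [simp]: "exponent_vec \<alpha> = exponent_vec \<beta> \<longleftrightarrow> \<alpha> = \<beta>"
  by (auto simp: exponent_vec_def vec_eq_iff intro: poly_mapping_eqI)

lemma exponent_vec_nth [simp]: "exponent_vec \<alpha> $ i = real (Poly_Mapping.lookup \<alpha> i)"
  by (simp add: exponent_vec_def)

section \<open>Polynomial functions with few exponents are linearly dependent\<close>

lemma underdetermined_system:
  fixes M :: "'k \<Rightarrow> 'j \<Rightarrow> 'a::field"
  assumes "finite K" "finite J" "card K < card J"
  shows "\<exists>q. (\<exists>j\<in>J. q j \<noteq> 0) \<and> (\<forall>k\<in>K. (\<Sum>j\<in>J. q j * M k j) = 0)"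
  using assms
proof (induction K arbitrary: J M rule: finite_induct)
  case empty
  then have "J \<noteq> {}" by auto
  then show ?case by (intro exI[of _ "\<lambda>_. 1"]) auto
next
  case (insert k K)
  show ?case
  proof (cases "\<forall>j\<in>J. M k j = 0")
    case True
    obtain q where "\<exists>j\<in>J. q j \<noteq> 0" "\<forall>k\<in>K. (\<Sum>j\<in>J. q j * M k j) = 0"
      using insert.IH[of J M] insert.prems insert.hyps by auto
    then show ?thesis using True by (intro exI[of _ q]) auto
  next
    case False
    then obtain p where p: "p \<in> J" "M k p \<noteq> 0" by auto
    \<comment> \<open>elimination of the unknown \<open>p\<close> by means of equation \<open>k\<close>\<close>
    define M' where "M' = (\<lambda>l j. M l j - M l p * M k j / M k p)"
    have c: "card K < card (J - {p})"
      using insert.prems insert.hyps p by (simp add: card_Diff_singleton)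
    obtain q where q: "\<exists>j\<in>J-{p}. q j \<noteq> 0" "\<forall>l\<in>K. (\<Sum>j\<in>J-{p}. q j * M' l j) = 0"
      using insert.IH[of "J - {p}" M'] insert.prems c by auto
    define q' where "q' = q(p := - (\<Sum>j\<in>J-{p}. q j * M k j) / M k p)"
    have split: "(\<Sum>j\<in>J. q' j * M l j) = q' p * M l p + (\<Sum>j\<in>J-{p}. q j * M l j)" for l
      using insert.prems p by (subst sum.remove[of J p]) (auto simp: q'_def intro!: sum.cong)
    have "(\<Sum>j\<in>J. q' j * M k j) = 0"
      unfolding split using p by (simp add: q'_def)
    moreover have "(\<Sum>j\<in>J. q' j * M l j) = 0" if "l \<in> K" for l
    proof -
      have "0 = (\<Sum>j\<in>J-{p}. q j * M l j - M l p / M k p * (q j * M k j))"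
        using q(2) that unfolding M'_def by (auto simp: algebra_simps)
      also have "\<dots> = (\<Sum>j\<in>J-{p}. q j * M l j) - M l p / M k p * (\<Sum>j\<in>J-{p}. q j * M k j)"
        by (simp add: sum_subtractf sum_distrib_left)
      finally show ?thesis unfolding split by (simp add: q'_def field_simps)
    qed
    moreover have "\<exists>j\<in>J. q' j \<noteq> 0" using q(1) by (auto simp: q'_def)
    ultimately show ?thesis by (intro exI[of _ q']) auto
  qed
qed

primrec iterated_sumset :: "'a::comm_monoid_add set \<Rightarrow> nat \<Rightarrow> 'a set" where
  "iterated_sumset A 0 = {0}"
| "iterated_sumset A (Suc m) = (\<lambda>(a, s). a + s) ` (A \<times> iterated_sumset A m)"

lemma finite_iterated_sumset [simp]: "finite A \<Longrightarrow> finite (iterated_sumset A m)"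
  by (induction m) auto

lemma iterated_sumset_in_dilate:
  fixes A :: "('v::finite \<Rightarrow>\<^sub>0 nat) set"
  assumes "\<gamma> \<in> iterated_sumset A (Suc m)"
  shows "\<exists>p \<in> convex hull (exponent_vec ` A). exponent_vec \<gamma> = real (Suc m) *\<^sub>R p"
  using assms
proof (induction m arbitrary: \<gamma>)
  case 0
  then obtain a where "a \<in> A" "\<gamma> = a" by auto
  then show ?case by (intro bexI[of _ "exponent_vec a"]) (auto intro: hull_inc)
next
  case (Suc m)
  then obtain a s where as: "a \<in> A" "s \<in> iterated_sumset A (Suc m)" "\<gamma> = a + s"
    by (auto simp del: iterated_sumset.simps(2) simp: iterated_sumset.simps(2)[of A "Suc m"])
  then obtain p where p: "p \<in> convex hull (exponent_vec ` A)" "exponent_vec s = real (Suc m) *\<^sub>R p"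
    using Suc.IH by blast
  define r where "r = (1 / real (Suc (Suc m))) *\<^sub>R exponent_vec a + (real (Suc m) / real (Suc (Suc m))) *\<^sub>R p"
  have "r \<in> convex hull (exponent_vec ` A)" unfolding r_def
    using as p by (intro convexD[OF convex_convex_hull]) (auto intro: hull_inc simp: field_simps)
  moreover have "exponent_vec \<gamma> = real (Suc (Suc m)) *\<^sub>R r"
    unfolding r_def as(3) exponent_vec_add p(2) by (simp add: scaleR_add_right del: of_nat_Suc)
  ultimately show ?case by blast
qed

definition supported_poly_fun :: "('v::finite \<Rightarrow>\<^sub>0 nat) set \<Rightarrow> (real ^ 'v \<Rightarrow> real) \<Rightarrow> bool" where
  "supported_poly_fun S h \<longleftrightarrow> (\<exists>c. \<forall>x. h x = (\<Sum>\<gamma>\<in>S. c \<gamma> * mon \<gamma> x))"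

lemma supported_poly_fun_mult:
  assumes "finite A" "supported_poly_fun A h" "supported_poly_fun (iterated_sumset A m) g"
  shows "supported_poly_fun (iterated_sumset A (Suc m)) (\<lambda>x. h x * g x)"
proof -
  obtain c where c: "h x = (\<Sum>\<alpha>\<in>A. c \<alpha> * mon \<alpha> x)" for x
    using assms(2) unfolding supported_poly_fun_def by auto
  obtain d where d: "g x = (\<Sum>\<gamma>\<in>iterated_sumset A m. d \<gamma> * mon \<gamma> x)" for x
    using assms(3) unfolding supported_poly_fun_def by auto
  let ?P = "A \<times> iterated_sumset A m"
  let ?f = "\<lambda>(a, s). a + s"
  have "h x * g x = (\<Sum>\<gamma>\<in>iterated_sumset A (Suc m). (\<Sum>p | p \<in> ?P \<and> ?f p = \<gamma>. c (fst p) * d (snd p)) * mon \<gamma> x)" for x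
  proof -
    have "h x * g x = (\<Sum>p\<in>?P. (c (fst p) * d (snd p)) * mon (?f p) x)"
      unfolding c d sum_product sum.cartesian_product
      by (intro sum.cong) (auto simp: mon_add)
    also have "\<dots> = (\<Sum>\<gamma>\<in>?f ` ?P. \<Sum>p | p \<in> ?P \<and> ?f p = \<gamma>. (c (fst p) * d (snd p)) * mon (?f p) x)"
      using assms(1) by (intro sum.image_gen) auto
    also have "\<dots> = (\<Sum>\<gamma>\<in>?f ` ?P. (\<Sum>p | p \<in> ?P \<and> ?f p = \<gamma>. c (fst p) * d (snd p)) * mon \<gamma> x)"
      by (intro sum.cong refl) (auto simp: sum_distrib_right intro!: sum.cong)
    finally show ?thesis by simp
  qed
  then show ?thesis unfolding supported_poly_fun_def by fast
qed

lemma supported_poly_fun_prod_mset: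
  assumes "finite A" "\<And>k. k \<in># M \<Longrightarrow> supported_poly_fun A (l k)"
  shows "supported_poly_fun (iterated_sumset A (size M)) (\<lambda>x. \<Prod>k\<in>#M. l k x)"
  using assms(2)
proof (induction M)
  case empty
  show ?case by (auto simp: supported_poly_fun_def intro!: exI[of _ "\<lambda>_. 1"])
next
  case (add k M)
  then show ?case using supported_poly_fun_mult[OF assms(1), of "l k" "size M"] by simp
qed

lemma supported_poly_fun_power_mult:
  assumes "finite A" "supported_poly_fun A h" "supported_poly_fun (iterated_sumset A m) g"
  shows "supported_poly_fun (iterated_sumset A (b + m)) (\<lambda>x. h x ^ b * g x)"
proof (induction b)
  case 0
  then show ?case using assms by simp
next
  case (Suc b)
  then show ?case using supported_poly_fun_mult[OF assms(1,2), of "b + m"] by (simp add: mult.assoc)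
qed

lemma supported_poly_fun_dependent:
  assumes "finite S" "finite J" "card S < card J" "\<And>j. j \<in> J \<Longrightarrow> supported_poly_fun S (W j)"
  shows "\<exists>q. (\<exists>j\<in>J. q j \<noteq> 0) \<and> (\<forall>x. (\<Sum>j\<in>J. q j * W j x) = 0)"
proof -
  have "\<forall>j\<in>J. \<exists>c. \<forall>x. W j x = (\<Sum>\<gamma>\<in>S. c \<gamma> * mon \<gamma> x)"
    using assms(4) by (simp add: supported_poly_fun_def)
  then obtain C where C: "\<And>j x. j \<in> J \<Longrightarrow> W j x = (\<Sum>\<gamma>\<in>S. C j \<gamma> * mon \<gamma> x)"
    by metis
  obtain q where q: "\<exists>j\<in>J. q j \<noteq> 0" "\<forall>k\<in>S. (\<Sum>j\<in>J. q j * C j k) = 0"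
    using underdetermined_system[OF assms(1-3), of "\<lambda>k j. C j k"] by auto
  have "(\<Sum>j\<in>J. q j * W j x) = 0" for x
  proof -
    have "(\<Sum>j\<in>J. q j * W j x) = (\<Sum>j\<in>J. \<Sum>\<gamma>\<in>S. q j * C j \<gamma> * mon \<gamma> x)"
      by (intro sum.cong) (auto simp: C sum_distrib_left mult.assoc)
    also have "\<dots> = (\<Sum>\<gamma>\<in>S. (\<Sum>j\<in>J. q j * C j \<gamma>) * mon \<gamma> x)"
      by (subst sum.swap) (simp add: sum_distrib_right)
    finally show ?thesis using q by simp
  qed
  with q show ?thesis by auto
qed

text \<open>The half-open unit cubes with lower corners at distinct lattice points are disjoint, so the
  points of \<open>S\<close> can be counted by volume.\<close>

lemma card_lattice_le_measure:
  fixes S :: "('v::finite \<Rightarrow>\<^sub>0 nat) set" and T :: "(real ^ 'v) set"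
  assumes "finite S" "T \<in> sets lborel" "emeasure lborel T < \<infinity>"
    and sub: "\<And>\<gamma> y. \<gamma> \<in> S \<Longrightarrow> (\<And>i. 0 \<le> y $ i \<and> y $ i < 1) \<Longrightarrow> exponent_vec \<gamma> + y \<in> T"
  shows "real (card S) \<le> measure lborel T"
proof -
  define Q :: "('v \<Rightarrow>\<^sub>0 nat) \<Rightarrow> (real ^ 'v) set" where
    "Q = (\<lambda>\<gamma>. {z. \<forall>i. exponent_vec \<gamma> $ i \<le> z $ i \<and> z $ i < exponent_vec \<gamma> $ i + 1})"
  have Qs: "Q \<gamma> \<in> sets lborel" for \<gamma>
    unfolding Q_def by (simp) measurable
  have boxsub: "box (exponent_vec \<gamma>) (exponent_vec \<gamma> + 1) \<subseteq> Q \<gamma>" for \<gamma>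
    unfolding Q_def by (auto simp: mem_box_cart less_imp_le)
  have QT: "Q \<gamma> \<subseteq> T" if "\<gamma> \<in> S" for \<gamma>
  proof
    fix z assume "z \<in> Q \<gamma>"
    then have "exponent_vec \<gamma> + (z - exponent_vec \<gamma>) \<in> T"
      by (intro sub that) (simp_all add: Q_def, smt (verit))
    then show "z \<in> T" by simp
  qed
  have one: "1 \<le> emeasure lborel (Q \<gamma>)" for \<gamma> :: "'v \<Rightarrow>\<^sub>0 nat"
  proof -
    have "emeasure lborel (box (exponent_vec \<gamma>) (exponent_vec \<gamma> + 1)) = ennreal (\<Prod>b\<in>Basis. 1)"
    proof -
      have b: "(1 :: real ^ 'v) \<bullet> b = 1" if "b \<in> Basis" for b
        using that by (auto simp: Basis_vec_def inner_axis)
      then have "prod ((\<bullet>) (1 :: real ^ 'v)) Basis = (\<Prod>b\<in>(Basis :: (real ^ 'v) set). 1)"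
        by (intro prod.cong) auto
      moreover have "emeasure lborel (box (exponent_vec \<gamma>) (exponent_vec \<gamma> + 1))
          = ennreal (prod ((\<bullet>) (exponent_vec \<gamma> + 1 - exponent_vec \<gamma>)) Basis)"
        by (rule emeasure_lborel_box) (simp add: inner_add_left b)
      ultimately show ?thesis by simp
    qed
    then show ?thesis using emeasure_mono[OF boxsub Qs] by (metis prod.neutral_const ennreal_1)
  qed
  have disj: "disjoint_family_on Q S"
  proof (unfold disjoint_family_on_def, intro ballI impI)
    fix \<gamma> \<gamma>' :: "'v \<Rightarrow>\<^sub>0 nat" assume ne: "\<gamma> \<noteq> \<gamma>'"
    show "Q \<gamma> \<inter> Q \<gamma>' = {}"
    proof (rule ccontr)
      assume "Q \<gamma> \<inter> Q \<gamma>' \<noteq> {}"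
      then obtain z where z: "z \<in> Q \<gamma>" "z \<in> Q \<gamma>'" by blast
      have "Poly_Mapping.lookup \<gamma> i = Poly_Mapping.lookup \<gamma>' i" for i
      proof -
        have "real (Poly_Mapping.lookup \<gamma> i) \<le> z $ i" "z $ i < real (Poly_Mapping.lookup \<gamma> i) + 1"
          "real (Poly_Mapping.lookup \<gamma>' i) \<le> z $ i" "z $ i < real (Poly_Mapping.lookup \<gamma>' i) + 1"
          using z by (auto simp: Q_def)
        then show ?thesis by linarith
      qed
      then show False using ne by (auto intro: poly_mapping_eqI)
    qed
  qed
  have "of_nat (card S) = (\<Sum>\<gamma>\<in>S. (1::ennreal))" by simp
  also have "\<dots> \<le> (\<Sum>\<gamma>\<in>S. emeasure lborel (Q \<gamma>))" by (intro sum_mono one)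
  also have "\<dots> = emeasure lborel (\<Union>\<gamma>\<in>S. Q \<gamma>)"
    using assms(1) disj Qs by (intro sum_emeasure) auto
  also have "\<dots> \<le> emeasure lborel T" using QT assms(2) by (intro emeasure_mono) auto
  also have "\<dots> = ennreal (measure lborel T)"
    using assms(3) by (intro emeasure_eq_ennreal_measure) auto
  finally show ?thesis
    by (simp add: ennreal_of_nat_eq_real_of_nat)
qed

lemma measure_lborel_scale:
  fixes T :: "'a::euclidean_space set"
  assumes "T \<in> sets lborel"
  shows "measure lborel ((*\<^sub>R) m ` T) = \<bar>m\<bar> ^ DIM('a) * measure lborel T"
proof (cases "m = 0")
  case True
  then have "(*\<^sub>R) m ` T \<subseteq> {0}" by auto
  then have "(*\<^sub>R) m ` T \<in> {{}, {0}}" by auto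
  then show ?thesis using True by (auto)
next
  case False
  have "(*\<^sub>R) m ` T = (*\<^sub>R) (1/m) -` T"
    using False by (auto simp: image_iff intro!: bexI[of _ "(1/m) *\<^sub>R _"])
  moreover have "(*\<^sub>R) (1/m) -` T \<in> sets lborel"
    using measurable_sets_borel[of "(*\<^sub>R) (1/m)" borel T] assms by auto
  ultimately have m: "(*\<^sub>R) m ` T \<in> sets lborel" by simp
  show ?thesis
    using measure_lebesgue_affine[of m 0 T] assms m by (simp add: measure_completion)
qed

text \<open>The upper half of Ehrhart's asymptotics. A sum of \<open>m\<close> elements of \<open>A\<close> is a lattice point of the
  \<open>m\<close>-fold dilation of the Newton polytope, and its unit cube stays within distance \<open>N\<close> of that
  dilation. Scaled back by \<open>m\<close>, the cubes lie in the \<open>N / m\<close>-neighbourhood of the polytope, whose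
  volume tends to that of the compact polytope.\<close>

lemma eventually_card_iterated_sumset:
  fixes A :: "('v::finite \<Rightarrow>\<^sub>0 nat) set"
  assumes A: "finite A" "A \<noteq> {}" and c: "measure lborel (convex hull (exponent_vec ` A)) < c"
  shows "\<forall>\<^sub>F m in sequentially. real (card (iterated_sumset A m)) \<le> c * real m ^ CARD('v)"
proof -
  define D where "D = convex hull (exponent_vec ` A)"
  have Dc: "compact D" "D \<noteq> {}" unfolding D_def
    using A by (auto intro!: finite_imp_compact_convex_hull)
  define N where "N = CARD('v)"
  define T where "T = (\<lambda>m. {x. infdist x D \<le> real N / real (Suc m)})"
  have Tc: "compact (T m)" for m unfolding T_def
    using Dc by (intro compact_infdist_le) (auto simp: N_def)
  have "decseq T" unfolding T_def
    by (intro antimonoI) (auto intro: order_trans[OF _ divide_left_mono])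
  then have "(\<lambda>m. measure lborel (T m)) \<longlonglongrightarrow> measure lborel (\<Inter>m. T m)"
    using Tc emeasure_compact_finite[OF Tc] compact_imp_closed[OF Tc]
    by (intro Lim_measure_decseq) (auto simp: less_top[symmetric])
  moreover have "(\<Inter>m. T m) = D"
  proof
    have "0 \<le> real N / real (Suc m)" for m by simp
    then show "D \<subseteq> (\<Inter>m. T m)" by (auto simp: T_def simp del: of_nat_Suc)
    show "(\<Inter>m. T m) \<subseteq> D"
    proof
      fix x assume x: "x \<in> (\<Inter>m. T m)"
      have "infdist x D \<le> 0"
      proof (rule tendsto_lowerbound)
        show "(\<lambda>m. real N / real (Suc m)) \<longlonglongrightarrow> 0"
          by (rule LIMSEQ_Suc) (rule lim_const_over_n)
        show "\<forall>\<^sub>F m in sequentially. infdist x D \<le> real N / real (Suc m)"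
          using x by (auto simp: T_def)
      qed auto
      then have "infdist x D = 0" using infdist_nonneg[of x D] by linarith
      then show "x \<in> D" using in_closed_iff_infdist_zero[of D x] Dc compact_imp_closed by auto
    qed
  qed
  ultimately have "(\<lambda>m. measure lborel (T m)) \<longlonglongrightarrow> measure lborel D" by simp
  then have ev: "\<forall>\<^sub>F m in sequentially. measure lborel (T m) < c"
    using c unfolding D_def by (rule order_tendstoD)
  have bound: "real (card (iterated_sumset A (Suc m))) \<le> real (Suc m) ^ N * measure lborel (T m)" for m
  proof -
    let ?m = "real (Suc m)"
    have cT: "compact ((*\<^sub>R) ?m ` T m)" using Tc compact_scaling[of "T m"] by blast
    have "real (card (iterated_sumset A (Suc m))) \<le> measure lborel ((*\<^sub>R) ?m ` T m)"
    proof (rule card_lattice_le_measure)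
      show "finite (iterated_sumset A (Suc m))" using A finite_iterated_sumset by blast
      show "(*\<^sub>R) ?m ` T m \<in> sets lborel" using borel_closed[OF compact_imp_closed[OF cT]] by simp
      show "emeasure lborel ((*\<^sub>R) ?m ` T m) < \<infinity>" using emeasure_compact_finite[OF cT] by simp
    next
      fix \<gamma> and y :: "real ^ 'v"
      assume g: "\<gamma> \<in> iterated_sumset A (Suc m)" and y: "\<And>i. 0 \<le> y $ i \<and> y $ i < 1"
      obtain p where p: "p \<in> D" "exponent_vec \<gamma> = ?m *\<^sub>R p"
        using iterated_sumset_in_dilate[OF g] unfolding D_def by blast
      have "norm y \<le> (\<Sum>i\<in>UNIV. \<bar>y $ i\<bar>)" by (rule norm_le_l1_cart)
      also have "\<dots> \<le> (\<Sum>i\<in>(UNIV::'v set). 1)" using y by (intro sum_mono) (simp add: less_imp_le)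
      finally have ny: "norm y \<le> real N" by (simp add: N_def)
      have "infdist (p + (1/?m) *\<^sub>R y) D \<le> real N / ?m"
        by (rule infdist_le2[OF p(1)]) (use ny in \<open>simp add: dist_norm divide_simps\<close>)
      then have "p + (1/?m) *\<^sub>R y \<in> T m" by (simp add: T_def)
      moreover have "exponent_vec \<gamma> + y = ?m *\<^sub>R (p + (1/?m) *\<^sub>R y)"
        using p by (simp add: scaleR_add_right del: of_nat_Suc)
      ultimately show "exponent_vec \<gamma> + y \<in> (*\<^sub>R) ?m ` T m" by blast
    qed
    also have "\<dots> = ?m ^ N * measure lborel (T m)"
      using compact_imp_closed[OF Tc] by (subst measure_lborel_scale) (auto simp: N_def)
    finally show ?thesis .
  qed
  have "\<forall>\<^sub>F m in sequentially. real (card (iterated_sumset A (Suc m))) \<le> c * real (Suc m) ^ N"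
    using ev
  proof eventually_elim
    case (elim m)
    have "real (Suc m) ^ N * measure lborel (T m) \<le> real (Suc m) ^ N * c"
      using elim by (intro mult_left_mono) auto
    with bound[of m] have "real (card (iterated_sumset A (Suc m))) \<le> real (Suc m) ^ N * c" by (rule order_trans)
    then show ?case by (simp only: mult.commute)
  qed
  then show ?thesis unfolding N_def
    by (rule eventually_sequentially_Suc[of "\<lambda>m. real (card (iterated_sumset A m)) \<le> c * real m ^ CARD('v)", THEN iffD1])
qed

lemma card_multisets_ge:
  "real k ^ CARD('v) / fact CARD('v) \<le> real (card (multisets_of_size (UNIV :: 'v::finite option set) k))"
proof -
  let ?N = "CARD('v)"
  have "card (multisets_of_size (UNIV :: 'v option set) k) = (k + ?N) choose k"
    by (subst card_multisets_of_size) (auto simp: card_UNIV_option add.commute)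
  also have "\<dots> = (k + ?N) choose ?N" by (simp add: binomial_symmetric[of k "k + ?N"])
  finally have *: "card (multisets_of_size (UNIV :: 'v option set) k) = (k + ?N) choose ?N" .
  have "real k ^ n / fact n \<le> real ((k + n) choose n)" for n
  proof (induction n)
    case (Suc n)
    have "real k ^ Suc n / fact (Suc n) = (real k ^ n / fact n) * (real k / real (Suc n))"
      by (simp add: mult.commute)
    also have "\<dots> \<le> real ((k + n) choose n) * (real (k + Suc n) / real (Suc n))"
      by (intro mult_mono Suc.IH divide_right_mono) auto
    also have "\<dots> = real ((k + Suc n) choose Suc n)"
      using Suc_times_binomial_eq[of "k + n" n]
      by (simp add: field_simps del: of_nat_Suc of_nat_add flip: of_nat_mult)
    finally show ?case .
  qed auto
  then show ?thesis unfolding * .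
qed

text \<open>Labels of the products of total degree \<open>m\<close> in \<open>N + 2\<close> polynomials: \<open>(M, b)\<close> stands for the product of the
  polynomials listed in \<open>M\<close> with the \<open>b\<close>-th power of one more. The label \<open>None\<close> is meant for the
  polynomial whose zeros are counted and \<open>Some i\<close> for its \<open>i\<close>-th logarithmic derivative.\<close>

definition form_index :: "nat \<Rightarrow> nat \<Rightarrow> ('v option multiset \<times> nat) set" where
  "form_index D m = {(M, b). b < D \<and> size M + b = m}"

lemma form_index_eq:
  assumes "D \<le> m"
  shows "form_index D m = (\<lambda>(b, M). (M, b)) ` (SIGMA b:{..<D}. multisets_of_size UNIV (m - b))"
  using assms by (auto simp: form_index_def multisets_of_size_def image_iff)

lemma finite_form_index: "D \<le> m \<Longrightarrow> finite (form_index D m :: ('v::finite option multiset \<times> nat) set)"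
  by (subst form_index_eq) (auto intro!: finite_imageI finite_SigmaI)

lemma card_form_index_ge:
  assumes "D \<le> m"
  shows "real D * (real (m - D) ^ CARD('v) / fact CARD('v))
    \<le> real (card (form_index D m :: ('v::finite option multiset \<times> nat) set))"
proof -
  have "card (form_index D m :: ('v option multiset \<times> nat) set)
      = card (SIGMA b:{..<D}. multisets_of_size (UNIV :: 'v option set) (m - b))"
    by (subst form_index_eq[OF assms], rule card_image) (auto simp: inj_on_def)
  also have "\<dots> = (\<Sum>b<D. card (multisets_of_size (UNIV :: 'v option set) (m - b)))"
    by (subst card_SigmaI) auto
  finally have "real (card (form_index D m :: ('v option multiset \<times> nat) set))
      = (\<Sum>b<D. real (card (multisets_of_size (UNIV :: 'v option set) (m - b))))" by simp
  moreover have "(\<Sum>b<D. real (m - D) ^ CARD('v) / fact CARD('v))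
      \<le> (\<Sum>b<D. real (card (multisets_of_size (UNIV :: 'v option set) (m - b))))"
  proof (intro sum_mono)
    fix b assume "b \<in> {..<D}"
    then have "real (m - D) ^ CARD('v) / fact CARD('v) \<le> real (m - b) ^ CARD('v) / fact CARD('v)"
      by (intro divide_right_mono power_mono) auto
    also note card_multisets_ge
    finally show "real (m - D) ^ CARD('v) / fact CARD('v)
      \<le> real (card (multisets_of_size (UNIV :: 'v option set) (m - b)))" .
  qed
  ultimately show ?thesis by simp
qed

text \<open>There are at least \<open>D (m - D)\<^sup>N / N!\<close> labels, whereas the exponents number at most \<open>c m\<^sup>N\<close> for any
  constant \<open>c\<close> above the volume. The leading coefficients decide for large \<open>m\<close>.\<close>

lemma more_forms_than_lattice_points:
  fixes A :: "('v::finite \<Rightarrow>\<^sub>0 nat) set"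
  assumes A: "finite A" "A \<noteq> {}"
    and D: "fact CARD('v) * measure lborel (convex hull (exponent_vec ` A)) < real D"
  shows "\<exists>m\<ge>D. card (iterated_sumset A m) < card (form_index D m :: ('v option multiset \<times> nat) set)"
proof -
  let ?N = "CARD('v)" and ?V = "measure lborel (convex hull (exponent_vec ` A))"
  have "?V < real D / fact ?N" using D by (simp add: field_simps)
  then obtain c where c: "?V < c" "c < real D / fact ?N" using dense by blast
  have "(\<lambda>m. real D / fact ?N * ((real m - real D) / real m) ^ ?N) \<longlonglongrightarrow> real D / fact ?N * 1 ^ ?N"
  proof (intro tendsto_intros)
    have "(\<lambda>m. 1 - real D / real m) \<longlonglongrightarrow> 1 - 0"
      by (intro tendsto_intros lim_const_over_n)
    moreover have "\<forall>\<^sub>F m in sequentially. 1 - real D / real m = (real m - real D) / real m"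
      using eventually_gt_at_top[of 0] by eventually_elim (auto simp: field_simps)
    ultimately show "(\<lambda>m. (real m - real D) / real m) \<longlonglongrightarrow> 1"
      by (simp add: tendsto_cong)
  qed
  then have "\<forall>\<^sub>F m in sequentially. c < real D / fact ?N * ((real m - real D) / real m) ^ ?N"
    by (rule order_tendstoD(1)) (use c(2) in simp)
  moreover have "\<forall>\<^sub>F m in sequentially. real (card (iterated_sumset A m)) \<le> c * real m ^ ?N"
    by (rule eventually_card_iterated_sumset[OF A c(1)])
  moreover have "\<forall>\<^sub>F m in sequentially. m > D" by (rule eventually_gt_at_top)
  ultimately have "\<forall>\<^sub>F m in sequentially. m > D \<and> card (iterated_sumset A m) < card (form_index D m :: ('v option multiset \<times> nat) set)"
  proof eventually_elim
    case (elim m)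
    have "real (card (iterated_sumset A m)) \<le> c * real m ^ ?N" by (rule elim)
    also have "\<dots> < real D / fact ?N * ((real m - real D) / real m) ^ ?N * real m ^ ?N"
      using elim by (intro mult_strict_right_mono) auto
    also have "\<dots> = real D * (real (m - D) ^ ?N / fact ?N)"
      using elim by (simp add: power_divide of_nat_diff)
    also have "\<dots> \<le> real (card (form_index D m :: ('v option multiset \<times> nat) set))"
      using elim by (intro card_form_index_ge) auto
    finally show ?case using elim by simp
  qed
  from eventually_happens[OF this] show ?thesis by (auto intro: less_imp_le)
qed

section \<open>Null sets of homogeneous polynomials\<close>

text \<open>The translates of \<open>Z\<close> by the vectors \<open>e / (k + 1)\<close> cover no point more than \<open>d\<close> times, because every line
  in direction \<open>e\<close> meets \<open>Z\<close> at most \<open>d\<close> times. A bounded piece of \<open>Z\<close> of positive measure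
  would have infinitely many translates of that measure inside one ball.\<close>

lemma emeasure_zero_if_finite_line_sections:
  fixes Z :: "'a::euclidean_space set"
  assumes Z: "Z \<in> sets lborel"
    and fin: "\<And>z. finite {s. z + s *\<^sub>R e \<in> Z} \<and> card {s. z + s *\<^sub>R e \<in> Z} \<le> d"
  shows "Z \<in> null_sets lborel"
proof -
  have null: "emeasure lborel (Z \<inter> cball 0 r) = 0" for r
  proof -
    define Y where "Y = Z \<inter> cball 0 r"
    have Y: "Y \<in> sets borel" using Z by (simp add: Y_def)
    define C where "C = emeasure lborel (cball (0::'a) (r + norm e))"
    have C: "C < \<infinity>" unfolding C_def using emeasure_compact_finite[of "cball (0::'a) (r + norm e)"] by simp
    define c where "c = (\<lambda>k. (1 / real (Suc k)) *\<^sub>R e)"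
    have le: "of_nat K * emeasure lborel Y \<le> of_nat d * C" for K
    proof -
      have shift: "(\<integral>\<^sup>+x. indicator Y (c k + x) \<partial>lborel) = emeasure lborel Y" for k
      proof -
        have "emeasure lborel Y = (\<integral>\<^sup>+x. indicator Y x \<partial>distr lborel borel ((+) (c k)))"
          using Y by (simp add: lborel_distr_plus)
        also have "\<dots> = (\<integral>\<^sup>+x. indicator Y (c k + x) \<partial>lborel)"
          using Y by (intro nn_integral_distr) auto
        finally show ?thesis by simp
      qed
      have pw: "(\<Sum>k<K. indicator Y (c k + x)) \<le> (of_nat d * indicator (cball 0 (r + norm e)) x :: ennreal)" for x
      proof (cases "\<exists>k<K. c k + x \<in> Y")
        case True
        then obtain k where k: "c k + x \<in> Y" by auto
        have "norm (c k) \<le> norm e" by (simp add: c_def divide_simps mult_le_cancel_left1)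
        moreover have "norm (c k + x) \<le> r" using k by (simp add: Y_def)
        moreover have "norm x \<le> norm (c k + x) + norm (c k)"
          using norm_triangle_ineq4[of "c k + x" "c k"] by simp
        ultimately have x: "norm x \<le> r + norm e" by linarith
        have "(\<Sum>k<K. indicator Y (c k + x) :: ennreal) = of_nat (card {k\<in>{..<K}. c k + x \<in> Y})"
          by (simp add: indicator_def sum.If_cases Int_def)
        also have "card {k\<in>{..<K}. c k + x \<in> Y} \<le> card {s. x + s *\<^sub>R e \<in> Z}"
        proof (rule card_inj_on_le)
          show "inj_on (\<lambda>k. 1 / real (Suc k)) {k\<in>{..<K}. c k + x \<in> Y}" by (auto simp: inj_on_def)
          show "(\<lambda>k. 1 / real (Suc k)) ` {k\<in>{..<K}. c k + x \<in> Y} \<subseteq> {s. x + s *\<^sub>R e \<in> Z}"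
            by (auto simp: c_def Y_def add.commute)
          show "finite {s. x + s *\<^sub>R e \<in> Z}" using fin by auto
        qed
        also have "\<dots> \<le> d" using fin by auto
        finally show ?thesis using x by simp
      qed (auto intro!: sum_nonneg simp: sum_nonneg_eq_0_iff)
      have "of_nat K * emeasure lborel Y = (\<Sum>k<K. \<integral>\<^sup>+x. indicator Y (c k + x) \<partial>lborel)"
        unfolding shift by simp
      also have "\<dots> = (\<integral>\<^sup>+x. (\<Sum>k<K. indicator Y (c k + x)) \<partial>lborel)"
        using Y by (intro nn_integral_sum[symmetric] measurable_compose[OF _ borel_measurable_indicator]) auto
      also have "\<dots> \<le> (\<integral>\<^sup>+x. of_nat d * indicator (cball (0::'a) (r + norm e)) x \<partial>lborel)"
        using pw by (simp add: nn_integral_mono)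
      also have "\<dots> = of_nat d * C" unfolding C_def by (subst nn_integral_cmult_indicator) auto
      finally show ?thesis .
    qed
    have fC: "of_nat d * C < \<infinity>" using C by (simp add: ennreal_mult_less_top of_nat_less_top)
    have "emeasure lborel Y < \<infinity>" using le[of 1] fC by (simp add: le_less_trans)
    then obtain y where y: "emeasure lborel Y = ennreal y" "y \<ge> 0"
      by (cases "emeasure lborel Y") auto
    obtain u where u: "of_nat d * C = ennreal u" "u \<ge> 0" using fC by (cases "of_nat d * C") auto
    have "real K * y \<le> u" for K
      using le[of K] y u by (simp add: ennreal_of_nat_eq_real_of_nat flip: ennreal_mult)
    then have "y = 0"
      using y(2) by (metis ex_less_of_nat_mult less_le not_le)
    then show ?thesis using y by (simp add: Y_def)
  qed
  have "Z = (\<Union>r::nat. Z \<inter> cball 0 (real r))"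
    using real_arch_simple by (auto simp: dist_norm)
  moreover have "(\<Union>r::nat. Z \<inter> cball 0 (real r)) \<in> null_sets lborel"
    using null Z by (intro null_sets_UN) (auto simp: null_sets_def)
  ultimately show ?thesis by simp
qed

text \<open>Each sum is the value at \<open>s\<close> of a nonzero polynomial, and finitely many nonzero polynomials have a
  common natural number at which none of them vanishes. This supplies all the generic choices below.\<close>

lemma exists_generic_power_combination:
  fixes C :: "('i \<Rightarrow> real) set" and idx :: "'i \<Rightarrow> nat"
  assumes "finite I" "inj_on idx I" "finite C" "\<And>c. c \<in> C \<Longrightarrow> \<exists>i\<in>I. c i \<noteq> 0"
  shows "\<exists>s::nat. \<forall>c\<in>C. (\<Sum>i\<in>I. c i * real s ^ idx i) \<noteq> 0"
proof -
  define p :: "('i \<Rightarrow> real) \<Rightarrow> real poly" where "p = (\<lambda>c. \<Sum>i\<in>I. monom (c i) (idx i))"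
  have "p c \<noteq> 0" if c: "c \<in> C" for c
  proof -
    obtain i where i: "i \<in> I" "c i \<noteq> 0" using assms(4)[OF c] by auto
    have "coeff (p c) (idx i) = (\<Sum>j\<in>I. if j = i then c j else 0)"
      unfolding p_def coeff_sum using i assms(2) by (intro sum.cong) (auto simp: inj_on_def)
    also have "\<dots> = c i" using assms(1) i by simp
    finally show ?thesis using i by auto
  qed
  then have "finite (\<Union>c\<in>C. {x. poly (p c) x = 0})"
    using assms(3) poly_roots_finite by blast
  moreover have "infinite (range real)" by (simp add: infinite_UNIV_nat finite_image_iff inj_on_def)
  ultimately obtain s where "real s \<notin> (\<Union>c\<in>C. {x. poly (p c) x = 0})"
    by (meson finite_subset image_subset_iff subsetI)
  then show ?thesis by (intro exI[of _ s]) (auto simp: p_def poly_sum poly_monom)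
qed

text \<open>Exceptional sets of directions; invariance under scaling lets them descend to null sets of lines.\<close>

definition null_cone :: "'a::euclidean_space set \<Rightarrow> bool" where
  "null_cone B \<longleftrightarrow> B \<in> null_sets lborel \<and> (\<forall>v\<in>B. \<forall>r. r \<noteq> 0 \<longrightarrow> r *\<^sub>R v \<in> B)"

lemma null_cone_UN:
  fixes B :: "'i \<Rightarrow> 'a::euclidean_space set"
  assumes "countable I" "\<And>i. i \<in> I \<Longrightarrow> null_cone (B i)" shows "null_cone (\<Union>i\<in>I. B i)"
  using assms by (auto simp: null_cone_def intro: null_sets_UN')

lemma continuous_prod_mset_comp [continuous_intros]:
  fixes f :: "'k \<Rightarrow> 'a::topological_space \<Rightarrow> real"
  assumes "\<And>k. k \<in># M \<Longrightarrow> continuous_on S (f k)"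
  shows "continuous_on S (\<lambda>x. \<Prod>k\<in>#M. f k x)"
  using assms by (induction M) (auto intro!: continuous_intros)

text \<open>Evaluation on a monomial curve gives different powers of the parameter to different monomials, so the
  polynomial is nonzero at some \<open>e\<close>. By homogeneity that value is the leading coefficient of the
  polynomial on every line in direction \<open>e\<close>, which bounds the number of zeros on such a line.\<close>

lemma null_cone_homogeneous:
  fixes J :: "'v::finite multiset set"
  assumes J: "finite J" "\<And>a. a \<in> J \<Longrightarrow> size a = d" and q: "a0 \<in> J" "q a0 \<noteq> 0"
  shows "null_cone {v :: real ^ 'v. (\<Sum>a\<in>J. q a * (\<Prod>i\<in>#a. v $ i)) = 0}"
proof -
  define Q :: "real ^ 'v \<Rightarrow> real" where "Q = (\<lambda>v. \<Sum>a\<in>J. q a * (\<Prod>i\<in>#a. v $ i))"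
  have "\<exists>ix. bij_betw ix (UNIV :: 'v set) {0..<CARD('v)}" by (rule ex_bij_betw_finite_nat) simp
  then obtain ix :: "'v \<Rightarrow> nat" where ix: "inj_on ix UNIV" unfolding bij_betw_def by (elim exE conjE)
  \<comment> \<open>powers of a number \<open>s\<close> that is generic for these differences are weights under which the monomials have different degrees\<close>
  define C where "C = (\<lambda>(a, b). (\<lambda>i. real (count a i) - real (count b i))) ` {(a, b) \<in> J \<times> J. a \<noteq> b}"
  have "finite C" unfolding C_def
    by (rule finite_imageI, rule finite_subset[of _ "J \<times> J"]) (use J in auto)
  moreover have "\<exists>i\<in>UNIV. c i \<noteq> 0" if "c \<in> C" for c
    using that by (auto simp: C_def multiset_eq_iff)
  ultimately obtain s :: nat where s: "\<And>c. c \<in> C \<Longrightarrow> (\<Sum>i\<in>UNIV. c i * real s ^ ix i) \<noteq> 0"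
    using exists_generic_power_combination[of UNIV ix C] ix by auto
  define w where "w = (\<lambda>a :: 'v multiset. \<Sum>i\<in>UNIV. count a i * s ^ ix i)"
  have winj: "inj_on w J"
  proof (rule inj_onI, rule ccontr)
    fix a b assume ab: "a \<in> J" "b \<in> J" "w a = w b" "a \<noteq> b"
    then have "(\<lambda>i. real (count a i) - real (count b i)) \<in> C" by (auto simp: C_def image_iff intro!: bexI[of _ "(a, b)"])
    then have "(\<Sum>i\<in>UNIV. (real (count a i) - real (count b i)) * real s ^ ix i) \<noteq> 0" by (rule s)
    moreover have "(\<Sum>i\<in>UNIV. (real (count a i) - real (count b i)) * real s ^ ix i) = real (w a) - real (w b)"
      by (simp add: w_def left_diff_distrib sum_subtractf)
    ultimately show False using ab by simp
  qed
  obtain t :: nat where "(\<Sum>a\<in>J. q a * real t ^ w a) \<noteq> 0"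
    using exists_generic_power_combination[of J w "{q}"] J q winj by auto
  moreover have "(\<Prod>i\<in>#a. (\<chi> i. real t ^ (s ^ ix i)) $ i) = real t ^ w a" for a
  proof (induction a)
    case (add k a)
    have "w (add_mset k a) = (\<Sum>i\<in>UNIV. (if i = k then s ^ ix i else 0) + count a i * s ^ ix i)"
      unfolding w_def by (intro sum.cong) auto
    also have "\<dots> = s ^ ix k + w a" by (simp add: sum.distrib w_def)
    finally show ?case using add by (simp add: power_add)
  qed (simp add: w_def)
  ultimately have "Q (\<chi> i. real t ^ (s ^ ix i)) \<noteq> 0"
    by (simp add: Q_def del: vec_lambda_beta)
  then obtain e where e: "Q e \<noteq> 0" by blast
  have Qscale: "Q (r *\<^sub>R v) = r ^ d * Q v" for r v
  proof -
    have "(\<Prod>i\<in>#a. (r *\<^sub>R v) $ i) = r ^ size a * (\<Prod>i\<in>#a. v $ i)" for a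
      by (induction a) (auto simp: algebra_simps)
    then show ?thesis unfolding Q_def using J by (simp add: sum_distrib_left mult.left_commute del: vector_scaleR_component)
  qed
  define Z where "Z = {v. Q v = 0}"
  have Zm: "Z \<in> sets lborel"
  proof -
    have "continuous_on UNIV Q" unfolding Q_def by (intro continuous_intros)
    then have "closed Z" unfolding Z_def by (intro closed_Collect_eq) (auto intro: continuous_intros)
    then show ?thesis by simp
  qed
  have "finite {s. z + s *\<^sub>R e \<in> Z} \<and> card {s. z + s *\<^sub>R e \<in> Z} \<le> d" for z
  proof -
    define P where "P = (\<Sum>a\<in>J. smult (q a) (\<Prod>i\<in>#a. [:z $ i, e $ i:]))"
    have lin: "poly (\<Prod>i\<in>#a. [:z $ i, e $ i:]) s = (\<Prod>i\<in>#a. (z + s *\<^sub>R e) $ i)" for a s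
      by (induction a) (auto simp: algebra_simps)
    have deg: "degree (\<Prod>i\<in>#a. [:z $ i, e $ i:]) \<le> size a \<and> coeff (\<Prod>i\<in>#a. [:z $ i, e $ i:]) (size a) = (\<Prod>i\<in>#a. e $ i)" for a
    proof (induction a)
      case (add k a)
      let ?p = "\<Prod>i\<in>#a. [:z $ i, e $ i:]"
      have "degree [:z $ k, e $ k:] \<le> 1" by simp
      then have "degree ([:z $ k, e $ k:] * ?p) \<le> Suc (size a)"
        using add.IH degree_mult_le[of "[:z $ k, e $ k:]" ?p] by linarith
      moreover have "coeff ([:z $ k, e $ k:] * ?p) (Suc (size a)) = e $ k * (\<Prod>i\<in>#a. e $ i)"
        using add by (simp add: coeff_eq_0)
      ultimately show ?case by simp
    qed auto
    have poly: "poly P s = Q (z + s *\<^sub>R e)" for s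
      by (simp add: P_def Q_def poly_sum lin del: vector_add_component vector_scaleR_component)
    have dP: "degree P \<le> d" unfolding P_def
      using deg J by (intro degree_sum_le) (auto intro: order_trans[OF degree_smult_le])
    have "coeff P d = Q e"
    proof -
      have "coeff P d = (\<Sum>a\<in>J. q a * coeff (\<Prod>i\<in>#a. [:z $ i, e $ i:]) (size a))"
        unfolding P_def coeff_sum using J by (intro sum.cong) auto
      then show ?thesis using deg by (simp add: Q_def)
    qed
    then have P0: "P \<noteq> 0" using e by auto
    have "{s. z + s *\<^sub>R e \<in> Z} = {s. poly P s = 0}" by (simp add: Z_def poly)
    then show ?thesis using poly_roots_finite[OF P0] card_poly_roots_bound[OF P0] dP by auto
  qed
  then have "Z \<in> null_sets lborel" by (rule emeasure_zero_if_finite_line_sections[OF Zm])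
  moreover have "r *\<^sub>R v \<in> Z" if "v \<in> Z" for r v using that by (simp add: Z_def Qscale)
  ultimately show ?thesis by (simp add: null_cone_def Z_def Q_def)
qed

section \<open>Exponents that generate the lattice affinely\<close>

text \<open>Integer combinations with coefficient sum \<open>0\<close> are the combinations of differences of elements of \<open>A\<close>; the
  condition is that they give every unit vector, hence the whole lattice.\<close>

definition affinely_generates :: "('v::finite \<Rightarrow>\<^sub>0 nat) set \<Rightarrow> bool" where
  "affinely_generates A \<longleftrightarrow> (\<forall>i. \<exists>k :: _ \<Rightarrow> int.
     (\<Sum>\<alpha>\<in>A. k \<alpha>) = 0 \<and> (\<Sum>\<alpha>\<in>A. of_int (k \<alpha>) *\<^sub>R exponent_vec \<alpha>) = axis i 1)"

lemma power_int_of_sum: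
  fixes y :: "'a::field"
  assumes "y \<noteq> 0" shows "(\<Prod>i\<in>I. y powi f i) = y powi (\<Sum>i\<in>I. f i)"
  using assms by (induction I rule: infinite_finite_induct) (auto simp: power_int_add)

lemma power_int_of_prod:
  fixes f :: "'i \<Rightarrow> 'a::field"
  shows "(\<Prod>i\<in>I. f i) powi n = (\<Prod>i\<in>I. f i powi n)"
  by (induction I rule: infinite_finite_induct) (auto simp: power_int_mult_distrib)

text \<open>Taking monomials turns the combination of exponents into a product of powers.\<close>

lemma coordinate_from_monomials:
  fixes y :: "real ^ 'v::finite"
  assumes y: "\<And>i. y $ i \<noteq> 0" and k: "(\<Sum>\<alpha>\<in>A. of_int (k \<alpha>) *\<^sub>R exponent_vec \<alpha>) = axis i 1"
  shows "(\<Prod>\<alpha>\<in>A. mon \<alpha> y powi k \<alpha>) = y $ i"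
proof -
  have s: "(\<Sum>\<alpha>\<in>A. k \<alpha> * int (Poly_Mapping.lookup \<alpha> j)) = (if j = i then 1 else 0)" for j
  proof -
    have "real_of_int (\<Sum>\<alpha>\<in>A. k \<alpha> * int (Poly_Mapping.lookup \<alpha> j))
        = (\<Sum>\<alpha>\<in>A. of_int (k \<alpha>) *\<^sub>R exponent_vec \<alpha>) $ j" by simp
    also have "\<dots> = (if j = i then 1 else 0)" unfolding k by (simp add: axis_def)
    finally show ?thesis by (metis of_int_0 of_int_1 of_int_eq_iff)
  qed
  have "(\<Prod>\<alpha>\<in>A. mon \<alpha> y powi k \<alpha>)
      = (\<Prod>\<alpha>\<in>A. \<Prod>j\<in>UNIV. y $ j powi (k \<alpha> * int (Poly_Mapping.lookup \<alpha> j)))"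
    unfolding mon_def power_int_of_prod
    by (intro prod.cong refl) (metis mult.commute power_int_mult power_int_of_nat)
  also have "\<dots> = (\<Prod>j\<in>UNIV. y $ j powi (\<Sum>\<alpha>\<in>A. k \<alpha> * int (Poly_Mapping.lookup \<alpha> j)))"
    by (subst prod.swap) (simp add: power_int_of_sum y)
  also have "\<dots> = (\<Prod>j\<in>UNIV. if j = i then y $ j else 1)" unfolding s by (intro prod.cong) auto
  also have "\<dots> = y $ i" by simp
  finally show ?thesis .
qed

text \<open>The map from the real torus to projective space given by the monomials of \<open>A\<close> is injective: a
  common factor cancels from every product of powers with exponent sum \<open>0\<close>, and such products recover
  the coordinates.\<close>

lemma monomials_proportional_imp_eq:
  fixes x y :: "real ^ 'v::finite"
  assumes A: "affinely_generates A"
    and xy: "\<And>i. x $ i \<noteq> 0" "\<And>i. y $ i \<noteq> 0"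
    and c: "c \<noteq> 0" "\<And>\<alpha>. \<alpha> \<in> A \<Longrightarrow> mon \<alpha> x = c * mon \<alpha> y"
  shows "x = y"
proof -
  have "x $ i = y $ i" for i
  proof -
    obtain k :: "_ \<Rightarrow> int" where k: "(\<Sum>\<alpha>\<in>A. k \<alpha>) = 0"
      "(\<Sum>\<alpha>\<in>A. of_int (k \<alpha>) *\<^sub>R exponent_vec \<alpha>) = axis i 1"
      using A unfolding affinely_generates_def by meson
    have "x $ i = (\<Prod>\<alpha>\<in>A. mon \<alpha> x powi k \<alpha>)" using coordinate_from_monomials[OF xy(1) k(2)] by simp
    also have "\<dots> = (\<Prod>\<alpha>\<in>A. c powi k \<alpha> * mon \<alpha> y powi k \<alpha>)"
      by (intro prod.cong) (auto simp: c power_int_mult_distrib)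
    also have "\<dots> = (\<Prod>\<alpha>\<in>A. mon \<alpha> y powi k \<alpha>)"
      using k(1) c(1) by (simp add: prod.distrib power_int_of_sum)
    also have "\<dots> = y $ i" using coordinate_from_monomials[OF xy(2) k(2)] by simp
    finally show ?thesis .
  qed
  then show ?thesis by (simp add: vec_eq_iff)
qed

lemma affinely_generates_mono:
  assumes "affinely_generates \<sigma>" "\<sigma> \<subseteq> A" "finite A" shows "affinely_generates A"
  unfolding affinely_generates_def
proof
  fix i
  obtain k :: "_ \<Rightarrow> int" where k: "(\<Sum>\<alpha>\<in>\<sigma>. k \<alpha>) = 0" "(\<Sum>\<alpha>\<in>\<sigma>. of_int (k \<alpha>) *\<^sub>R exponent_vec \<alpha>) = axis i 1"
    using assms(1) unfolding affinely_generates_def by meson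
  have "(\<Sum>\<alpha>\<in>A. if \<alpha> \<in> \<sigma> then k \<alpha> else 0) = 0"
    using k(1) assms by (simp add: sum.If_cases Int_absorb1)
  moreover have "(\<Sum>\<alpha>\<in>A. of_int (if \<alpha> \<in> \<sigma> then k \<alpha> else 0) *\<^sub>R exponent_vec \<alpha>) = axis i 1"
    unfolding k(2)[symmetric] using assms by (intro sum.mono_neutral_cong_right) auto
  ultimately show "\<exists>k :: _ \<Rightarrow> int. (\<Sum>\<alpha>\<in>A. k \<alpha>) = 0 \<and> (\<Sum>\<alpha>\<in>A. of_int (k \<alpha>) *\<^sub>R exponent_vec \<alpha>) = axis i 1"
    by (intro exI[of _ "\<lambda>\<alpha>. if \<alpha> \<in> \<sigma> then k \<alpha> else 0"]) simp
qed

section \<open>An upper bound for the fibres of the logarithmic Gauss map\<close>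

definition poly_fun :: "('v::finite \<Rightarrow>\<^sub>0 nat) set \<Rightarrow> (('v \<Rightarrow>\<^sub>0 nat) \<Rightarrow> real) \<Rightarrow> real ^ 'v \<Rightarrow> real" where
  "poly_fun A c x = (\<Sum>\<alpha>\<in>A. c \<alpha> * mon \<alpha> x)"

text \<open>The vector of the \<open>x\<^sub>i \<partial>p/\<partial>x\<^sub>i\<close> for \<open>p = poly_fun A c\<close>.\<close>

definition log_gradient :: "('v::finite \<Rightarrow>\<^sub>0 nat) set \<Rightarrow> (('v \<Rightarrow>\<^sub>0 nat) \<Rightarrow> real) \<Rightarrow> real ^ 'v \<Rightarrow> real ^ 'v" where
  "log_gradient A c x = (\<Sum>\<alpha>\<in>A. (c \<alpha> * mon \<alpha> x) *\<^sub>R exponent_vec \<alpha>)"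

text \<open>The fibre of the logarithmic Gauss map over the line supported_poly_fun by \<open>v\<close>, when \<open>v\<close> is nonzero.\<close>

definition gauss_fibre :: "('v::finite \<Rightarrow>\<^sub>0 nat) set \<Rightarrow> (('v \<Rightarrow>\<^sub>0 nat) \<Rightarrow> real) \<Rightarrow> real ^ 'v \<Rightarrow> (real ^ 'v) set" where
  "gauss_fibre A c v = {x. (\<forall>i. x $ i \<noteq> 0) \<and> poly_fun A c x = 0 \<and> (\<exists>l. l \<noteq> 0 \<and> log_gradient A c x = l *\<^sub>R v)}"

lemma mon_has_derivative:
  "(mon \<alpha> has_derivative (\<lambda>h. \<Sum>i\<in>UNIV.
      (real (Poly_Mapping.lookup \<alpha> i) * (x $ i) ^ (Poly_Mapping.lookup \<alpha> i - 1) * h $ i)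
      * (\<Prod>j\<in>UNIV-{i}. (x $ j) ^ Poly_Mapping.lookup \<alpha> j))) (at x)"
proof -
  have "((\<lambda>x :: real ^ 'a. (x $ i) ^ n) has_derivative (\<lambda>h. real n * (x $ i) ^ (n - 1) * h $ i)) (at x)" for i n
    by (rule derivative_eq_intros bounded_linear_vec_nth[THEN bounded_linear.has_derivative, OF has_derivative_ident] refl)+
       (auto simp: mult.commute mult.left_commute)
  then show ?thesis unfolding mon_def by (intro has_derivative_prod)
qed

text \<open>Each monomial is an eigenvector of the operators \<open>x\<^sub>i \<partial>/\<partial>x\<^sub>i\<close>, with the components of its exponent as
  eigenvalues.\<close>

lemma poly_fun_has_derivative:
  "\<exists>D. (poly_fun A c has_derivative D) (at x) \<and> (\<forall>i. x $ i * D (axis i 1) = log_gradient A c x $ i)"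
proof -
  define E where "E = (\<lambda>\<alpha> h. \<Sum>i\<in>UNIV.
      (real (Poly_Mapping.lookup \<alpha> i) * (x $ i) ^ (Poly_Mapping.lookup \<alpha> i - 1) * h $ i)
      * (\<Prod>j\<in>UNIV-{i}. (x $ j) ^ Poly_Mapping.lookup \<alpha> j))"
  have Eax: "x $ i * E \<alpha> (axis i 1) = real (Poly_Mapping.lookup \<alpha> i) * mon \<alpha> x" for i \<alpha>
  proof -
    let ?n = "Poly_Mapping.lookup \<alpha> i" and ?R = "\<Prod>j\<in>UNIV-{i}. (x $ j) ^ Poly_Mapping.lookup \<alpha> j"
    have "E \<alpha> (axis i 1) = (\<Sum>k\<in>UNIV. if k = i then real ?n * (x $ i) ^ (?n - 1) * ?R else 0)"
      unfolding E_def by (intro sum.cong) (auto simp: axis_def)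
    then have "E \<alpha> (axis i 1) = real ?n * (x $ i) ^ (?n - 1) * ?R" by simp
    moreover have "mon \<alpha> x = (x $ i) ^ ?n * ?R" unfolding mon_def by (subst prod.remove[of _ i]) auto
    ultimately show ?thesis by (cases ?n) auto
  qed
  have "((\<lambda>x. \<Sum>\<alpha>\<in>A. c \<alpha> * mon \<alpha> x) has_derivative (\<lambda>h. \<Sum>\<alpha>\<in>A. c \<alpha> * E \<alpha> h)) (at x)"
    unfolding E_def by (intro has_derivative_sum has_derivative_mult_right mon_has_derivative)
  moreover have "x $ i * (\<Sum>\<alpha>\<in>A. c \<alpha> * E \<alpha> (axis i 1)) = log_gradient A c x $ i" for i
  proof -
    have "x $ i * (\<Sum>\<alpha>\<in>A. c \<alpha> * E \<alpha> (axis i 1)) = (\<Sum>\<alpha>\<in>A. c \<alpha> * (x $ i * E \<alpha> (axis i 1)))"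
      by (simp add: sum_distrib_left mult_ac)
    then show ?thesis unfolding Eax by (simp add: log_gradient_def mult_ac)
  qed
  ultimately show ?thesis by (intro exI[of _ "\<lambda>h. \<Sum>\<alpha>\<in>A. c \<alpha> * E \<alpha> h"]) (auto simp: poly_fun_def[abs_def])
qed

lemma continuous_mon [continuous_intros]: "continuous_on S (mon \<alpha>)"
  unfolding mon_def by (intro continuous_intros)

lemma supported_poly_fun_continuous: "supported_poly_fun A g \<Longrightarrow> continuous_on S g"
proof -
  assume "supported_poly_fun A g"
  then obtain c where "g = (\<lambda>x. \<Sum>\<gamma>\<in>A. c \<gamma> * mon \<gamma> x)" unfolding supported_poly_fun_def by auto
  then show ?thesis by (auto intro!: continuous_intros)
qed

text \<open>Where \<open>H\<close> is nonzero the polynomial vanishes, and it cannot vanish near a point at which its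
  logarithmic gradient is nonzero. So a power of the polynomial can be divided out at such a point.\<close>

lemma vanishes_at_regular_zero:
  assumes "poly_fun A c x = 0" "log_gradient A c x \<noteq> 0"
    and cont: "continuous_on UNIV H" and prod: "\<And>y. poly_fun A c y ^ k * H y = (0::real)"
  shows "H x = 0"
proof (rule ccontr)
  assume nz: "H x \<noteq> 0"
  have "open {y. H y \<noteq> 0}"
    by (rule open_Collect_neq[OF cont]) (auto intro: continuous_intros)
  then have "\<forall>\<^sub>F y in nhds x. H y \<noteq> 0" using nz by (auto simp: eventually_nhds)
  then have ev: "\<forall>\<^sub>F y in at x. poly_fun A c y = 0"
    unfolding eventually_at_filter using prod by (elim eventually_mono) (metis mult_eq_0_iff power_eq_0_iff)
  obtain D where D: "(poly_fun A c has_derivative D) (at x)" "\<forall>i. x $ i * D (axis i 1) = log_gradient A c x $ i"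
    using poly_fun_has_derivative by blast
  have "((\<lambda>_. 0::real) has_derivative D) (at x)"
    by (rule has_derivative_transform_eventually[OF D(1) ev assms(1)]) simp
  then have "D = (\<lambda>_. 0)" by (rule has_derivative_unique[OF _ has_derivative_const])
  then show False using D(2) assms(2) by (simp add: vec_eq_iff)
qed

text \<open>The algebraic core of the upper bound. The products labelled by \<open>form_index D m\<close> satisfy a linear relation.
  After division by the largest common power of the polynomial, evaluation at a fibre point, where the
  logarithmic gradient is \<open>l v\<close>, kills all terms still containing the polynomial and leaves a
  homogeneous relation between \<open>l v\<close> and \<open>g x\<close>, that is, an equation for \<open>g x / l\<close> of degree less than
  \<open>D\<close>. The coefficients depend on \<open>v\<close> alone and one of them is a nonzero homogeneous polynomial.\<close>

lemma fibre_values_are_roots: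
  fixes A :: "('v::finite \<Rightarrow>\<^sub>0 nat) set"
  assumes A: "finite A" "A \<noteq> {}"
    and D: "fact CARD('v) * measure lborel (convex hull (exponent_vec ` A)) < real D"
    and g: "supported_poly_fun A g"
  shows "\<exists>B. null_cone B \<and> (\<forall>v. v \<notin> B \<longrightarrow> (\<exists>P::real poly. P \<noteq> 0 \<and> degree P < D \<and>
    (\<forall>x l. poly_fun A c x = 0 \<longrightarrow> log_gradient A c x \<noteq> 0 \<longrightarrow> log_gradient A c x = l *\<^sub>R v \<longrightarrow> poly P (g x / l) = 0)))"
proof -
  define form :: "'v option \<Rightarrow> real ^ 'v \<Rightarrow> real" where
    "form = (\<lambda>k x. case k of None \<Rightarrow> poly_fun A c x | Some i \<Rightarrow> log_gradient A c x $ i)"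
  have form: "supported_poly_fun A (form k)" for k
  proof (cases k)
    case None
    then show ?thesis by (auto simp: form_def supported_poly_fun_def poly_fun_def)
  next
    case (Some i)
    have "log_gradient A c x $ i = (\<Sum>\<gamma>\<in>A. (c \<gamma> * exponent_vec \<gamma> $ i) * mon \<gamma> x)" for x
      by (simp add: log_gradient_def mult_ac)
    with Some show ?thesis unfolding form_def supported_poly_fun_def by fastforce
  qed
  obtain m where m: "D \<le> m" "card (iterated_sumset A m) < card (form_index D m :: ('v option multiset \<times> nat) set)"
    using more_forms_than_lattice_points[OF A D] by auto
  define J where "J = (form_index D m :: ('v option multiset \<times> nat) set)"
  have J: "finite J" unfolding J_def by (rule finite_form_index[OF m(1)])
  define W where "W = (\<lambda>(M, b) x. g x ^ b * (\<Prod>k\<in>#M. form k x))"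
  have "supported_poly_fun (iterated_sumset A m) (W j)" if j: "j \<in> J" for j
  proof -
    obtain M b where Mb: "j = (M, b)" "size M + b = m" using j by (auto simp: J_def form_index_def)
    show ?thesis
      using supported_poly_fun_power_mult[OF A(1) g supported_poly_fun_prod_mset[OF A(1) form], of b M] Mb
      by (simp add: W_def add.commute)
  qed
  then obtain q where q: "\<exists>j\<in>J. q j \<noteq> 0" "\<And>x. (\<Sum>j\<in>J. q j * W j x) = 0"
    using supported_poly_fun_dependent[OF finite_iterated_sumset[OF A(1)] J] m(2) unfolding J_def by blast
  define J1 where "J1 = {j \<in> J. q j \<noteq> 0}"
  have J1: "finite J1" "J1 \<noteq> {}" using q J by (auto simp: J1_def)
  \<comment> \<open>the largest power of the polynomial that divides every term of the relation\<close>
  define k where "k = Min ((\<lambda>(M, b). count M None) ` J1)"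
  have k_le: "k \<le> count M None" if "(M, b) \<in> J1" for M b
    unfolding k_def using that J1 by (intro Min_le) force+
  have "k \<in> (\<lambda>(M, b). count M None) ` J1" unfolding k_def using J1 by (intro Min_in) auto
  then obtain M0 b0 where M0: "(M0, b0) \<in> J1" "count M0 None = k" by auto
  define red where "red = (\<lambda>M :: 'v option multiset. M - replicate_mset k None)"
  have M_split: "M = replicate_mset k None + red M" if "(M, b) \<in> J1" for M b
    using k_le[OF that] by (simp add: red_def count_le_replicate_mset_subset_eq)
  define H where "H = (\<lambda>x. \<Sum>(M, b)\<in>J1. q (M, b) * (g x ^ b * (\<Prod>k\<in>#red M. form k x)))"
  have "poly_fun A c x ^ k * H x = 0" for x
  proof -
    have "0 = (\<Sum>j\<in>J1. q j * W j x)"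
      using q(2)[of x] J by (subst (asm) sum.mono_neutral_right[of J J1]) (auto simp: J1_def)
    also have "\<dots> = (\<Sum>(M, b)\<in>J1. poly_fun A c x ^ k * (q (M, b) * (g x ^ b * (\<Prod>k\<in>#red M. form k x))))"
    proof (intro sum.cong refl, clarify)
      fix M b assume "(M, b) \<in> J1"
      then have "(\<Prod>k\<in>#M. form k x) = poly_fun A c x ^ k * (\<Prod>k\<in>#red M. form k x)"
        by (subst M_split) (auto simp: form_def)
      then show "q (M, b) * W (M, b) x = poly_fun A c x ^ k * (q (M, b) * (g x ^ b * (\<Prod>k\<in>#red M. form k x)))"
        by (simp add: W_def mult_ac)
    qed
    finally show ?thesis by (simp add: H_def sum_distrib_left case_prod_unfold)
  qed
  note FH = this
  have Hcont: "continuous_on UNIV H" unfolding H_def case_prod_unfold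
    by (intro continuous_intros supported_poly_fun_continuous[OF g] supported_poly_fun_continuous[OF form])
  \<comment> \<open>the terms that survive at a fibre point contain the polynomial to the power \<open>k\<close> exactly\<close>
  define up where "up = (\<lambda>a. replicate_mset k None + image_mset (Some :: 'v \<Rightarrow> 'v option) a)"
  define I where "I = (\<lambda>b. {a. (up a, b) \<in> J1})"
  have up_inj: "up a = up a' \<longleftrightarrow> a = a'" for a a'
    unfolding up_def by (simp add: inj_eq[OF multiset.inj_map])
  have fin_I: "finite (I b)" for b
  proof (rule finite_imageD)
    show "finite (up ` I b)" by (rule finite_subset[of _ "fst ` J1"]) (use J1 in \<open>force simp: I_def\<close>)+
    show "inj_on up (I b)" by (simp add: inj_on_def up_inj)
  qed
  have size_I: "size a + b + k = m" "b < D" if "a \<in> I b" for a b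
    using that by (auto simp: I_def J1_def J_def form_index_def up_def)
  have red_up: "red (up a) = image_mset Some a" for a by (simp add: red_def up_def)
  have no_None: "\<exists>a. M = up a" if "(M, b) \<in> J1" "count M None = k" for M b
  proof -
    have "None \<notin># red M" using that by (simp add: red_def count_eq_zero_iff[symmetric])
    then have "image_mset (\<lambda>z. Some (the z)) (red M) = red M"
      by (intro multiset.map_ident_strong) (metis option.collapse)
    then have "image_mset Some (image_mset the (red M)) = red M"
      by (simp add: image_mset.compositionality comp_def)
    then show ?thesis using M_split[OF that(1)] unfolding up_def by metis
  qed
  define Q where "Q = (\<lambda>b (v :: real ^ 'v). \<Sum>a\<in>I b. q (up a, b) * (\<Prod>i\<in>#a. v $ i))"
  have H_fibre: "H x = (\<Sum>b<D. l ^ (m - k - b) * Q b v * g x ^ b)"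
    if x: "poly_fun A c x = 0" "log_gradient A c x = l *\<^sub>R v" for x l v
  proof -
    define J2 where "J2 = {(M, b) \<in> J1. count M None = k}"
    have J2: "J2 = (\<lambda>(b, a). (up a, b)) ` (SIGMA b:{..<D}. I b)"
    proof
      show "J2 \<subseteq> (\<lambda>(b, a). (up a, b)) ` (SIGMA b:{..<D}. I b)"
      proof clarify
        fix M b assume "(M, b) \<in> J2"
        then have Mb: "(M, b) \<in> J1" "count M None = k" by (auto simp: J2_def)
        then obtain a where "M = up a" using no_None by blast
        moreover then have "a \<in> I b" using Mb by (simp add: I_def)
        moreover then have "b < D" by (rule size_I)
        ultimately show "(M, b) \<in> (\<lambda>(b, a). (up a, b)) ` (SIGMA b:{..<D}. I b)" by force
      qed
    qed (auto simp: J2_def I_def up_def count_image_mset vimage_def)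
    have "H x = (\<Sum>(M, b)\<in>J2. q (M, b) * (g x ^ b * (\<Prod>k\<in>#red M. form k x)))"
      unfolding H_def
    proof (intro sum.mono_neutral_right ballI)
      fix j assume j: "j \<in> J1 - J2"
      obtain M b where Mb: "j = (M, b)" by force
      then have "k < count M None" using j k_le[of M b] by (auto simp: J2_def)
      then have "None \<in># red M" by (simp add: red_def flip: count_greater_zero_iff)
      then have "(\<Prod>k\<in>#red M. form k x) = 0" using x(1)
        by (auto simp: form_def image_iff intro!: bexI[of _ None])
      then show "(case j of (M, b) \<Rightarrow> q (M, b) * (g x ^ b * (\<Prod>k\<in>#red M. form k x))) = 0"
        using Mb by simp
    qed (use J1 in \<open>auto simp: J2_def\<close>)
    also have "\<dots> = (\<Sum>(b, a)\<in>(SIGMA b:{..<D}. I b). q (up a, b) * (g x ^ b * (\<Prod>k\<in>#red (up a). form k x)))"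
      unfolding J2 by (subst sum.reindex) (auto simp: inj_on_def up_inj case_prod_unfold)
    also have "\<dots> = (\<Sum>b<D. \<Sum>a\<in>I b. q (up a, b) * (g x ^ b * (\<Prod>k\<in>#red (up a). form k x)))"
      by (subst sum.Sigma) (auto simp: fin_I)
    also have "\<dots> = (\<Sum>b<D. l ^ (m - k - b) * Q b v * g x ^ b)"
    proof (intro sum.cong refl)
      fix b
      have "(\<Prod>k\<in>#red (up a). form k x) = l ^ (m - k - b) * (\<Prod>i\<in>#a. v $ i)" if a: "a \<in> I b" for a
      proof -
        have "(\<Prod>k\<in>#red (up a). form k x) = (\<Prod>i\<in>#a. l * v $ i)"
          unfolding red_up by (simp add: form_def x multiset.map_comp comp_def)
        also have "\<dots> = l ^ size a * (\<Prod>i\<in>#a. v $ i)" by (induction a) auto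
        also have "size a = m - k - b" using size_I[OF a] by simp
        finally show ?thesis .
      qed
      then show "(\<Sum>a\<in>I b. q (up a, b) * (g x ^ b * (\<Prod>k\<in>#red (up a). form k x)))
          = l ^ (m - k - b) * Q b v * g x ^ b"
        unfolding Q_def sum_distrib_left sum_distrib_right by (intro sum.cong) auto
    qed
    finally show ?thesis .
  qed
  obtain a0 where a0: "M0 = up a0" using no_None[OF M0] by blast
  then have a0I: "a0 \<in> I b0" using M0 by (simp add: I_def)
  define B where "B = {v. Q b0 v = 0}"
  have "null_cone B" unfolding B_def Q_def
  proof (rule null_cone_homogeneous)
    show "size a = m - k - b0" if "a \<in> I b0" for a using size_I[OF that] by simp
    show "q (up a0, b0) \<noteq> 0" using M0 a0 by (simp add: J1_def)
  qed (use fin_I a0I in auto)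
  moreover have "\<exists>P::real poly. P \<noteq> 0 \<and> degree P < D \<and>
    (\<forall>x l. poly_fun A c x = 0 \<longrightarrow> log_gradient A c x \<noteq> 0 \<longrightarrow> log_gradient A c x = l *\<^sub>R v \<longrightarrow> poly P (g x / l) = 0)" if v: "v \<notin> B" for v
  proof -
    define P where "P = (\<Sum>b<D. monom (Q b v) b)"
    have b0: "b0 < D" using size_I[OF a0I] by simp
    have cf: "coeff P b = (if b < D then Q b v else 0)" for b
      unfolding P_def coeff_sum by (simp add: sum.delta)
    then have "P \<noteq> 0" using v b0 unfolding B_def by (metis (mono_tags) coeff_0 mem_Collect_eq)
    moreover have "degree P < D"
      using \<open>P \<noteq> 0\<close> cf by (metis leading_coeff_0_iff)
    moreover have "poly P (g x / l) = 0" if x: "poly_fun A c x = 0" "log_gradient A c x \<noteq> 0" "log_gradient A c x = l *\<^sub>R v" for x l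
    proof -
      have l: "l \<noteq> 0" using x by auto
      have "0 = H x" using vanishes_at_regular_zero[OF x(1,2) Hcont FH] by simp
      also have "\<dots> = (\<Sum>b<D. l ^ (m - k) * (Q b v * (g x / l) ^ b))"
        unfolding H_fibre[OF x(1,3)]
      proof (intro sum.cong refl)
        fix b
        show "l ^ (m - k - b) * Q b v * g x ^ b = l ^ (m - k) * (Q b v * (g x / l) ^ b)"
        proof (cases "I b = {}")
          case True
          then show ?thesis by (simp add: Q_def)
        next
          case False
          then obtain a where "a \<in> I b" by auto
          then have "m - k = (m - k - b) + b" using size_I[of a b] by simp
          then have "l ^ (m - k) = l ^ (m - k - b) * l ^ b" by (metis power_add)
          then show ?thesis using l by (simp add: power_divide)
        qed
      qed
      also have "\<dots> = l ^ (m - k) * poly P (g x / l)"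
        by (simp add: P_def poly_sum poly_monom sum_distrib_left)
      finally show ?thesis using l by simp
    qed
    ultimately show ?thesis by blast
  qed
  ultimately show ?thesis by blast
qed

text \<open>A bound of Kushnirenko's type. Fibre points \<open>x\<close> with factors \<open>l x\<close> have pairwise
  different vectors of monomials divided by \<open>l x\<close>, so some member of a countable family of linear
  combinations \<open>g s\<close> separates any finite set of them. Countability of the family keeps the union of
  the exceptional sets null.\<close>

theorem kushnirenko_gauss_bound:
  fixes A :: "('v::finite \<Rightarrow>\<^sub>0 nat) set"
  assumes A: "finite A" "A \<noteq> {}" "affinely_generates A"
  shows "\<exists>B. null_cone B \<and> 0 \<in> B \<and> (\<forall>v. v \<notin> B \<longrightarrow> finite (gauss_fibre A c v) \<and>
     real (card (gauss_fibre A c v)) \<le> fact CARD('v) * measure lborel (convex hull (exponent_vec ` A)))"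
proof -
  let ?V = "fact CARD('v) * measure lborel (convex hull (exponent_vec ` A))"
  \<comment> \<open>the least natural number above \<open>?V\<close>, so that \<open>D - 1\<close> is still at most \<open>?V\<close>\<close>
  define D where "D = Suc (nat \<lfloor>?V\<rfloor>)"
  have V: "?V < real D" and DV: "real (D - 1) \<le> ?V" unfolding D_def by (auto; linarith)+
  obtain ix :: "('v \<Rightarrow>\<^sub>0 nat) \<Rightarrow> nat" where ix: "inj_on ix A"
    using ex_bij_betw_finite_nat[OF A(1)] unfolding bij_betw_def by blast
  define g where "g = (\<lambda>(s::nat) x. \<Sum>\<alpha>\<in>A. real s ^ ix \<alpha> * mon \<alpha> x)"
  have "supported_poly_fun A (g s)" for s by (auto simp: supported_poly_fun_def g_def)
  then have "\<forall>s. \<exists>B. null_cone B \<and> (\<forall>v. v \<notin> B \<longrightarrow> (\<exists>P::real poly. P \<noteq> 0 \<and> degree P < D \<and>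
    (\<forall>x l. poly_fun A c x = 0 \<longrightarrow> log_gradient A c x \<noteq> 0 \<longrightarrow> log_gradient A c x = l *\<^sub>R v \<longrightarrow> poly P (g s x / l) = 0)))"
    using fibre_values_are_roots[OF A(1,2) V] by blast
  then obtain B where B: "\<And>s. null_cone (B s)" and P: "\<And>s v. v \<notin> B s \<Longrightarrow> \<exists>P::real poly. P \<noteq> 0 \<and> degree P < D \<and>
    (\<forall>x l. poly_fun A c x = 0 \<longrightarrow> log_gradient A c x \<noteq> 0 \<longrightarrow> log_gradient A c x = l *\<^sub>R v \<longrightarrow> poly P (g s x / l) = 0)"
    by metis
  define B' where "B' = insert 0 (\<Union>s. B s)"
  have "null_cone (\<Union>s. B s)" using B by (intro null_cone_UN) auto
  moreover have "{0::real ^ 'v} \<in> null_sets lborel" by (auto simp: null_sets_def)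
  ultimately have "{0} \<union> (\<Union>s. B s) \<in> null_sets lborel"
    unfolding null_cone_def by (intro null_sets.Un) blast+
  then have "null_cone B'"
    using \<open>null_cone (\<Union>s. B s)\<close> unfolding null_cone_def B'_def by auto
  have card_le: "card X \<le> D - 1" if v: "v \<notin> B'" and X: "finite X" "X \<subseteq> gauss_fibre A c v" for v X
  proof -
    have "\<forall>x\<in>X. \<exists>l. l \<noteq> 0 \<and> log_gradient A c x = l *\<^sub>R v"
    proof
      fix x assume "x \<in> X"
      then have "x \<in> gauss_fibre A c v" using X(2) by (rule rev_subsetD)
      then show "\<exists>l. l \<noteq> 0 \<and> log_gradient A c x = l *\<^sub>R v" unfolding gauss_fibre_def by (elim CollectE conjE)
    qed
    from bchoice[OF this] obtain l where l: "\<And>x. x \<in> X \<Longrightarrow> l x \<noteq> 0" "\<And>x. x \<in> X \<Longrightarrow> log_gradient A c x = l x *\<^sub>R v" by blast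
    have v0: "v \<noteq> 0" using v by (auto simp: B'_def)
    define C where "C = (\<lambda>(x, y) \<alpha>. mon \<alpha> x / l x - mon \<alpha> y / l y) ` {(x, y) \<in> X \<times> X. x \<noteq> y}"
    have "finite C" unfolding C_def
      by (rule finite_imageI, rule finite_subset[of _ "X \<times> X"]) (use X in auto)
    moreover have "\<exists>\<alpha>\<in>A. f \<alpha> \<noteq> 0" if f: "f \<in> C" for f
    proof (rule ccontr)
      assume "\<not> (\<exists>\<alpha>\<in>A. f \<alpha> \<noteq> 0)"
      moreover obtain x y where xy: "x \<in> X" "y \<in> X" "x \<noteq> y" "f = (\<lambda>\<alpha>. mon \<alpha> x / l x - mon \<alpha> y / l y)"
        using f by (auto simp: C_def)
      ultimately have "mon \<alpha> x / l x = mon \<alpha> y / l y" if "\<alpha> \<in> A" for \<alpha> using that by auto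
      then have "mon \<alpha> x = (l x / l y) * mon \<alpha> y" if "\<alpha> \<in> A" for \<alpha>
        using that l(1)[OF xy(1)] l(1)[OF xy(2)] by (simp add: field_simps)
      moreover have "l x / l y \<noteq> 0" using l xy by auto
      moreover have "\<And>i. x $ i \<noteq> 0" "\<And>i. y $ i \<noteq> 0" using X xy by (auto simp: gauss_fibre_def)
      ultimately have "x = y" by (intro monomials_proportional_imp_eq[OF A(3)])
      with xy show False by simp
    qed
    ultimately obtain s :: nat where s: "\<And>f. f \<in> C \<Longrightarrow> (\<Sum>\<alpha>\<in>A. f \<alpha> * real s ^ ix \<alpha>) \<noteq> 0"
      using exists_generic_power_combination[OF A(1) ix, of C] by blast
    have inj: "inj_on (\<lambda>x. g s x / l x) X"
    proof (rule inj_onI, rule ccontr)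
      fix x y assume xy: "x \<in> X" "y \<in> X" "g s x / l x = g s y / l y" "x \<noteq> y"
      then have "(\<Sum>\<alpha>\<in>A. (mon \<alpha> x / l x - mon \<alpha> y / l y) * real s ^ ix \<alpha>) \<noteq> 0"
        by (intro s) (auto simp: C_def image_iff)
      moreover have "(\<Sum>\<alpha>\<in>A. (mon \<alpha> x / l x - mon \<alpha> y / l y) * real s ^ ix \<alpha>) = g s x / l x - g s y / l y"
        unfolding g_def sum_divide_distrib sum_subtractf[symmetric]
        by (intro sum.cong) (auto simp: algebra_simps)
      ultimately show False using xy by simp
    qed
    obtain P :: "real poly" where P: "P \<noteq> 0" "degree P < D" "\<And>x l. poly_fun A c x = 0 \<Longrightarrow> log_gradient A c x \<noteq> 0 \<Longrightarrow> log_gradient A c x = l *\<^sub>R v \<Longrightarrow> poly P (g s x / l) = 0"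
      using P[of v s] v by (auto simp: B'_def)
    have "card X = card ((\<lambda>x. g s x / l x) ` X)" using inj by (simp add: card_image)
    also have "\<dots> \<le> card {t. poly P t = 0}"
    proof (rule card_mono[OF poly_roots_finite[OF P(1)]], clarify)
      fix x assume x: "x \<in> X"
      show "poly P (g s x / l x) = 0"
        using x X l[OF x] v0 by (intro P(3)) (auto simp: gauss_fibre_def)
    qed
    also have "\<dots> \<le> degree P" by (rule card_poly_roots_bound[OF P(1)])
    finally show ?thesis using P(2) by simp
  qed
  have "finite (gauss_fibre A c v) \<and> real (card (gauss_fibre A c v)) \<le> ?V" if v: "v \<notin> B'" for v
  proof -
    have fin: "finite (gauss_fibre A c v)"
    proof (rule ccontr)
      assume "infinite (gauss_fibre A c v)"
      then obtain X where "finite X" "X \<subseteq> gauss_fibre A c v" "card X = D" by (meson infinite_arbitrarily_large)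
      then show False using card_le[OF v, of X] by (simp add: D_def)
    qed
    show ?thesis using fin card_le[OF v fin] DV by force
  qed
  then show ?thesis using \<open>null_cone B'\<close> by (intro exI[of _ B']) (auto simp: B'_def)
qed

section \<open>Solutions near a primitive simplex\<close>

lemma sum_UNIV_option: "(\<Sum>k\<in>UNIV. f k) = f None + (\<Sum>i\<in>UNIV. f (Some i))" for f :: "'v::finite option \<Rightarrow> 'b::comm_monoid_add"
  by (simp add: UNIV_option_conv sum.reindex)

text \<open>The functions \<open>y \<mapsto> w0 j + w j \<bullet> y\<close> are the barycentric coordinates of the simplex with vertices \<open>a j\<close>,
  and \<open>y \<mapsto> w j \<bullet> y\<close> are those of directions. They come from the inverse of the matrix with columns
  \<open>(1, a j)\<close>: affine generation provides an integral right inverse, which is also a left inverse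
  because the matrix is square.\<close>

lemma barycentric_coordinates:
  fixes a :: "'v::finite option \<Rightarrow> 'v \<Rightarrow>\<^sub>0 nat"
  assumes inj: "inj a" and gen: "affinely_generates (range a)"
  shows "\<exists>w0 w. (\<Sum>j\<in>UNIV. w0 j) = 1 \<and> (\<Sum>j\<in>UNIV. w0 j *\<^sub>R exponent_vec (a j)) = 0 \<and>
     (\<forall>y. (\<Sum>j\<in>UNIV. w j \<bullet> y) = 0) \<and> (\<forall>y. (\<Sum>j\<in>UNIV. (w j \<bullet> y) *\<^sub>R exponent_vec (a j)) = y) \<and>
     (\<forall>j j'. w0 j + w j \<bullet> exponent_vec (a j') = (if j = j' then 1 else (0::real))) \<and> (\<forall>j. w j \<noteq> 0) \<and>
     (\<forall>j \<alpha>. w0 j + w j \<bullet> exponent_vec \<alpha> \<in> \<int>)"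
proof -
  have "\<forall>i. \<exists>k :: _ \<Rightarrow> int. (\<Sum>j\<in>UNIV. k (a j)) = 0 \<and> (\<Sum>j\<in>UNIV. of_int (k (a j)) *\<^sub>R exponent_vec (a j)) = axis i 1"
    using gen unfolding affinely_generates_def by (simp add: sum.reindex[OF inj] comp_def)
  then obtain k :: "'v \<Rightarrow> _ \<Rightarrow> int" where k: "\<And>i. (\<Sum>j\<in>UNIV. k i (a j)) = 0"
     "\<And>i. (\<Sum>j\<in>UNIV. of_int (k i (a j)) *\<^sub>R exponent_vec (a j)) = axis i 1" by metis
  have k0: "(\<Sum>j\<in>UNIV. real_of_int (k i (a j))) = 0" for i using k(1)[of i] by (metis of_int_0 of_int_sum)
  have k1: "(\<Sum>j\<in>UNIV. real_of_int (k i (a j)) * real (Poly_Mapping.lookup (a j) l)) = (if l = i then 1 else 0)" for i l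
    using arg_cong[OF k(2)[of i], of "\<lambda>x. x $ l"] by (simp add: axis_def)
  let ?c = "\<lambda>i. real (Poly_Mapping.lookup (a None) i)"
  define M :: "real ^ 'v option ^ 'v option" where
    "M = (\<chi> r j. case r of None \<Rightarrow> 1 | Some i \<Rightarrow> real (Poly_Mapping.lookup (a j) i))"
  define K :: "real ^ 'v option ^ 'v option" where
    "K = (\<chi> j r. case r of None \<Rightarrow> (if j = None then 1 else 0) - (\<Sum>i\<in>UNIV. ?c i * of_int (k i (a j)))
                          | Some i \<Rightarrow> of_int (k i (a j)))"
  have entry: "(M ** K) $ r $ r' = (if r = r' then 1 else 0)" for r r'
  proof (cases r')
    case None
    have *: "(\<Sum>j\<in>UNIV. f j * ((if j = None then 1 else 0) - (\<Sum>i\<in>UNIV. ?c i * of_int (k i (a j)))))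
        = f None - (\<Sum>i\<in>UNIV. ?c i * (\<Sum>j\<in>UNIV. of_int (k i (a j)) * f j))" for f :: "'v option \<Rightarrow> real"
    proof -
      have "(\<Sum>j\<in>UNIV. f j * ((if j = None then 1 else 0) - (\<Sum>i\<in>UNIV. ?c i * of_int (k i (a j)))))
        = (\<Sum>j\<in>UNIV. (if j = None then f j else 0)) - (\<Sum>j\<in>UNIV. \<Sum>i\<in>UNIV. ?c i * (of_int (k i (a j)) * f j))"
        unfolding sum_subtractf[symmetric]
        by (intro sum.cong) (auto simp: right_diff_distrib sum_distrib_left mult_ac)
      also have "(\<Sum>j\<in>UNIV. \<Sum>i\<in>UNIV. ?c i * (of_int (k i (a j)) * f j)) = (\<Sum>i\<in>UNIV. ?c i * (\<Sum>j\<in>UNIV. of_int (k i (a j)) * f j))"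
        by (subst sum.swap) (simp add: sum_distrib_left)
      finally show ?thesis by simp
    qed
    show ?thesis
    proof (cases r)
      case N: None
      show ?thesis using *[of "\<lambda>_. 1"] k0 by (simp add: matrix_matrix_mult_def M_def K_def None N)
    next
      case (Some l)
      have "(\<Sum>i\<in>UNIV. ?c i * (\<Sum>j\<in>UNIV. of_int (k i (a j)) * real (Poly_Mapping.lookup (a j) l))) = ?c l"
        unfolding k1 by (simp add: mult_delta_right)
      then show ?thesis using *[of "\<lambda>j. real (Poly_Mapping.lookup (a j) l)"]
        by (simp add: matrix_matrix_mult_def M_def K_def None Some)
    qed
  next
    case (Some i)
    show ?thesis using k0[of i] k1[of i]
      by (cases r) (auto simp: matrix_matrix_mult_def M_def K_def Some mult.commute)
  qed
  then have "M ** K = mat 1" by (simp add: vec_eq_iff mat_def)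
  then have "K ** M = mat 1" by (simp add: matrix_left_right_inverse)
  then have entry': "(K ** M) $ j $ j' = (if j = j' then 1 else 0)" for j j' by (simp add: mat_def)
  define w0 where "w0 = (\<lambda>j. K $ j $ None)"
  define w :: "'v option \<Rightarrow> real ^ 'v" where "w = (\<lambda>j. \<chi> i. K $ j $ Some i)"
  have 1: "(\<Sum>j\<in>UNIV. w0 j) = 1"
    using entry[of None None] by (simp add: w0_def matrix_matrix_mult_def M_def)
  have 2: "(\<Sum>j\<in>UNIV. w0 j *\<^sub>R exponent_vec (a j)) = 0"
  proof -
    have "(\<Sum>j\<in>UNIV. w0 j * real (Poly_Mapping.lookup (a j) i)) = 0" for i
      using entry[of "Some i" None] by (simp add: w0_def matrix_matrix_mult_def M_def mult.commute)
    then show ?thesis by (simp add: vec_eq_iff)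
  qed
  have 3: "(\<Sum>j\<in>UNIV. w j \<bullet> y) = 0" for y
  proof -
    have "(\<Sum>j\<in>UNIV. w j) = 0"
      using entry[of None "Some _"] by (simp add: vec_eq_iff w_def matrix_matrix_mult_def M_def)
    then show ?thesis by (simp flip: inner_sum_left)
  qed
  have 4: "(\<Sum>j\<in>UNIV. (w j \<bullet> y) *\<^sub>R exponent_vec (a j)) = y" for y
  proof -
    have e: "(\<Sum>j\<in>UNIV. real (Poly_Mapping.lookup (a j) l) * K $ j $ Some i) = (if l = i then 1 else 0)" for l i
      using entry[of "Some l" "Some i"] by (simp add: matrix_matrix_mult_def M_def)
    have "(\<Sum>j\<in>UNIV. (w j \<bullet> y) * real (Poly_Mapping.lookup (a j) l)) = y $ l" for l
    proof -
      have "(\<Sum>j\<in>UNIV. (w j \<bullet> y) * real (Poly_Mapping.lookup (a j) l))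
          = (\<Sum>j\<in>UNIV. \<Sum>i\<in>UNIV. y $ i * (real (Poly_Mapping.lookup (a j) l) * K $ j $ Some i))"
        by (intro sum.cong) (auto simp: inner_vec_def w_def sum_distrib_left mult_ac)
      also have "\<dots> = (\<Sum>i\<in>UNIV. y $ i * (if l = i then 1 else 0))"
        by (subst sum.swap) (simp add: e flip: sum_distrib_left)
      finally show ?thesis by (simp add: mult_delta_right)
    qed
    then show ?thesis by (simp add: vec_eq_iff)
  qed
  have 5: "w0 j + w j \<bullet> exponent_vec (a j') = (if j = j' then 1 else 0)" for j j'
    using entry'[of j j'] by (simp add: w0_def w_def inner_vec_def matrix_matrix_mult_def M_def sum_UNIV_option)
  have 6: "w j \<noteq> 0" for j
  proof
    assume "w j = 0"
    then have "w0 j = (if j = j' then 1 else 0)" for j' using 5[of j j'] by simp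
    moreover obtain j' where "j \<noteq> j'" by (cases j) auto
    ultimately show False by (metis zero_neq_one)
  qed
  have 7: "w0 j + w j \<bullet> exponent_vec \<alpha> \<in> \<int>" for j \<alpha>
    by (auto simp: w0_def w_def K_def inner_vec_def intro!: Ints_add Ints_diff Ints_sum Ints_mult)
  show ?thesis by (intro exI[of _ w0] exI[of _ w] conjI allI 1 2 3 4 5 6 7)
qed

lemma mon_abs_one: "(\<And>i. \<bar>s $ i\<bar> = 1) \<Longrightarrow> \<bar>mon \<alpha> s\<bar> = 1"
  by (simp add: mon_def abs_prod power_abs)

text \<open>Signs of the \<open>N\<close> variables together with a common sign \<open>\<tau>\<close> determine the signs of the \<open>N + 1\<close>
  monomials. Both sides have \<open>2\<^sup>N\<^sup>+\<^sup>1\<close> elements and the assignment is injective, because the signs of the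
  variables are recovered from the monomials up to a common factor. Hence it is surjective.\<close>

lemma prescribed_monomial_signs:
  fixes a :: "'v::finite option \<Rightarrow> 'v \<Rightarrow>\<^sub>0 nat"
  assumes gen: "affinely_generates (range a)"
  shows "\<exists>s \<tau>. (\<forall>i. \<bar>s $ i\<bar> = (1::real)) \<and> \<bar>\<tau>\<bar> = (1::real) \<and> (\<forall>j. \<tau> * mon (a j) s = (if p j then 1 else - 1))"
proof -
  define sg :: "bool \<Rightarrow> real" where "sg = (\<lambda>b. if b then 1 else - 1)"
  have sg_abs: "\<bar>sg b\<bar> = 1" for b by (simp add: sg_def)
  have sg_inj: "sg b = sg c \<longleftrightarrow> b = c" for b c by (auto simp: sg_def split: if_splits)
  define S :: "('v option \<Rightarrow> bool) \<Rightarrow> real ^ 'v" where "S = (\<lambda>e. \<chi> i. sg (e (Some i)))"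
  define f :: "('v option \<Rightarrow> bool) \<Rightarrow> ('v option \<Rightarrow> bool)" where
    "f = (\<lambda>e j. sg (e None) * mon (a j) (S e) = 1)"
  have S_abs: "\<bar>S e $ i\<bar> = 1" for e i by (simp add: S_def sg_abs)
  have val: "sg (e None) * mon (a j) (S e) = (if f e j then 1 else - 1)" for e j
  proof -
    have "\<bar>sg (e None) * mon (a j) (S e)\<bar> = 1" by (simp add: abs_mult sg_abs mon_abs_one S_abs)
    then show ?thesis by (auto simp: f_def)
  qed
  have "inj f"
  proof (rule injI)
    fix e e' assume eq: "f e = f e'"
    then have m: "sg (e None) * mon (a j) (S e) = sg (e' None) * mon (a j) (S e')" for j
      by (simp add: val)
    have nz: "sg b \<noteq> 0" for b using sg_abs[of b] by auto
    have Snz: "S e $ i \<noteq> 0" for e i using S_abs[of e i] by auto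
    have "S e = S e'"
    proof (rule monomials_proportional_imp_eq[OF gen Snz Snz])
      show "sg (e' None) / sg (e None) \<noteq> 0" using nz by simp
      fix \<alpha> assume "\<alpha> \<in> range a"
      then show "mon \<alpha> (S e) = sg (e' None) / sg (e None) * mon \<alpha> (S e')"
        using m nz[of "e None"] by (auto simp: field_simps)
    qed
    then have 1: "e (Some i) = e' (Some i)" for i by (simp add: S_def vec_eq_iff sg_inj)
    have "sg (e None) = sg (e' None)"
      using m[of None] mon_nonzero[OF Snz] unfolding \<open>S e = S e'\<close> by simp
    then have "e None = e' None" by (simp add: sg_inj)
    with 1 show "e = e'" by (intro ext) (metis option.exhaust)
  qed
  then have "surj f" by (simp add: finite_UNIV_inj_surj)
  then obtain e where "f e = p" by (metis surjD)
  then show ?thesis using val[of e] sg_abs S_abs by (intro exI[of _ "S e"] exI[of _ "sg (e None)"]) auto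
qed

lemma mon_exp: "mon \<alpha> (\<chi> i. s $ i * exp (\<eta> $ i)) = mon \<alpha> s * exp (\<eta> \<bullet> exponent_vec \<alpha>)"
  by (simp add: mon_def inner_vec_def power_mult_distrib prod.distrib exp_sum mult.commute flip: exp_of_nat_mult)

text \<open>In barycentric coordinates the equations for a fibre point \<open>x\<close> with factor \<open>l\<close> read
  \<open>T j * (1 + err j) = l * (w j \<bullet> v)\<close>, where \<open>T j\<close> is the term of the vertex \<open>a j\<close> and \<open>err j\<close> collects the
  relative contribution of the other exponents. Signs can be matched separately, and the numbers
  \<open>r j = ln \<bar>T j\<bar> - ln \<bar>l\<bar> - ln \<bar>D (a j)\<bar>\<close> are affine coordinates of the \<open>ln \<bar>x $ i\<bar>\<close> and \<open>ln \<bar>l\<bar>\<close>. In terms of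
  \<open>r\<close> the equations become \<open>r j = ln \<bar>w j \<bullet> v\<bar> - ln \<bar>D (a j)\<bar> - ln (1 + err j)\<close>, a fixed-point problem for a
  map of a box into itself as soon as the errors are at most one half. The bounds by \<open>e\<close> make the choice
  of \<open>d\<close> uniform in \<open>D\<close> and \<open>v\<close>.\<close>

lemma perturbed_simplex_solution:
  fixes a :: "'v::finite option \<Rightarrow> 'v \<Rightarrow>\<^sub>0 nat" and w :: "'v option \<Rightarrow> real ^ 'v"
  assumes inj: "inj a" and gen: "affinely_generates (range a)" and A: "finite A" "range a \<subseteq> A"
    and w01: "(\<Sum>j\<in>UNIV. w0 j) = 1" and w0E: "(\<Sum>j\<in>UNIV. w0 j *\<^sub>R exponent_vec (a j)) = 0"
    and w1: "\<And>y. (\<Sum>j\<in>UNIV. w j \<bullet> y) = 0"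
    and wE: "\<And>y. (\<Sum>j\<in>UNIV. (w j \<bullet> y) *\<^sub>R exponent_vec (a j)) = y"
    and dual: "\<And>j j'. w0 j + w j \<bullet> exponent_vec (a j') = (if j = j' then 1 else 0)"
    and e: "0 < e"
  shows "\<exists>d>0. \<forall>D v. (\<forall>j. e \<le> \<bar>D (a j)\<bar> \<and> \<bar>D (a j)\<bar> \<le> 1/e) \<longrightarrow> (\<forall>\<alpha>\<in>A - range a. \<bar>D \<alpha>\<bar> < d) \<longrightarrow>
      (\<forall>j. e \<le> \<bar>w j \<bullet> v\<bar> \<and> \<bar>w j \<bullet> v\<bar> \<le> 1/e) \<longrightarrow>
      (\<exists>x \<in> gauss_fibre A D v. \<forall>\<alpha>\<in>A - range a. \<forall>j. \<bar>D \<alpha> * mon \<alpha> x\<bar> < \<bar>D (a j) * mon (a j) x\<bar>)"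
proof -
  define \<rho> where "\<rho> = 2 * \<bar>ln e\<bar> + 1"
  define H where "H = \<rho> * (\<Sum>j\<in>UNIV. norm (w j))"
  define G where "G = (\<Sum>\<alpha>\<in>A. \<Sum>j\<in>UNIV. norm (exponent_vec \<alpha> - exponent_vec (a j)))"
  define \<zeta> where "\<zeta> = (\<lambda>j \<alpha>. w0 j + w j \<bullet> exponent_vec \<alpha>)"
  define Z where "Z = (\<Sum>\<alpha>\<in>A. \<Sum>j\<in>UNIV. \<bar>\<zeta> j \<alpha>\<bar>)"
  \<comment> \<open>makes each of the at most \<open>card A\<close> summands of \<open>err j r\<close> at most \<open>1 / (2 * (card A + 1))\<close>\<close>
  define d where "d = e / (2 * (real (card A) + 1) * (Z + 1) * exp (H * G))"
  have Z0: "Z \<ge> 0" unfolding Z_def by (intro sum_nonneg) auto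
  have d0: "d > 0" using Z0 e by (simp add: d_def)
  have \<zeta>Z: "\<bar>\<zeta> j \<alpha>\<bar> \<le> Z" if "\<alpha> \<in> A" for j \<alpha>
  proof -
    have "\<bar>\<zeta> j \<alpha>\<bar> \<le> (\<Sum>j\<in>UNIV. \<bar>\<zeta> j \<alpha>\<bar>)" by (rule member_le_sum) auto
    also have "\<dots> \<le> Z" unfolding Z_def using that A by (intro member_le_sum) (auto intro: sum_nonneg)
    finally show ?thesis .
  qed
  have EG: "norm (exponent_vec \<alpha> - exponent_vec (a j)) \<le> G" if "\<alpha> \<in> A" for j \<alpha>
  proof -
    have "norm (exponent_vec \<alpha> - exponent_vec (a j)) \<le> (\<Sum>j\<in>UNIV. norm (exponent_vec \<alpha> - exponent_vec (a j)))"
      by (rule member_le_sum) auto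
    also have "\<dots> \<le> G" unfolding G_def using that A by (intro member_le_sum) (auto intro: sum_nonneg)
    finally show ?thesis .
  qed
  show ?thesis
  proof (intro exI[of _ d] conjI d0 allI impI)
    fix D :: "('v \<Rightarrow>\<^sub>0 nat) \<Rightarrow> real" and v
    assume Dj: "\<forall>j. e \<le> \<bar>D (a j)\<bar> \<and> \<bar>D (a j)\<bar> \<le> 1/e"
      and Dsmall: "\<forall>\<alpha>\<in>A - range a. \<bar>D \<alpha>\<bar> < d"
      and wv: "\<forall>j. e \<le> \<bar>w j \<bullet> v\<bar> \<and> \<bar>w j \<bullet> v\<bar> \<le> 1/e"
    have nz: "D (a j) \<noteq> 0" "w j \<bullet> v \<noteq> 0" for j using Dj[rule_format, of j] wv[rule_format, of j] e by auto
    obtain s \<tau> where s: "\<And>i. \<bar>s $ i\<bar> = (1::real)" and \<tau>: "\<bar>\<tau>\<bar> = (1::real)"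
      and sgn: "\<And>j. \<tau> * mon (a j) s = (if (D (a j) > 0) = (w j \<bullet> v > 0) then 1 else - 1)"
      using prescribed_monomial_signs[OF gen, of "\<lambda>j. (D (a j) > 0) = (w j \<bullet> v > 0)"] by blast
    have ms: "\<bar>mon \<alpha> s\<bar> = 1" for \<alpha> by (rule mon_abs_one[OF s])
    \<comment> \<open>the exact solution if all the exponents outside \<open>range a\<close> are dropped\<close>
    define b :: "real ^ 'v option" where "b = (\<chi> j. ln \<bar>w j \<bullet> v\<bar> - ln \<bar>D (a j)\<bar>)"
    \<comment> \<open>the logarithms of the \<open>\<bar>x $ i\<bar>\<close>, recovered from the coordinates \<open>r\<close>\<close>
    define \<eta> :: "real ^ 'v option \<Rightarrow> real ^ 'v" where "\<eta> = (\<lambda>r. \<Sum>j\<in>UNIV. (r $ j) *\<^sub>R w j)"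
    define err where "err = (\<lambda>j r. \<Sum>\<alpha>\<in>A - range a. D \<alpha> * mon \<alpha> s / (D (a j) * mon (a j) s)
        * exp (\<eta> r \<bullet> (exponent_vec \<alpha> - exponent_vec (a j))) * \<zeta> j \<alpha>)"
    define \<Phi> :: "real ^ 'v option \<Rightarrow> real ^ 'v option" where "\<Phi> = (\<lambda>r. \<chi> j. b $ j - ln (1 + err j r))"
    define S where "S = cbox (b - 1) (b + 1)"
    have S_iff: "r \<in> S \<longleftrightarrow> (\<forall>j. \<bar>r $ j - b $ j\<bar> \<le> 1)" for r
      unfolding S_def mem_box_cart by (simp add: abs_le_iff) (smt (verit))
    have ln_le: "\<bar>ln y\<bar> \<le> \<bar>ln e\<bar>" if "e \<le> y" "y \<le> 1/e" for y
    proof -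
      have "ln e \<le> ln y" "ln y \<le> ln (1/e)" using that e by (simp_all del: ln_div)
      then show ?thesis using e by (simp add: ln_div)
    qed
    have b_le: "\<bar>b $ j\<bar> \<le> 2 * \<bar>ln e\<bar>" for j
    proof -
      have "\<bar>ln \<bar>w j \<bullet> v\<bar>\<bar> \<le> \<bar>ln e\<bar>" "\<bar>ln \<bar>D (a j)\<bar>\<bar> \<le> \<bar>ln e\<bar>"
        using ln_le Dj wv by blast+
      then show ?thesis unfolding b_def vec_lambda_beta by linarith
    qed
    have \<eta>_le: "norm (\<eta> r) \<le> H" if "r \<in> S" for r
    proof -
      have "\<bar>r $ j\<bar> \<le> \<rho>" for j using that b_le[of j] unfolding S_iff \<rho>_def by (smt (verit))
      then have "(\<Sum>j\<in>UNIV. norm ((r $ j) *\<^sub>R w j)) \<le> (\<Sum>j\<in>UNIV. \<rho> * norm (w j))"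
        by (intro sum_mono) (simp add: mult_right_mono)
      then show ?thesis unfolding \<eta>_def H_def sum_distrib_left by (rule order_trans[OF norm_sum])
    qed
    have H0: "H \<ge> 0" unfolding H_def \<rho>_def by (intro mult_nonneg_nonneg sum_nonneg) auto
    have ratio: "\<bar>D \<alpha>\<bar> / \<bar>D (a j)\<bar> * exp (\<eta> r \<bullet> (exponent_vec \<alpha> - exponent_vec (a j)))
        \<le> 1 / (2 * (real (card A) + 1) * (Z + 1))" if "r \<in> S" "\<alpha> \<in> A - range a" for r \<alpha> j
    proof -
      have "\<eta> r \<bullet> (exponent_vec \<alpha> - exponent_vec (a j)) \<le> norm (\<eta> r) * norm (exponent_vec \<alpha> - exponent_vec (a j))"
        by (rule norm_cauchy_schwarz)
      also have "\<dots> \<le> H * G" using \<eta>_le[OF that(1)] EG[of \<alpha> j] that H0 by (intro mult_mono) auto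
      finally have 1: "exp (\<eta> r \<bullet> (exponent_vec \<alpha> - exponent_vec (a j))) \<le> exp (H * G)" by simp
      have 2: "\<bar>D \<alpha>\<bar> / \<bar>D (a j)\<bar> \<le> d / e"
        using Dsmall that Dj[rule_format, of j] e by (intro frac_le) (auto intro: less_imp_le)
      have "\<bar>D \<alpha>\<bar> / \<bar>D (a j)\<bar> * exp (\<eta> r \<bullet> (exponent_vec \<alpha> - exponent_vec (a j))) \<le> d / e * exp (H * G)"
        using 1 2 d0 e by (intro mult_mono) auto
      also have "\<dots> = 1 / (2 * (real (card A) + 1) * (Z + 1))" using e by (simp add: d_def)
      finally show ?thesis .
    qed
    have err_le: "\<bar>err j r\<bar> \<le> 1/2" if r: "r \<in> S" for j r
    proof -
      have "\<bar>err j r\<bar> \<le> (\<Sum>\<alpha>\<in>A - range a. \<bar>D \<alpha> * mon \<alpha> s / (D (a j) * mon (a j) s)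
        * exp (\<eta> r \<bullet> (exponent_vec \<alpha> - exponent_vec (a j))) * \<zeta> j \<alpha>\<bar>)"
        unfolding err_def by (rule sum_abs)
      also have "\<dots> \<le> (\<Sum>\<alpha>\<in>A - range a. 1 / (2 * (real (card A) + 1) * (Z + 1)) * (Z + 1))"
      proof (intro sum_mono)
        fix \<alpha> assume \<alpha>: "\<alpha> \<in> A - range a"
        have "\<bar>D \<alpha> * mon \<alpha> s / (D (a j) * mon (a j) s) * exp (\<eta> r \<bullet> (exponent_vec \<alpha> - exponent_vec (a j))) * \<zeta> j \<alpha>\<bar>
            = (\<bar>D \<alpha>\<bar> / \<bar>D (a j)\<bar> * exp (\<eta> r \<bullet> (exponent_vec \<alpha> - exponent_vec (a j)))) * \<bar>\<zeta> j \<alpha>\<bar>"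
          by (simp add: abs_mult ms)
        also have "\<dots> \<le> 1 / (2 * (real (card A) + 1) * (Z + 1)) * (Z + 1)"
          using ratio[OF r \<alpha>] \<zeta>Z[of \<alpha> j] \<alpha> Z0 by (intro mult_mono) auto
        finally show "\<bar>D \<alpha> * mon \<alpha> s / (D (a j) * mon (a j) s) * exp (\<eta> r \<bullet> (exponent_vec \<alpha> - exponent_vec (a j))) * \<zeta> j \<alpha>\<bar>
            \<le> 1 / (2 * (real (card A) + 1) * (Z + 1)) * (Z + 1)" .
      qed
      also have "\<dots> = real (card (A - range a)) * (1 / (2 * (real (card A) + 1)))" using Z0 by simp
      also have "\<dots> \<le> (real (card A) + 1) * (1 / (2 * (real (card A) + 1)))"
        using A card_mono[of A "A - range a"] by (intro mult_right_mono) auto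
      also have "\<dots> = 1/2" by (simp add: field_simps)
      finally show ?thesis .
    qed
    have ln_err: "\<bar>ln (1 + err j r)\<bar> \<le> 1" if "r \<in> S" for j r
    proof -
      have "\<bar>err j r\<bar> \<le> 1/2" by (rule err_le[OF that])
      then have "1/2 \<le> 1 + err j r" "1 + err j r \<le> 2" by (auto simp: abs_le_iff)
      then have "ln (1/2) \<le> ln (1 + err j r)" "ln (1 + err j r) \<le> ln 2" by (simp_all del: ln_div)
      moreover have "ln (2::real) \<le> 1" using ln_le_minus_one[of "2::real"] by simp
      ultimately show ?thesis by (simp add: ln_div)
    qed
    have "continuous_on S \<Phi>"
    proof -
      have "1 + err j r \<noteq> 0" if "r \<in> S" for j r using err_le[OF that, of j] by auto
      then show ?thesis unfolding \<Phi>_def err_def \<eta>_def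
        by (intro continuous_on_vec_lambda continuous_intros) auto
    qed
    moreover have "\<Phi> \<in> S \<rightarrow> S" using ln_err by (auto simp: S_iff \<Phi>_def)
    moreover have "S \<noteq> {}" using S_iff[of b] by auto
    ultimately obtain r where r: "r \<in> S" "\<Phi> r = r"
      using brouwer[of S \<Phi>] unfolding S_def by (auto simp: compact_cbox convex_box)
    define x :: "real ^ 'v" where "x = (\<chi> i. s $ i * exp (\<eta> r $ i))"
    \<comment> \<open>equals \<open>- ln \<bar>l\<bar>\<close>\<close>
    define u0 where "u0 = (\<Sum>j\<in>UNIV. r $ j * w0 j)"
    have mx: "mon \<alpha> x = mon \<alpha> s * exp (\<eta> r \<bullet> exponent_vec \<alpha>)" for \<alpha> unfolding x_def by (rule mon_exp)
    have \<eta>a: "\<eta> r \<bullet> exponent_vec (a j) = r $ j - u0" for j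
    proof -
      have "u0 + \<eta> r \<bullet> exponent_vec (a j) = (\<Sum>j'\<in>UNIV. r $ j' * (w0 j' + w j' \<bullet> exponent_vec (a j)))"
        by (simp add: u0_def \<eta>_def inner_sum_left distrib_left sum.distrib)
      also have "\<dots> = r $ j" unfolding dual by (simp add: mult_delta_right)
      finally show ?thesis by simp
    qed
    define T where "T = (\<lambda>\<alpha>. D \<alpha> * mon \<alpha> x)"
    define l where "l = \<tau> * exp (- u0)"
    have pos: "1 + err j r > 0" for j using err_le[OF r(1), of j] by auto
    have Tj: "T (a j) * (1 + err j r) = l * (w j \<bullet> v)" for j
    proof -
      have "r $ j = b $ j - ln (1 + err j r)" using arg_cong[OF r(2), of "\<lambda>y. y $ j"] by (simp add: \<Phi>_def)
      then have "exp (r $ j) = \<bar>w j \<bullet> v\<bar> / \<bar>D (a j)\<bar> / (1 + err j r)"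
        using nz pos[of j] by (simp add: b_def exp_diff)
      then have "exp (r $ j) * (1 + err j r) = \<bar>w j \<bullet> v\<bar> / \<bar>D (a j)\<bar>" using pos[of j] by simp
      then have *: "T (a j) * (1 + err j r) = (D (a j) / \<bar>D (a j)\<bar>) * mon (a j) s * \<bar>w j \<bullet> v\<bar> * exp (- u0)"
        by (simp add: T_def mx \<eta>a exp_diff exp_minus field_simps)
      have "(D (a j) / \<bar>D (a j)\<bar>) * mon (a j) s * \<bar>w j \<bullet> v\<bar> = \<tau> * (w j \<bullet> v)"
      proof -
        have "\<tau> * \<tau> = 1" using \<tau> by (metis abs_mult_self_eq mult_1)
        then have "mon (a j) s = \<tau> * (\<tau> * mon (a j) s)" by (simp flip: mult.assoc)
        then have m: "mon (a j) s = \<tau> * (if (D (a j) > 0) = (w j \<bullet> v > 0) then 1 else - 1)" unfolding sgn .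
        show ?thesis unfolding m using nz[of j] by (auto simp: abs_if)
      qed
      then show ?thesis unfolding * l_def by (simp add: mult_ac)
    qed
    have errT: "T (a j) * err j r = (\<Sum>\<alpha>\<in>A - range a. T \<alpha> * \<zeta> j \<alpha>)" for j
    proof -
      have nzm: "mon (a j) s \<noteq> 0" using ms[of "a j"] by auto
      show ?thesis unfolding err_def sum_distrib_left
        by (intro sum.cong) (use nz nzm in \<open>auto simp: T_def mx inner_diff_right exp_diff\<close>)
    qed
    have coord: "(\<Sum>\<alpha>\<in>A. T \<alpha> * \<zeta> j \<alpha>) = l * (w j \<bullet> v)" for j
    proof -
      have "(\<Sum>\<alpha>\<in>A. T \<alpha> * \<zeta> j \<alpha>) = (\<Sum>\<alpha>\<in>range a. T \<alpha> * \<zeta> j \<alpha>) + (\<Sum>\<alpha>\<in>A - range a. T \<alpha> * \<zeta> j \<alpha>)"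
        using A by (simp add: sum.subset_diff add.commute)
      also have "(\<Sum>\<alpha>\<in>range a. T \<alpha> * \<zeta> j \<alpha>) = (\<Sum>j'\<in>UNIV. T (a j') * (if j = j' then 1 else 0))"
        by (simp add: sum.reindex[OF inj] \<zeta>_def dual)
      also have "\<dots> = T (a j)" by (simp add: mult_delta_right)
      finally show ?thesis using Tj[of j] errT[of j] by (simp add: distrib_left)
    qed
    have "poly_fun A D x = (\<Sum>\<alpha>\<in>A. T \<alpha> * (\<Sum>j\<in>UNIV. \<zeta> j \<alpha>))"
      unfolding poly_fun_def T_def \<zeta>_def sum.distrib w01 w1 by simp
    also have "\<dots> = (\<Sum>j\<in>UNIV. \<Sum>\<alpha>\<in>A. T \<alpha> * \<zeta> j \<alpha>)"
      unfolding sum_distrib_left by (rule sum.swap)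
    also have "\<dots> = 0" unfolding coord using w1[of v] by (simp flip: sum_distrib_left)
    finally have p0: "poly_fun A D x = 0" .
    have "(\<Sum>j\<in>UNIV. \<zeta> j \<alpha> *\<^sub>R exponent_vec (a j)) = exponent_vec \<alpha>" for \<alpha>
      unfolding \<zeta>_def scaleR_left_distrib sum.distrib w0E wE by simp
    then have "log_gradient A D x = (\<Sum>\<alpha>\<in>A. T \<alpha> *\<^sub>R (\<Sum>j\<in>UNIV. \<zeta> j \<alpha> *\<^sub>R exponent_vec (a j)))"
      unfolding log_gradient_def T_def by simp
    also have "\<dots> = (\<Sum>j\<in>UNIV. \<Sum>\<alpha>\<in>A. (T \<alpha> * \<zeta> j \<alpha>) *\<^sub>R exponent_vec (a j))"
      unfolding scaleR_sum_right scaleR_scaleR by (rule sum.swap)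
    also have "\<dots> = l *\<^sub>R (\<Sum>j\<in>UNIV. (w j \<bullet> v) *\<^sub>R exponent_vec (a j))"
      unfolding scaleR_sum_left[symmetric] coord by (simp add: scaleR_sum_right)
    finally have lg: "log_gradient A D x = l *\<^sub>R v" unfolding wE .
    have "x $ i \<noteq> 0" for i using s[of i] by (auto simp: x_def)
    moreover have "l \<noteq> 0" using \<tau> by (auto simp: l_def)
    ultimately have "x \<in> gauss_fibre A D v" using p0 lg by (auto simp: gauss_fibre_def)
    moreover have "\<bar>D \<alpha> * mon \<alpha> x\<bar> < \<bar>D (a j) * mon (a j) x\<bar>" if \<alpha>: "\<alpha> \<in> A - range a" for \<alpha> j
    proof -
      have "2 * (real (card A) + 1) * (Z + 1) \<ge> 2 * 1 * 1" using Z0 by (intro mult_mono) auto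
      then have "1 / (2 * (real (card A) + 1) * (Z + 1)) \<le> 1/2" by (intro divide_left_mono) auto
      then have "\<bar>D \<alpha>\<bar> / \<bar>D (a j)\<bar> * exp (\<eta> r \<bullet> (exponent_vec \<alpha> - exponent_vec (a j))) < 1"
        using ratio[OF r(1) \<alpha>, of j] by linarith
      then have "\<bar>D \<alpha>\<bar> * exp (\<eta> r \<bullet> exponent_vec \<alpha>) < \<bar>D (a j)\<bar> * exp (\<eta> r \<bullet> exponent_vec (a j))"
        using nz[of j] by (simp add: inner_diff_right exp_diff divide_simps)
      then show ?thesis by (simp add: mx abs_mult ms)
    qed
    ultimately show "\<exists>x \<in> gauss_fibre A D v. \<forall>\<alpha>\<in>A - range a. \<forall>j. \<bar>D \<alpha> * mon \<alpha> x\<bar> < \<bar>D (a j) * mon (a j) x\<bar>" by blast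
  qed
qed

section \<open>Vertices of primitive simplices\<close>

text \<open>A copy of a finite type with a well-order on it: the determinant formula for the volume of a simplex
  concerns vectors indexed by a well-ordered type.\<close>

typedef 'v wo = "UNIV :: 'v set" morphisms of_wo to_wo ..

definition wo_rank :: "'v::finite wo \<Rightarrow> nat" where
  "wo_rank x = (SOME f :: 'v \<Rightarrow> nat. inj f) (of_wo x)"

lemma inj_wo_rank: "inj (wo_rank :: 'v::finite wo \<Rightarrow> nat)"
proof -
  have "\<exists>f. bij_betw f (UNIV :: 'v set) {0..<CARD('v)}" by (rule ex_bij_betw_finite_nat) simp
  then have "\<exists>f :: 'v \<Rightarrow> nat. inj f" by (auto simp: bij_betw_def)
  then have inj: "inj (SOME f :: 'v \<Rightarrow> nat. inj f)" by (rule someI_ex)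
  show ?thesis
  proof (rule injI)
    fix x y :: "'v wo" assume "wo_rank x = wo_rank y"
    then have "of_wo x = of_wo y" unfolding wo_rank_def by (rule injD[OF inj])
    then show "x = y" by (simp add: of_wo_inject)
  qed
qed

lemma bij_of_wo: "bij of_wo"
  by (metis bijI' of_wo_inject to_wo_inverse UNIV_I)

instance wo :: (finite) finite
proof
  show "finite (UNIV :: 'a wo set)"
    using finite_imageD[of of_wo UNIV] bij_of_wo by (metis bij_def finite)
qed

instantiation wo :: (finite) wellorder
begin
definition "x \<le> y \<longleftrightarrow> wo_rank x \<le> wo_rank (y :: 'a wo)"
definition "x < y \<longleftrightarrow> wo_rank x < wo_rank (y :: 'a wo)"
instance
proof
  fix P :: "'a wo \<Rightarrow> bool" and a :: "'a wo"
  assume *: "\<And>x. (\<And>y. y < x \<Longrightarrow> P y) \<Longrightarrow> P x"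
  show "P a" by (induction a rule: measure_induct_rule[of wo_rank]) (auto intro: * simp: less_wo_def)
qed (auto simp: less_eq_wo_def less_wo_def dest: injD[OF inj_wo_rank])
end

lemma Ints_det: "(\<And>i j. M $ i $ j \<in> \<int>) \<Longrightarrow> det (M :: real ^ 'n::finite ^ 'n) \<in> \<int>"
  unfolding det_def by (auto intro!: Ints_sum Ints_mult Ints_prod)

text \<open>Cramer's rule, whose denominator is a unit.\<close>

lemma unimodular_solution:
  fixes M :: "real ^ 'n::finite ^ 'n"
  assumes M: "\<And>i j. M $ i $ j \<in> \<int>" and det: "\<bar>det M\<bar> = 1" and b: "\<And>i. b $ i \<in> \<int>"
  shows "\<exists>x. M *v x = b \<and> (\<forall>i. x $ i \<in> \<int>)"
proof -
  define x where "x = (\<chi> k. det (\<chi> i j. if j = k then b $ i else M $ i $ j) / det M)"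
  have "det M \<noteq> 0" using det by auto
  then have "M *v x = b" by (simp add: cramer x_def)
  moreover have "x $ k \<in> \<int>" for k
  proof -
    have d: "det (\<chi> i j. if j = k then b $ i else M $ i $ j) \<in> \<int>" using M b by (intro Ints_det) auto
    have "det M = 1 \<or> det M = -1" using det by auto
    then show ?thesis using d by (auto simp: x_def)
  qed
  ultimately show ?thesis by blast
qed

text \<open>The matrix of edge vectors is integral, and by the volume formula its determinant is a unit.\<close>

lemma lattice_simplex_unit_volume_wo:
  fixes V :: "(real ^ 'n::{finite,wellorder}) set"
  assumes V: "finite V" "card V = Suc CARD('n)" "\<And>p i. p \<in> V \<Longrightarrow> p $ i \<in> \<int>"
    and vol: "measure lborel (convex hull V) = 1 / fact CARD('n)"
  shows "\<exists>k :: _ \<Rightarrow> int. (\<Sum>p\<in>V. k p) = 0 \<and> (\<Sum>p\<in>V. of_int (k p) *\<^sub>R p) = axis i 1"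
proof -
  obtain x0 where x0: "x0 \<in> V" using V by fastforce
  have "card (V - {x0}) = CARD('n)" using V x0 by simp
  then obtain f :: "'n \<Rightarrow> (real, 'n) vec" where f: "bij_betw f UNIV (V - {x0})"
    using finite_same_card_bij[of "UNIV :: 'n set" "V - {x0}"] V by auto
  define M where "M = (\<chi> i j. f j $ i - x0 $ i)"
  have fV: "f j \<in> V" for j using f by (auto simp: bij_betw_def)
  have "\<bar>det M\<bar> / fact CARD('n) = 1 / fact CARD('n)"
    using content_simplex[OF V(1,2) x0 f] vol unfolding M_def by simp
  then have "\<bar>det M\<bar> = 1" by (simp add: field_simps)
  moreover have "M $ i $ j \<in> \<int>" for i j using V(3)[OF x0] V(3)[OF fV] by (auto simp: M_def)
  moreover have "axis i (1::real) $ j \<in> \<int>" for j by (auto simp: axis_def)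
  ultimately obtain y where y: "M *v y = axis i 1" "\<And>j. y $ j \<in> \<int>" using unimodular_solution[of M "axis i 1"] by blast
  have "\<forall>j. \<exists>m. y $ j = of_int m" using y(2) by (auto elim: Ints_cases)
  from choice[OF this] obtain z where z: "\<And>j. y $ j = of_int (z j)" by blast
  have "(\<Sum>j\<in>UNIV. of_int (z j) *\<^sub>R (f j - x0)) = axis i 1"
    unfolding y(1)[symmetric] by (auto simp: vec_eq_iff matrix_vector_mult_def M_def z mult.commute)
  then have e: "(\<Sum>j\<in>UNIV. of_int (z j) *\<^sub>R f j) - (\<Sum>j\<in>UNIV. of_int (z j)) *\<^sub>R x0 = axis i 1"
    by (simp add: scaleR_diff_right sum_subtractf scaleR_left.sum)
  define k where "k = (\<lambda>p. if p = x0 then - (\<Sum>j\<in>UNIV. z j) else z (inv_into UNIV f p))"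
  have inv: "inv_into UNIV f (f j) = j" for j using f by (intro inv_into_f_f) (auto simp: bij_betw_def)
  have ne: "f j \<noteq> x0" for j using f by (auto simp: bij_betw_def)
  have 1: "(\<Sum>p\<in>V. k p) = 0"
  proof -
    have "(\<Sum>p\<in>V. k p) = k x0 + (\<Sum>p\<in>V-{x0}. k p)" using V x0 by (simp add: sum.remove)
    also have "(\<Sum>p\<in>V-{x0}. k p) = (\<Sum>j\<in>UNIV. k (f j))" by (rule sum.reindex_bij_betw[OF f, symmetric])
    finally show ?thesis by (simp add: k_def ne inv)
  qed
  have 2: "(\<Sum>p\<in>V. of_int (k p) *\<^sub>R p) = axis i 1"
  proof -
    have "(\<Sum>p\<in>V. of_int (k p) *\<^sub>R p) = of_int (k x0) *\<^sub>R x0 + (\<Sum>p\<in>V-{x0}. of_int (k p) *\<^sub>R p)"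
      using V x0 by (simp add: sum.remove)
    also have "(\<Sum>p\<in>V-{x0}. of_int (k p) *\<^sub>R p) = (\<Sum>j\<in>UNIV. of_int (k (f j)) *\<^sub>R f j)"
      by (rule sum.reindex_bij_betw[OF f, symmetric])
    finally show ?thesis using e by (simp add: k_def ne inv)
  qed
  from 1 2 show ?thesis by blast
qed

definition reindex_wo :: "real ^ 'v \<Rightarrow> real ^ 'v wo" where
  "reindex_wo x = (\<chi> i. x $ of_wo i)"

lemma linear_reindex_wo: "linear (reindex_wo :: real ^ 'v::finite \<Rightarrow> _)"
  by (auto simp: linear_iff reindex_wo_def vec_eq_iff)

lemma inj_reindex_wo: "inj (reindex_wo :: real ^ 'v::finite \<Rightarrow> _)"
  by (rule injI) (metis reindex_wo_def vec_eq_iff vec_lambda_beta to_wo_inverse UNIV_I)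

lemma prod_Basis_cart: "(\<Prod>b\<in>(Basis :: (real ^ 'n::finite) set). f b) = (\<Prod>i\<in>UNIV. f (axis i 1))"
proof -
  have "(Basis :: (real ^ 'n) set) = (\<lambda>i. axis i 1) ` UNIV" by (auto simp: Basis_vec_def)
  moreover have "inj (\<lambda>i :: 'n. axis i (1::real))" by (auto simp: inj_def axis_eq_axis)
  ultimately show ?thesis by (metis (no_types) prod.reindex_cong)
qed

text \<open>Permuting coordinates preserves the volume of boxes.\<close>

lemma distr_reindex_wo: "distr lborel borel (reindex_wo :: real ^ 'v::finite \<Rightarrow> _) = lborel"
proof (rule lborel_eqI[symmetric])
  fix l u :: "real ^ 'v wo" assume le: "\<And>b. b \<in> Basis \<Longrightarrow> l \<bullet> b \<le> u \<bullet> b"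
  define l' u' :: "real ^ 'v" where "l' = (\<chi> i. l $ to_wo i)" and "u' = (\<chi> i. u $ to_wo i)"
  have le': "l $ i \<le> u $ i" for i using le[of "axis i 1"] by (simp add: inner_axis)
  have m: "reindex_wo \<in> borel_measurable (borel :: (real ^ 'v) measure)"
    by (intro borel_measurable_continuous_onI linear_continuous_on linear_linear[THEN iffD2] linear_reindex_wo)
  have "emeasure (distr lborel borel (reindex_wo :: real ^ 'v \<Rightarrow> _)) (box l u)
      = emeasure lborel (reindex_wo -` box l u :: (real ^ 'v) set)"
    using m by (subst emeasure_distr) auto
  also have "reindex_wo -` box l u = box l' u'"
  proof -
    have "(\<forall>i. l $ i < x $ of_wo i \<and> x $ of_wo i < u $ i) \<longleftrightarrow> (\<forall>i. l $ to_wo i < x $ i \<and> x $ i < u $ to_wo i)" for x :: "real ^ 'v"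
      by (metis of_wo_inverse to_wo_inverse UNIV_I)
    then show ?thesis by (auto simp: mem_box_cart reindex_wo_def l'_def u'_def)
  qed
  also have "emeasure lborel (box l' u') = (\<Prod>b\<in>Basis. (u' - l') \<bullet> b)"
    by (rule emeasure_lborel_box) (auto simp: Basis_vec_def inner_axis l'_def u'_def le')
  also have "(\<Prod>b\<in>Basis. (u' - l') \<bullet> b) = (\<Prod>i\<in>UNIV. u $ to_wo i - l $ to_wo i)"
    by (simp add: prod_Basis_cart inner_axis l'_def u'_def)
  also have "\<dots> = (\<Prod>i\<in>UNIV. u $ i - l $ i)"
    by (rule prod.reindex_bij_witness[of _ of_wo to_wo]) (auto simp: of_wo_inverse to_wo_inverse)
  also have "\<dots> = (\<Prod>b\<in>Basis. (u - l) \<bullet> b)" by (simp add: prod_Basis_cart inner_axis)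
  finally show "emeasure (distr lborel borel (reindex_wo :: real ^ 'v \<Rightarrow> _)) (box l u) = ennreal (\<Prod>b\<in>Basis. (u - l) \<bullet> b)" .
qed simp

lemma lattice_simplex_unit_volume:
  fixes V :: "(real ^ 'v::finite) set"
  assumes V: "finite V" "card V = Suc CARD('v)" "\<And>p i. p \<in> V \<Longrightarrow> p $ i \<in> \<int>"
    and vol: "measure lborel (convex hull V) = 1 / fact CARD('v)"
  shows "\<exists>k :: _ \<Rightarrow> int. (\<Sum>p\<in>V. k p) = 0 \<and> (\<Sum>p\<in>V. of_int (k p) *\<^sub>R p) = axis i 1"
proof -
  let ?R = "reindex_wo :: real ^ 'v \<Rightarrow> _"
  have inj: "inj_on ?R X" for X using inj_reindex_wo by (rule inj_on_subset) simp
  have card_wo: "CARD('v wo) = CARD('v)" using bij_of_wo by (rule bij_betw_same_card)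
  have m: "?R \<in> borel_measurable borel"
    by (intro borel_measurable_continuous_onI linear_continuous_on linear_linear[THEN iffD2] linear_reindex_wo)
  have hull: "convex hull (?R ` V) = ?R ` (convex hull V)"
    by (rule convex_hull_linear_image[OF linear_reindex_wo, symmetric])
  have "compact (convex hull (?R ` V))" using V by (intro finite_imp_compact_convex_hull) auto
  then have "convex hull (?R ` V) \<in> sets borel" by (intro borel_closed compact_imp_closed)
  then have "measure lborel (convex hull (?R ` V)) = measure lborel (?R -` (convex hull (?R ` V)))"
    using m by (subst distr_reindex_wo[symmetric], subst measure_distr) auto
  also have "?R -` (convex hull (?R ` V)) = convex hull V"
    unfolding hull by (simp add: inj_vimage_image_eq inj_reindex_wo)
  finally have vol': "measure lborel (convex hull (?R ` V)) = 1 / fact CARD('v wo)"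
    using vol card_wo by simp
  have "\<exists>k :: _ \<Rightarrow> int. (\<Sum>p\<in>?R ` V. k p) = 0 \<and> (\<Sum>p\<in>?R ` V. of_int (k p) *\<^sub>R p) = axis (to_wo i) 1"
  proof (rule lattice_simplex_unit_volume_wo)
    show "card (?R ` V) = Suc CARD('v wo)" using V inj card_wo by (simp add: card_image)
    show "p $ i \<in> \<int>" if "p \<in> ?R ` V" for p i using that V(3) by (auto simp: reindex_wo_def)
  qed (use V vol' in auto)
  then obtain k :: "_ \<Rightarrow> int" where k: "(\<Sum>p\<in>V. k (?R p)) = 0" "(\<Sum>p\<in>V. of_int (k (?R p)) *\<^sub>R ?R p) = axis (to_wo i) 1"
    by (auto simp: sum.reindex[OF inj])
  have "?R (\<Sum>p\<in>V. of_int (k (?R p)) *\<^sub>R p) = (\<Sum>p\<in>V. of_int (k (?R p)) *\<^sub>R ?R p)"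
    by (simp add: linear_sum[OF linear_reindex_wo] linear_scale[OF linear_reindex_wo])
  also have "\<dots> = ?R (axis i 1)" unfolding k(2)
    by (auto simp: reindex_wo_def axis_def vec_eq_iff of_wo_inverse to_wo_inverse)
  finally have "(\<Sum>p\<in>V. of_int (k (?R p)) *\<^sub>R p) = axis i 1"
    by (rule injD[OF inj_reindex_wo])
  with k(1) show ?thesis by (intro exI[of _ "\<lambda>p. k (?R p)"]) auto
qed

text \<open>The vertices generate the lattice affinely because of the volume. Consequently a lattice point of the
  simplex has integral barycentric coordinates; as these are nonnegative with sum \<open>1\<close>, the point is a
  vertex. Hence the exponents in \<open>S\<close> are exactly the vertices.\<close>

lemma primitive_simplex_vertices:
  fixes S :: "('v::finite \<Rightarrow>\<^sub>0 nat) set"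
  assumes S: "finite S" and prim: "primitive_simplex (convex hull (exponent_vec ` S))"
  shows "\<exists>a :: 'v option \<Rightarrow> 'v \<Rightarrow>\<^sub>0 nat. inj a \<and> range a = S \<and> affinely_generates S"
proof -
  let ?C = "convex hull (exponent_vec ` S)"
  obtain V where V: "\<not> affine_dependent V" "int (card V) = int CARD('v) + 1" "?C = convex hull V"
    using prim unfolding primitive_simplex_def simplex_def by blast
  have finV: "finite V" by (rule aff_independent_finite[OF V(1)])
  have "V \<subseteq> exponent_vec ` S"
  proof
    fix p assume "p \<in> V"
    then have "p extreme_point_of ?C" unfolding V(3) by (simp add: extreme_point_of_convex_hull_affine_independent[OF V(1)])
    then show "p \<in> exponent_vec ` S" by (rule extreme_point_of_convex_hull)
  qed
  then obtain S0 where S0: "S0 \<subseteq> S" "V = exponent_vec ` S0" by (meson subset_imageE)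
  have injE: "inj_on exponent_vec X" for X :: "('v \<Rightarrow>\<^sub>0 nat) set" by (simp add: inj_on_def)
  have finS0: "finite S0" using S S0 finite_subset by blast
  have cardS0: "card S0 = Suc CARD('v)" using V(2) S0 card_image[OF injE, of S0] by simp
  have gen0: "affinely_generates S0" unfolding affinely_generates_def
  proof
    fix i
    have "\<exists>k :: _ \<Rightarrow> int. (\<Sum>p\<in>V. k p) = 0 \<and> (\<Sum>p\<in>V. of_int (k p) *\<^sub>R p) = axis i 1"
      using prim S0 cardS0 card_image[OF injE, of S0] finV V(3)
      by (intro lattice_simplex_unit_volume) (auto simp: primitive_simplex_def)
    then obtain k :: "_ \<Rightarrow> int" where "(\<Sum>p\<in>V. k p) = 0" "(\<Sum>p\<in>V. of_int (k p) *\<^sub>R p) = axis i 1" by blast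
    then show "\<exists>k :: _ \<Rightarrow> int. (\<Sum>\<alpha>\<in>S0. k \<alpha>) = 0 \<and> (\<Sum>\<alpha>\<in>S0. of_int (k \<alpha>) *\<^sub>R exponent_vec \<alpha>) = axis i 1"
      unfolding S0(2) by (intro exI[of _ "\<lambda>\<alpha>. k (exponent_vec \<alpha>)"]) (simp add: sum.reindex[OF injE])
  qed
  have "card (UNIV :: 'v option set) = card S0" using cardS0 by (simp add: card_UNIV_option)
  then obtain a :: "'v option \<Rightarrow> 'v \<Rightarrow>\<^sub>0 nat" where a: "bij_betw a UNIV S0"
    using finite_same_card_bij[of "UNIV :: 'v option set" S0] finS0 by auto
  then have inj: "inj a" and ran: "range a = S0" by (auto simp: bij_betw_def)
  obtain w0 w where dual: "\<And>j j'. w0 j + w j \<bullet> exponent_vec (a j') = (if j = j' then 1 else (0::real))"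
    and int: "\<And>j \<alpha>. w0 j + w j \<bullet> exponent_vec \<alpha> \<in> \<int>"
    using barycentric_coordinates[OF inj] gen0 ran by metis
  have "S \<subseteq> S0"
  proof
    fix \<alpha> assume "\<alpha> \<in> S"
    then have "exponent_vec \<alpha> \<in> ?C" by (auto intro: hull_inc)
    also have "?C = convex hull (range (\<lambda>j. exponent_vec (a j)))"
      unfolding V(3) S0(2) ran[symmetric] by (simp add: image_image)
    finally have "exponent_vec \<alpha> \<in> convex hull ((\<lambda>j. exponent_vec (a j)) ` UNIV)" .
    moreover have injEa: "inj (\<lambda>j. exponent_vec (a j))" using inj by (simp add: inj_def)
    ultimately obtain u' where u': "\<forall>j. u' (exponent_vec (a j)) \<ge> (0::real)" "(\<Sum>j\<in>UNIV. u' (exponent_vec (a j))) = 1"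
        "(\<Sum>j\<in>UNIV. u' (exponent_vec (a j)) *\<^sub>R exponent_vec (a j)) = exponent_vec \<alpha>"
      by (auto simp: convex_hull_finite sum.reindex[OF injEa])
    define u where "u = (\<lambda>j. u' (exponent_vec (a j)))"
    have u: "\<And>j. u j \<ge> (0::real)" "sum u UNIV = 1" "(\<Sum>j\<in>UNIV. u j *\<^sub>R exponent_vec (a j)) = exponent_vec \<alpha>"
      using u' by (auto simp: u_def)
    have "u j = w0 j + w j \<bullet> exponent_vec \<alpha>" for j
    proof -
      have "w0 j + w j \<bullet> exponent_vec \<alpha> = (\<Sum>j'\<in>UNIV. u j' * (w0 j + w j \<bullet> exponent_vec (a j')))"
        unfolding u(3)[symmetric] using u(2)
        by (simp add: inner_sum_right distrib_left sum.distrib flip: sum_distrib_right)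
      also have "\<dots> = u j" unfolding dual by (simp add: mult_delta_right)
      finally show ?thesis by simp
    qed
    then have ui: "u j \<in> \<int>" for j using int by simp
    have "\<exists>j. u j \<noteq> 0" using u(2) by (metis sum.neutral zero_neq_one)
    then obtain j where j: "u j \<noteq> 0" by blast
    then have "u j \<ge> 1" using ui[of j] u(1)[of j] by (auto elim!: Ints_cases)
    moreover have "u j + (\<Sum>j'\<in>UNIV-{j}. u j') = 1" using u(2) by (simp add: sum.remove)
    moreover have "(\<Sum>j'\<in>UNIV-{j}. u j') \<ge> 0" using u(1) by (intro sum_nonneg) auto
    ultimately have "u j = 1" "(\<Sum>j'\<in>UNIV-{j}. u j') = 0" by linarith+
    then have "u j' = (if j' = j then 1 else 0)" for j'
      using u(1) by (auto simp: sum_nonneg_eq_0_iff)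
    then have "exponent_vec \<alpha> = exponent_vec (a j)"
      unfolding u(3)[symmetric] by (simp add: if_distrib[of "\<lambda>c. c *\<^sub>R _"] cong: if_cong)
    then show "\<alpha> \<in> S0" using ran by auto
  qed
  then show ?thesis using S0 inj ran gen0 by (intro exI[of _ a]) auto
qed

section \<open>The regular subdivision covers the Newton polytope\<close>

lemma trop_monomial_continuous: "continuous_on S (\<lambda>X. trop_monomial f \<alpha> X)"
  unfolding trop_monomial_def by (intro continuous_intros)

lemma trop_monomial_le: "finite (dom f) \<Longrightarrow> \<alpha> \<in> dom f \<Longrightarrow> trop_monomial f \<alpha> X \<le> trop_fun f X"
  unfolding trop_fun_def by (intro Max_ge) auto

lemma trop_fun_attained:
  assumes "finite (dom f)" "dom f \<noteq> {}"
  obtains \<alpha> where "\<alpha> \<in> dom f" "trop_monomial f \<alpha> X = trop_fun f X"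
proof -
  have "trop_fun f X \<in> (\<lambda>\<alpha>. trop_monomial f \<alpha> X) ` dom f"
    unfolding trop_fun_def using assms by (intro Max_in) auto
  then obtain \<alpha> where "trop_fun f X = trop_monomial f \<alpha> X" "\<alpha> \<in> dom f" by (rule imageE)
  then show ?thesis using that[of \<alpha>] by simp
qed

lemma continuous_on_Max:
  fixes g :: "'i \<Rightarrow> 'a::topological_space \<Rightarrow> real"
  assumes "finite I" "I \<noteq> {}" "\<And>i. i \<in> I \<Longrightarrow> continuous_on S (g i)"
  shows "continuous_on S (\<lambda>x. MAX i\<in>I. g i x)"
  using assms
proof (induction I rule: finite_ne_induct)
  case (insert i I)
  have "continuous_on S (\<lambda>x. max (g i x) (MAX i\<in>I. g i x))"
    using insert by (intro continuous_on_max) auto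
  then show ?case using insert by simp
qed simp

lemma dom_initial_form: "dom (initial_form w f) = {\<alpha> \<in> dom f. trop_monomial f \<alpha> w = trop_fun f w}"
  by (auto simp: initial_form_def dom_def restrict_map_def)

text \<open>The function \<open>X \<mapsto> trop_fun f X - X \<bullet> p\<close> is convex and, \<open>p\<close> being interior, grows at least linearly at
  infinity, so it has a minimum \<open>w\<close>. If \<open>p\<close> were outside the cell of \<open>w\<close>, a separating direction would
  decrease all the maximal monomials at \<open>w\<close> at once, hence also the function.\<close>

lemma interior_in_cell:
  fixes f :: "'v::finite tpolynomial"
  assumes fin: "finite (dom f)" and p: "p \<in> interior (newton_polytope f)"
  shows "\<exists>w. p \<in> newton_polytope (initial_form w f)"
proof -
  have ne: "dom f \<noteq> {}" using p by (auto simp: newton_polytope_def)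
  define h where "h = (\<lambda>X. trop_fun f X - X \<bullet> p)"
  obtain r where r: "r > 0" "cball p r \<subseteq> newton_polytope f"
    using p by (meson mem_interior_cball)
  define m where "m = Min ((\<lambda>\<alpha>. the (f \<alpha>)) ` dom f)"
  have m: "m \<le> the (f \<alpha>)" if "\<alpha> \<in> dom f" for \<alpha> unfolding m_def using that fin by (intro Min_le) auto
  have coercive: "m + r * norm X \<le> h X" for X
  proof -
    define q where "q = p + r *\<^sub>R sgn X"
    have "dist p q \<le> r" using r by (simp add: q_def dist_norm norm_sgn)
    then have "q \<in> newton_polytope f" using r by auto
    then have "\<exists>\<alpha>\<in>dom f. X \<bullet> q \<le> X \<bullet> exponent_vec \<alpha>"
    proof (rule contrapos_pp)
      assume "\<not> (\<exists>\<alpha>\<in>dom f. X \<bullet> q \<le> X \<bullet> exponent_vec \<alpha>)"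
      then have "newton_polytope f \<subseteq> {y. X \<bullet> y < X \<bullet> q}" unfolding newton_polytope_def
        by (intro hull_minimal convex_halfspace_lt) (fastforce simp: not_le)
      then show "q \<notin> newton_polytope f" by auto
    qed
    then obtain \<alpha> where \<alpha>: "\<alpha> \<in> dom f" "X \<bullet> q \<le> X \<bullet> exponent_vec \<alpha>" by blast
    have "X \<bullet> q = X \<bullet> p + r * norm X"
      by (simp add: q_def inner_add_right sgn_div_norm dot_square_norm power2_eq_square divide_simps)
    then show ?thesis using \<alpha> m[OF \<alpha>(1)] trop_monomial_le[OF fin \<alpha>(1), of X]
      unfolding h_def trop_monomial_def by linarith
  qed
  have conth: "continuous_on S h" for S
    unfolding h_def trop_fun_def by (intro continuous_intros continuous_on_Max fin ne trop_monomial_continuous)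
  \<comment> \<open>outside the ball of radius \<open>R\<close> the values of \<open>h\<close> are at least \<open>h 0\<close>\<close>
  define R where "R = (\<bar>h 0\<bar> + \<bar>m\<bar>) / r"
  have R0: "R \<ge> 0" using r by (simp add: R_def)
  have "\<exists>w\<in>cball 0 R. \<forall>X\<in>cball 0 R. h w \<le> h X"
    by (rule continuous_attains_inf) (use conth R0 in auto)
  then obtain w where w: "w \<in> cball 0 R" "\<And>X. X \<in> cball 0 R \<Longrightarrow> h w \<le> h X" by blast
  have wmin: "h w \<le> h X" for X
  proof (cases "X \<in> cball 0 R")
    case False
    then have "R * r \<le> norm X * r" using r by (intro mult_right_mono) auto
    then have "\<bar>h 0\<bar> + \<bar>m\<bar> \<le> r * norm X" using r by (simp add: R_def mult.commute)
    then have "h 0 \<le> h X" using coercive[of X] by linarith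
    moreover have "h w \<le> h 0" using R0 by (intro w) simp
    ultimately show ?thesis by linarith
  qed (use w in auto)
  define Q where "Q = newton_polytope (initial_form w f)"
  have "p \<in> Q"
  proof (rule ccontr)
    assume pQ: "p \<notin> Q"
    have "finite (dom (initial_form w f))" by (rule finite_subset[OF _ fin]) (auto simp: dom_initial_form)
    then have "compact Q" unfolding Q_def newton_polytope_def by (intro finite_imp_compact_convex_hull) auto
    moreover have "convex Q" unfolding Q_def newton_polytope_def by (rule convex_convex_hull)
    ultimately have "\<exists>u b. u \<bullet> p < b \<and> (\<forall>x\<in>Q. b < u \<bullet> x)"
      using pQ by (intro separating_hyperplane_closed_point compact_imp_closed)
    then obtain u b where u: "u \<bullet> p < b" "\<forall>x\<in>Q. u \<bullet> x > b" by (elim exE conjE)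
    have "\<forall>\<^sub>F s in at_right (0::real). trop_monomial f \<alpha> (w - s *\<^sub>R u) - (w - s *\<^sub>R u) \<bullet> p < h w" if \<alpha>: "\<alpha> \<in> dom f" for \<alpha>
    proof (cases "trop_monomial f \<alpha> w = trop_fun f w")
      case True
      then have "exponent_vec \<alpha> \<in> Q" using \<alpha> unfolding Q_def newton_polytope_def
        by (intro hull_inc) (auto simp: dom_initial_form)
      then have "u \<bullet> exponent_vec \<alpha> - u \<bullet> p > 0" using u by fastforce
      moreover have "trop_monomial f \<alpha> (w - s *\<^sub>R u) - (w - s *\<^sub>R u) \<bullet> p = h w - s * (u \<bullet> exponent_vec \<alpha> - u \<bullet> p)" for s
        unfolding h_def True[symmetric] by (simp add: trop_monomial_def inner_diff_left algebra_simps)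
      ultimately show ?thesis
        by (intro eventually_mono[OF eventually_at_right_less]) simp
    next
      case False
      then have lt: "trop_monomial f \<alpha> w - w \<bullet> p < h w"
        using trop_monomial_le[OF fin \<alpha>, of w] by (simp add: h_def)
      have "((\<lambda>s. trop_monomial f \<alpha> (w - s *\<^sub>R u) - (w - s *\<^sub>R u) \<bullet> p) \<longlongrightarrow>
          trop_monomial f \<alpha> (w - 0 *\<^sub>R u) - (w - 0 *\<^sub>R u) \<bullet> p) (at_right 0)"
        unfolding trop_monomial_def by (intro tendsto_intros)
      then show ?thesis by (rule order_tendstoD(2)) (use lt in simp)
    qed
    then have "\<forall>\<^sub>F s in at_right (0::real). \<forall>\<alpha>\<in>dom f. trop_monomial f \<alpha> (w - s *\<^sub>R u) - (w - s *\<^sub>R u) \<bullet> p < h w"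
      using fin by (intro eventually_ball_finite) auto
    from eventually_happens'[OF trivial_limit_at_right_real this]
    obtain s :: real where s: "\<forall>\<alpha>\<in>dom f. trop_monomial f \<alpha> (w - s *\<^sub>R u) - (w - s *\<^sub>R u) \<bullet> p < h w" by blast
    obtain \<alpha> where \<alpha>: "\<alpha> \<in> dom f" "trop_monomial f \<alpha> (w - s *\<^sub>R u) = trop_fun f (w - s *\<^sub>R u)"
      using trop_fun_attained[OF fin ne] by blast
    have "h (w - s *\<^sub>R u) < h w"
      using bspec[OF s \<alpha>(1)] \<alpha>(2) by (simp add: h_def)
    with wmin[of "w - s *\<^sub>R u"] show False by simp
  qed
  then show ?thesis by (auto simp: Q_def)
qed

definition full_cells :: "'v::finite tpolynomial \<Rightarrow> (real ^ 'v) set set" where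
  "full_cells f = {C \<in> subdivision_cells f. aff_dim C = int CARD('v)}"

lemma finite_subdivision_cells:
  fixes f :: "'v::finite tpolynomial"
  assumes "finite (dom f)" shows "finite (subdivision_cells f)"
proof (rule finite_subset)
  show "subdivision_cells f \<subseteq> (\<lambda>S. convex hull (exponent_vec ` S)) ` Pow (dom f)"
    by (auto simp: subdivision_cells_def newton_polytope_def dom_initial_form)
qed (use assms in auto)

lemma primitive_simplex_aff_dim: "primitive_simplex (C :: (real ^ 'v::finite) set) \<Longrightarrow> aff_dim C = int CARD('v)"
  by (simp add: primitive_simplex_def aff_dim_simplex)

lemma nonsingular_full_cells:
  fixes f :: "'v::finite tpolynomial"
  assumes fin: "finite (dom f)" and ns: "trop_nonsingular f"
  shows "full_cells f \<noteq> {}" "\<And>C. C \<in> full_cells f \<Longrightarrow> primitive_simplex C"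
proof -
  have "finite (aff_dim ` subdivision_cells f)" "aff_dim ` subdivision_cells f \<noteq> {}"
    using finite_subdivision_cells[OF fin] by (auto simp: subdivision_cells_def)
  then have "Max (aff_dim ` subdivision_cells f) \<in> aff_dim ` subdivision_cells f"
    and le: "\<And>D. D \<in> subdivision_cells f \<Longrightarrow> aff_dim D \<le> Max (aff_dim ` subdivision_cells f)"
    by (intro Max_in, auto)
  then obtain C where C: "C \<in> subdivision_cells f" "\<And>D. D \<in> subdivision_cells f \<Longrightarrow> aff_dim D \<le> aff_dim C" by force
  then have "primitive_simplex C" using ns by (auto simp: trop_nonsingular_def)
  then have dim: "aff_dim C = int CARD('v)" by (rule primitive_simplex_aff_dim)
  with C show "full_cells f \<noteq> {}" by (auto simp: full_cells_def)
  show "primitive_simplex C'" if "C' \<in> full_cells f" for C'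
    using that C dim ns by (auto simp: full_cells_def trop_nonsingular_def)
qed

lemma newton_polytope_compact: "finite (dom f) \<Longrightarrow> compact (newton_polytope f)"
  unfolding newton_polytope_def by (intro finite_imp_compact_convex_hull) auto

lemma cell_compact: "finite (dom f) \<Longrightarrow> C \<in> subdivision_cells f \<Longrightarrow> compact C"
  by (auto simp: subdivision_cells_def dom_initial_form intro!: newton_polytope_compact)

text \<open>Up to the boundary of the Newton polytope and the lower-dimensional cells, which are null, the
  full-dimensional cells cover the polytope, and each of them has volume \<open>1 / N!\<close>.\<close>

lemma volume_le_card_full_cells:
  fixes f :: "'v::finite tpolynomial"
  assumes fin: "finite (dom f)" and ns: "trop_nonsingular f"
  shows "fact CARD('v) * measure lborel (newton_polytope f) \<le> real (card (full_cells f))"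
proof -
  let ?P = "newton_polytope f"
  have finc: "finite (full_cells f)" using finite_subdivision_cells[OF fin] by (simp add: full_cells_def)
  define L where "L = {C \<in> subdivision_cells f. aff_dim C \<noteq> int CARD('v)}"
  have finL: "finite L" using finite_subdivision_cells[OF fin] by (simp add: L_def)
  have conv: "convex C" if "C \<in> subdivision_cells f" for C using that by (auto simp: subdivision_cells_def newton_polytope_def)
  have "negligible (\<Union>L)"
  proof (rule negligible_Union[OF finL])
    fix C assume "C \<in> L"
    then have C: "C \<in> subdivision_cells f" "aff_dim C \<noteq> int CARD('v)" by (auto simp: L_def)
    have "interior C = {}" using aff_dim_nonempty_interior[of C] C(2) by auto
    then show "negligible C" using negligible_convex_interior[OF conv[OF C(1)]] by simp
  qed
  moreover have "negligible (frontier ?P)"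
    by (rule negligible_convex_frontier) (simp add: newton_polytope_def)
  ultimately have neg: "negligible (\<Union>L \<union> frontier ?P)" by (rule negligible_Un)
  have sub: "?P \<subseteq> \<Union>(full_cells f) \<union> (\<Union>L \<union> frontier ?P)"
  proof
    fix p assume p: "p \<in> ?P"
    show "p \<in> \<Union>(full_cells f) \<union> (\<Union>L \<union> frontier ?P)"
    proof (cases "p \<in> interior ?P")
      case True
      then obtain w where "p \<in> newton_polytope (initial_form w f)" using interior_in_cell[OF fin] by blast
      then show ?thesis by (auto simp: full_cells_def L_def subdivision_cells_def)
    next
      case False
      then show ?thesis using p closure_subset[of ?P] by (auto simp: frontier_def)
    qed
  qed
  have cm: "C \<in> lmeasurable" if "C \<in> full_cells f" for C
    using that cell_compact[OF fin, of C] by (auto simp: full_cells_def intro: lmeasurable_compact)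
  have "compact (\<Union>(full_cells f))"
    using finc cell_compact[OF fin] by (intro compact_Union) (auto simp: full_cells_def)
  then have U: "\<Union>(full_cells f) \<in> lmeasurable" by (rule lmeasurable_compact)
  have negm: "\<Union>L \<union> frontier ?P \<in> lmeasurable" by (rule negligible_imp_measurable[OF neg])
  have "measure lebesgue ?P \<le> measure lebesgue (\<Union>(full_cells f) \<union> (\<Union>L \<union> frontier ?P))"
    by (rule measure_mono_fmeasurable[OF sub fmeasurableD[OF lmeasurable_compact] fmeasurable.Un[OF U negm]])
       (rule newton_polytope_compact[OF fin])
  also have "\<dots> \<le> measure lebesgue (\<Union>(full_cells f)) + measure lebesgue (\<Union>L \<union> frontier ?P)"
    using U negm by (intro measure_Un_le) (auto dest: fmeasurableD)
  also have "measure lebesgue (\<Union>L \<union> frontier ?P) = 0" by (rule negligible_imp_measure0[OF neg])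
  finally have "measure lebesgue ?P \<le> measure lebesgue (\<Union>(full_cells f))" by simp
  also have "\<dots> \<le> (\<Sum>C\<in>full_cells f. measure lebesgue C)"
    using finc cm by (intro measure_Union_le) auto
  also have "\<dots> = (\<Sum>C\<in>full_cells f. 1 / fact CARD('v))"
  proof (intro sum.cong refl)
    fix C assume C: "C \<in> full_cells f"
    have "C \<in> sets lborel" using cell_compact[OF fin, of C] C by (auto simp: full_cells_def dest: compact_imp_closed)
    then show "measure lebesgue C = 1 / fact CARD('v)"
      using nonsingular_full_cells(2)[OF fin ns C] by (simp add: primitive_simplex_def measure_completion)
  qed
  also have "measure lebesgue ?P = measure lborel ?P"
    using compact_imp_closed[OF newton_polytope_compact[OF fin]] by (simp add: measure_completion)
  finally show ?thesis by (simp add: field_simps)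
qed

section \<open>Leading terms of Puiseux series\<close>

lemma puiseux_support_least:
  fixes \<xi> :: "'a::real_normed_field puiseux"
  assumes B: "B \<subseteq> {r. puiseux_coeff \<xi> r \<noteq> 0}" "B \<noteq> {}"
  shows "\<exists>r\<in>B. \<forall>s\<in>B. r \<le> s"
proof -
  have "wfp_on {r. puiseux_coeff \<xi> r \<noteq> 0} (<)" using puiseux_coeff[of \<xi>] by simp
  from this[unfolded wfp_on_iff_ex_minimal, rule_format, OF B]
  have "\<exists>r\<in>B. \<forall>s. s < r \<longrightarrow> s \<notin> B" .
  then obtain r where r: "r \<in> B" "\<forall>s. s < r \<longrightarrow> s \<notin> B" by (rule bexE)
  have "\<forall>s\<in>B. r \<le> s"
  proof (rule ballI, rule ccontr)
    fix s assume "s \<in> B" "\<not> r \<le> s"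
    then show False using r(2) by simp
  qed
  with r(1) show ?thesis by (rule bexI[rotated])
qed

lemma puiseux_val_attained:
  fixes \<xi> :: "'a::real_normed_field puiseux"
  assumes "\<xi> \<noteq> 0"
  shows "puiseux_coeff \<xi> (- puiseux_val \<xi>) \<noteq> 0"
    and "\<And>r. puiseux_coeff \<xi> r \<noteq> 0 \<Longrightarrow> - puiseux_val \<xi> \<le> r"
proof -
  have "{r. puiseux_coeff \<xi> r \<noteq> 0} \<noteq> {}"
  proof
    assume "{r. puiseux_coeff \<xi> r \<noteq> 0} = {}"
    then have "puiseux_coeff \<xi> = puiseux_coeff 0" by (auto simp: zero_puiseux.rep_eq)
    with assms show False by (simp add: puiseux_coeff_inject)
  qed
  then obtain r where r: "puiseux_coeff \<xi> r \<noteq> 0" "\<And>s. puiseux_coeff \<xi> s \<noteq> 0 \<Longrightarrow> r \<le> s"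
    using puiseux_support_least[of "{r. puiseux_coeff \<xi> r \<noteq> 0}" \<xi>] by auto
  then have "(LEAST r. puiseux_coeff \<xi> r \<noteq> 0) = r" by (intro Least_equality)
  then have "- puiseux_val \<xi> = r" by (simp add: puiseux_val_def)
  with r show "puiseux_coeff \<xi> (- puiseux_val \<xi>) \<noteq> 0"
    "\<And>r. puiseux_coeff \<xi> r \<noteq> 0 \<Longrightarrow> - puiseux_val \<xi> \<le> r" by auto
qed

text \<open>The support without its least exponent \<open>r0\<close> is empty or has a least exponent \<open>r1 > r0\<close>. Comparing the
  remaining terms at \<open>t\<close> with those at a fixed \<open>t0\<close>, where the series converges absolutely, bounds their
  sum by a multiple of \<open>t powr r1\<close>.\<close>

lemma puiseux_leading_term:
  fixes \<xi> :: "real puiseux"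
  assumes nz: "\<xi> \<noteq> 0"
  shows "((\<lambda>t. puiseux_eval \<xi> t * t powr puiseux_val \<xi>) \<longlongrightarrow> puiseux_coeff \<xi> (- puiseux_val \<xi>)) (at_right 0)"
proof -
  define c where "c = puiseux_coeff \<xi>"
  define r0 where "r0 = - puiseux_val \<xi>"
  have c0: "c r0 \<noteq> 0" and min0: "\<And>r. c r \<noteq> 0 \<Longrightarrow> r0 \<le> r"
    using puiseux_val_attained[OF nz] by (auto simp: c_def r0_def)
  obtain r1 where r1: "r0 < r1" "\<And>r. c r \<noteq> 0 \<Longrightarrow> r \<noteq> r0 \<Longrightarrow> r1 \<le> r"
  proof (cases "{r. c r \<noteq> 0} - {r0} = {}")
    case True
    then show ?thesis by (intro that[of "r0 + 1"]) auto
  next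
    case False
    then obtain r1 where "r1 \<in> {r. c r \<noteq> 0} - {r0}" "\<forall>s\<in>{r. c r \<noteq> 0} - {r0}. r1 \<le> s"
      using puiseux_support_least[of "{r. c r \<noteq> 0} - {r0}" \<xi>] unfolding c_def by blast
    then show ?thesis using min0 by (intro that[of r1]) force+
  qed
  have ev: "\<forall>\<^sub>F t in at_right (0::real). (\<lambda>r. c r * t powr r) summable_on UNIV"
    using puiseux_coeff[of \<xi>] by (simp add: c_def)
  then obtain T where T: "T > 0" "\<And>t. 0 < t \<Longrightarrow> t < T \<Longrightarrow> (\<lambda>r. c r * t powr r) summable_on UNIV"
    unfolding eventually_at_right_field by auto
  define t0 where "t0 = T / 2"
  have t0: "0 < t0" "t0 < T" using T by (auto simp: t0_def)
  have abs0: "(\<lambda>r. \<bar>c r * t0 powr r\<bar>) summable_on UNIV"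
    using summable_on_iff_abs_summable_on_real[THEN iffD1, OF T(2)[OF t0]] by simp
  define S where "S = infsum (\<lambda>r. \<bar>c r * t0 powr r\<bar>) UNIV"
  have bound: "\<bar>puiseux_eval \<xi> t * t powr puiseux_val \<xi> - c r0\<bar> \<le> S / t0 powr r1 * t powr (r1 - r0)"
    if t: "0 < t" "t < t0" for t
  proof -
    let ?f = "\<lambda>r. c r * t powr r"
    have sum: "?f summable_on UNIV" using T t t0 by auto
    then have sumd: "?f summable_on (UNIV - {r0})" by (rule summable_on_subset_banach) simp
    have "infsum ?f UNIV = infsum ?f (insert r0 (UNIV - {r0}))" by (rule arg_cong[of _ _ "infsum ?f"]) auto
    also have "\<dots> = ?f r0 + infsum ?f (UNIV - {r0})" by (rule infsum_insert[OF sumd]) simp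
    finally have split: "puiseux_eval \<xi> t = ?f r0 + infsum ?f (UNIV - {r0})"
      by (simp add: puiseux_eval_def c_def)
    have pw: "\<bar>?f r\<bar> \<le> (t / t0) powr r1 * \<bar>c r * t0 powr r\<bar>" if "r \<in> UNIV - {r0}" for r
    proof (cases "c r = 0")
      case False
      then have "(t / t0) powr r \<le> (t / t0) powr r1"
        using r1(2)[of r] that t by (intro powr_mono') auto
      then have "\<bar>c r * t0 powr r\<bar> * (t / t0) powr r \<le> \<bar>c r * t0 powr r\<bar> * (t / t0) powr r1"
        by (intro mult_left_mono) auto
      moreover have "\<bar>?f r\<bar> = \<bar>c r * t0 powr r\<bar> * (t / t0) powr r"
        using t t0 by (simp add: abs_mult powr_divide)
      ultimately show ?thesis by (simp add: mult.commute)
    qed simp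
    have sa: "(\<lambda>r. \<bar>?f r\<bar>) summable_on (UNIV - {r0})"
      using summable_on_iff_abs_summable_on_real[THEN iffD1, OF sumd] by simp
    have s0: "(\<lambda>r. \<bar>c r * t0 powr r\<bar>) summable_on (UNIV - {r0})"
      using abs0 by (rule summable_on_subset_banach) simp
    have "\<bar>infsum ?f (UNIV - {r0})\<bar> \<le> infsum (\<lambda>r. \<bar>?f r\<bar>) (UNIV - {r0})"
      using norm_infsum_bound[of ?f "UNIV - {r0}"] sa by simp
    also have "\<dots> \<le> infsum (\<lambda>r. (t / t0) powr r1 * \<bar>c r * t0 powr r\<bar>) (UNIV - {r0})"
      by (rule infsum_mono[OF sa summable_on_cmult_right[OF s0] pw])
    also have "\<dots> = (t / t0) powr r1 * infsum (\<lambda>r. \<bar>c r * t0 powr r\<bar>) (UNIV - {r0})"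
      by (rule infsum_cmult_right) (rule s0)
    also have "\<dots> \<le> (t / t0) powr r1 * S"
      unfolding S_def by (intro mult_left_mono infsum_mono_neutral s0 abs0) auto
    finally have rest: "\<bar>infsum ?f (UNIV - {r0})\<bar> \<le> (t / t0) powr r1 * S" .
    have "puiseux_eval \<xi> t * t powr puiseux_val \<xi> - c r0 = infsum ?f (UNIV - {r0}) * t powr (- r0)"
      unfolding split using t by (simp add: distrib_right r0_def flip: powr_add)
    then have "\<bar>puiseux_eval \<xi> t * t powr puiseux_val \<xi> - c r0\<bar> = \<bar>infsum ?f (UNIV - {r0})\<bar> * t powr (- r0)"
      by (simp add: abs_mult)
    also have "\<dots> \<le> (t / t0) powr r1 * S * t powr (- r0)"
      using rest by (intro mult_right_mono) auto
    also have "\<dots> = S / t0 powr r1 * (t powr r1 * t powr (- r0))"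
      using t t0 by (simp add: powr_divide)
    also have "t powr r1 * t powr (- r0) = t powr (r1 - r0)" by (simp flip: powr_add)
    finally show ?thesis .
  qed
  have "((\<lambda>t. t powr (r1 - r0)) \<longlongrightarrow> 0 powr (r1 - r0)) (at_right (0::real))"
    by (rule tendsto_powr'[OF _ tendsto_const]) 
       (use r1 in \<open>auto intro: tendsto_ident_at eventually_mono[OF eventually_at_right_less]\<close>)
  then have "((\<lambda>t. S / t0 powr r1 * t powr (r1 - r0)) \<longlongrightarrow> S / t0 powr r1 * 0) (at_right (0::real))"
    by (intro tendsto_intros) simp
  then have "((\<lambda>t. S / t0 powr r1 * t powr (r1 - r0)) \<longlongrightarrow> 0) (at_right (0::real))" by simp
  moreover have "\<forall>\<^sub>F t in at_right (0::real). norm (puiseux_eval \<xi> t * t powr puiseux_val \<xi> - c r0) \<le> S / t0 powr r1 * t powr (r1 - r0)"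
    unfolding eventually_at_right_field using bound t0 by (intro exI[of _ t0]) auto
  ultimately have "((\<lambda>t. puiseux_eval \<xi> t * t powr puiseux_val \<xi> - c r0) \<longlongrightarrow> 0) (at_right 0)"
    by (rule Lim_null_comparison[rotated])
  then show ?thesis unfolding c_def r0_def by (simp add: LIM_zero_iff)
qed

section \<open>A lower bound for the fibres of the logarithmic Gauss map\<close>

definition eval_coeffs :: "('v, real puiseux) mpolynomial \<Rightarrow> real \<Rightarrow> ('v \<Rightarrow>\<^sub>0 nat) \<Rightarrow> real" where
  "eval_coeffs F t \<alpha> = puiseux_eval (Poly_Mapping.lookup F \<alpha>) t"

lemma dom_Trop: "dom (Trop F) = Poly_Mapping.keys F"
  by (auto simp: Trop_def dom_def)

lemma mpoly_fun_at: "mpoly_fun (mpoly_at F t) = poly_fun (Poly_Mapping.keys F) (eval_coeffs F t)"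
proof
  fix x
  have lk: "Poly_Mapping.lookup (mpoly_at F t) \<alpha> = (if \<alpha> \<in> Poly_Mapping.keys F then eval_coeffs F t \<alpha> else 0)" for \<alpha>
    by (simp add: mpoly_at_def map.rep_eq eval_coeffs_def when_def in_keys_iff)
  have "mpoly_fun (mpoly_at F t) x = (\<Sum>\<alpha>\<in>Poly_Mapping.keys (mpoly_at F t). Poly_Mapping.lookup (mpoly_at F t) \<alpha> * mon \<alpha> x)"
    by (simp add: mpoly_fun_def mon_def)
  also have "\<dots> = (\<Sum>\<alpha>\<in>Poly_Mapping.keys F. Poly_Mapping.lookup (mpoly_at F t) \<alpha> * mon \<alpha> x)"
    by (rule sum.mono_neutral_left) (auto simp: in_keys_iff lk split: if_splits)
  also have "\<dots> = poly_fun (Poly_Mapping.keys F) (eval_coeffs F t) x"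
    unfolding poly_fun_def by (intro sum.cong) (auto simp: lk)
  finally show "mpoly_fun (mpoly_at F t) x = poly_fun (Poly_Mapping.keys F) (eval_coeffs F t) x" .
qed

lemma span_singleton_eq_iff:
  fixes y v :: "'a::real_vector"
  assumes "v \<noteq> 0"
  shows "span {y} = span {v} \<longleftrightarrow> (\<exists>l. l \<noteq> 0 \<and> y = l *\<^sub>R v)"
proof
  assume eq: "span {y} = span {v}"
  then have "y \<in> span {v}" using span_base[of y "{y}"] by simp
  then obtain l where l: "y = l *\<^sub>R v" by (auto simp: span_singleton)
  moreover have "l \<noteq> 0"
  proof
    assume "l = 0"
    moreover have "v \<in> span {y}" unfolding eq by (rule span_base) simp
    ultimately show False using assms l by simp
  qed
  ultimately show "\<exists>l. l \<noteq> 0 \<and> y = l *\<^sub>R v" by blast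
next
  assume "\<exists>l. l \<noteq> 0 \<and> y = l *\<^sub>R v"
  then obtain l where l: "l \<noteq> 0" "y = l *\<^sub>R v" by blast
  then have "v = (1 / l) *\<^sub>R y" by simp
  then have "v \<in> span {y}" by (metis span_base span_scale singletonI)
  moreover have "y \<in> span {v}" unfolding l by (intro span_scale span_base) simp
  ultimately show "span {y} = span {v}" by (simp add: span_eq)
qed

lemma log_gauss_fibre:
  assumes "v \<noteq> 0"
  shows "{x \<in> real_zero_set (mpoly_at F t). log_gauss_map (mpoly_at F t) x = span {v}}
    = gauss_fibre (Poly_Mapping.keys F) (eval_coeffs F t) v"
proof -
  have "(\<chi> i. x $ i * frechet_derivative (poly_fun A c) (at x) (axis i 1)) = log_gradient A c x" for A c and x :: "real ^ 'a"
  proof -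
    obtain D where D: "(poly_fun A c has_derivative D) (at x)" "\<forall>i. x $ i * D (axis i 1) = log_gradient A c x $ i"
      using poly_fun_has_derivative by blast
    then have "frechet_derivative (poly_fun A c) (at x) = D" by (metis frechet_derivative_at)
    then show ?thesis using D(2) by (simp add: vec_eq_iff)
  qed
  then show ?thesis
    by (auto simp: real_zero_set_def log_gauss_map_def gauss_fibre_def mpoly_fun_at span_singleton_eq_iff[OF assms])
qed

text \<open>Proportional terms give proportional values and logarithmic gradients; \<open>x\<close> will be \<open>y\<close> multiplied by powers
  of \<open>t\<close>.\<close>

lemma rescaled_fibre:
  assumes x: "\<And>i. x $ i \<noteq> 0" and s: "s \<noteq> 0"
    and eq: "\<And>\<alpha>. \<alpha> \<in> A \<Longrightarrow> c \<alpha> * mon \<alpha> x = s * (D \<alpha> * mon \<alpha> y)" and y: "y \<in> gauss_fibre A D v"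
  shows "x \<in> gauss_fibre A c v"
proof -
  have "poly_fun A c x = s * poly_fun A D y"
    unfolding poly_fun_def sum_distrib_left by (intro sum.cong) (auto simp: eq)
  moreover have "log_gradient A c x = s *\<^sub>R log_gradient A D y"
    unfolding log_gradient_def scaleR_sum_right by (intro sum.cong) (auto simp: eq)
  moreover obtain l where "l \<noteq> 0" "log_gradient A D y = l *\<^sub>R v" "poly_fun A D y = 0" using y by (auto simp: gauss_fibre_def)
  ultimately show ?thesis using x s by (auto simp: gauss_fibre_def intro!: exI[of _ "s * l"])
qed

lemma finite_positive_bounds:
  fixes X :: "real set"
  assumes "finite X" "\<And>x. x \<in> X \<Longrightarrow> x > 0"
  shows "\<exists>e>0. \<forall>x\<in>X. e < x \<and> x < 1/e"
proof -
  have "\<forall>\<^sub>F e in at_right (0::real). \<forall>x\<in>X. e < x \<and> x < 1/e"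
  proof (rule eventually_ball_finite[OF assms(1)], rule ballI)
    fix x assume "x \<in> X"
    then have x: "x > 0" by (rule assms)
    show "\<forall>\<^sub>F e in at_right (0::real). e < x \<and> x < 1/e"
      unfolding eventually_at_right_field
      by (rule exI[of _ "min x (1/x)"]) (use x in \<open>auto simp: field_simps\<close>)
  qed
  then have "\<forall>\<^sub>F e in at_right (0::real). e > 0 \<and> (\<forall>x\<in>X. e < x \<and> x < 1/e)"
    using eventually_at_right_less[of "0::real"] by eventually_elim auto
  from eventually_happens'[OF trivial_limit_at_right_real this] show ?thesis by blast
qed

text \<open>With \<open>om\<close> dual to the cell and \<open>x\<^sub>i = t powr (- om\<^sub>i) y\<^sub>i\<close>, the term of \<open>\<alpha>\<close> at \<open>x\<close> is, up to a common
  power of \<open>t\<close>, the monomial at \<open>y\<close> with coefficient \<open>D t \<alpha>\<close>, which tends to the leading coefficient of the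
  series of \<open>\<alpha>\<close> if \<open>\<alpha>\<close> is a vertex of the cell and to \<open>0\<close> otherwise. So \<open>perturbed_simplex_solution\<close> applies
  for small \<open>t\<close>. The set \<open>W\<close> consists of the barycentric coordinates of directions, of which none
  may be too close to \<open>0\<close> at \<open>v\<close>.\<close>

lemma full_cell_solutions:
  fixes F :: "('v::finite, real puiseux) mpolynomial"
  assumes ns: "trop_nonsingular (Trop F)" and C: "C \<in> full_cells (Trop F)"
  defines "A \<equiv> Poly_Mapping.keys F"
  shows "\<exists>\<sigma> W. \<sigma> \<subseteq> A \<and> card \<sigma> = Suc CARD('v) \<and> C = convex hull (exponent_vec ` \<sigma>) \<and> affinely_generates \<sigma> \<and>
    finite W \<and> (0 :: real ^ 'v) \<notin> W \<and>
    (\<forall>e>0. \<forall>\<^sub>F t in at_right 0. \<forall>v. norm v = 1 \<longrightarrow> (\<forall>w\<in>W. e \<le> \<bar>w \<bullet> v\<bar>) \<longrightarrow>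
       (\<exists>x\<in>gauss_fibre A (eval_coeffs F t) v. \<forall>\<alpha>\<in>A - \<sigma>. \<forall>\<alpha>'\<in>\<sigma>.
          \<bar>eval_coeffs F t \<alpha> * mon \<alpha> x\<bar> < \<bar>eval_coeffs F t \<alpha>' * mon \<alpha>' x\<bar>))"
proof -
  let ?f = "Trop F"
  have finA: "finite A" by (simp add: A_def)
  have domA: "dom ?f = A" by (simp add: A_def dom_Trop)
  obtain om where om: "C = newton_polytope (initial_form om ?f)"
    using C by (auto simp: full_cells_def subdivision_cells_def)
  define \<sigma> where "\<sigma> = dom (initial_form om ?f)"
  have \<sigma>: "\<sigma> = {\<alpha> \<in> A. trop_monomial ?f \<alpha> om = trop_fun ?f om}" by (simp add: \<sigma>_def dom_initial_form domA)
  then have \<sigma>A: "\<sigma> \<subseteq> A" "finite \<sigma>" using finA by auto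
  have Ch: "C = convex hull (exponent_vec ` \<sigma>)" by (simp add: om newton_polytope_def \<sigma>_def)
  have "primitive_simplex (convex hull (exponent_vec ` \<sigma>))"
    using nonsingular_full_cells(2)[OF _ ns C] finA domA Ch by simp
  then obtain a :: "'v option \<Rightarrow> 'v \<Rightarrow>\<^sub>0 nat" where a: "inj a" "range a = \<sigma>" and gen: "affinely_generates \<sigma>"
    using primitive_simplex_vertices[OF \<sigma>A(2)] by blast
  have card\<sigma>: "card \<sigma> = Suc CARD('v)"
    using card_image[OF a(1)] a(2) by (simp add: card_UNIV_option)
  have gen': "affinely_generates (range a)" using gen a by simp
  obtain w0 w where w: "(\<Sum>j\<in>UNIV. w0 j) = 1" "(\<Sum>j\<in>UNIV. w0 j *\<^sub>R exponent_vec (a j)) = 0"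
     "\<And>y. (\<Sum>j\<in>UNIV. w j \<bullet> y) = 0" "\<And>y. (\<Sum>j\<in>UNIV. (w j \<bullet> y) *\<^sub>R exponent_vec (a j)) = y"
     "\<And>j j'. w0 j + w j \<bullet> exponent_vec (a j') = (if j = j' then 1 else (0::real))" "\<And>j. w j \<noteq> 0"
    using barycentric_coordinates[OF a(1) gen'] by blast
  define D where "D = (\<lambda>t \<alpha>. eval_coeffs F t \<alpha> * t powr (trop_fun ?f om - om \<bullet> exponent_vec \<alpha>))"
  define lc where "lc = (\<lambda>\<alpha>. puiseux_coeff (Poly_Mapping.lookup F \<alpha>) (- puiseux_val (Poly_Mapping.lookup F \<alpha>)))"
  have nzF: "Poly_Mapping.lookup F \<alpha> \<noteq> 0" if "\<alpha> \<in> A" for \<alpha> using that by (simp add: A_def in_keys_iff)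
  have lc0: "lc \<alpha> \<noteq> 0" if "\<alpha> \<in> A" for \<alpha> unfolding lc_def by (rule puiseux_val_attained(1)[OF nzF[OF that]])
  \<comment> \<open>the power of \<open>t\<close> by which the term of \<open>\<alpha>\<close> is smaller than those of the cell\<close>
  define gap where "gap = (\<lambda>\<alpha>. trop_fun ?f om - trop_monomial ?f \<alpha> om)"
  have tv: "trop_monomial ?f \<alpha> om = puiseux_val (Poly_Mapping.lookup F \<alpha>) + om \<bullet> exponent_vec \<alpha>" if "\<alpha> \<in> A" for \<alpha>
    using that by (simp add: trop_monomial_def Trop_def A_def)
  have lim0: "((\<lambda>t. puiseux_eval (Poly_Mapping.lookup F \<alpha>) t * t powr puiseux_val (Poly_Mapping.lookup F \<alpha>) * t powr gap \<alpha>) \<longlongrightarrow> lc \<alpha> * g) (at_right 0)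
      \<Longrightarrow> ((\<lambda>t. D t \<alpha>) \<longlongrightarrow> lc \<alpha> * g) (at_right 0)" if "\<alpha> \<in> A" for \<alpha> g
  proof (erule Lim_transform_eventually)
    show "\<forall>\<^sub>F t in at_right 0. puiseux_eval (Poly_Mapping.lookup F \<alpha>) t * t powr puiseux_val (Poly_Mapping.lookup F \<alpha>) * t powr gap \<alpha> = D t \<alpha>"
      using eventually_at_right_less[of "0::real"]
      by eventually_elim (simp add: D_def gap_def tv[OF that] eval_coeffs_def mult.assoc flip: powr_add)
  qed
  have D_in: "((\<lambda>t. D t \<alpha>) \<longlongrightarrow> lc \<alpha>) (at_right 0)" if "\<alpha> \<in> \<sigma>" for \<alpha>
  proof -
    have \<alpha>: "\<alpha> \<in> A" "gap \<alpha> = 0" using that by (auto simp: \<sigma> gap_def)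
    have "((\<lambda>t. puiseux_eval (Poly_Mapping.lookup F \<alpha>) t * t powr puiseux_val (Poly_Mapping.lookup F \<alpha>) * t powr gap \<alpha>) \<longlongrightarrow> lc \<alpha> * 1) (at_right 0)"
    proof (rule tendsto_mult)
      show "((\<lambda>t. t powr gap \<alpha>) \<longlongrightarrow> 1) (at_right (0::real))" unfolding \<alpha>(2)
        by (rule tendsto_eventually) (auto intro: eventually_mono[OF eventually_at_right_less])
    qed (use puiseux_leading_term[OF nzF[OF \<alpha>(1)]] in \<open>simp add: lc_def\<close>)
    from lim0[OF \<alpha>(1) this] show ?thesis by simp
  qed
  have D_out: "((\<lambda>t. D t \<alpha>) \<longlongrightarrow> 0) (at_right 0)" if "\<alpha> \<in> A - \<sigma>" for \<alpha>
  proof -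
    have \<alpha>: "\<alpha> \<in> A" "gap \<alpha> > 0"
      using that trop_monomial_le[of ?f \<alpha> om] finA domA by (auto simp: \<sigma> gap_def less_le)
    have "((\<lambda>t. puiseux_eval (Poly_Mapping.lookup F \<alpha>) t * t powr puiseux_val (Poly_Mapping.lookup F \<alpha>) * t powr gap \<alpha>) \<longlongrightarrow> lc \<alpha> * 0) (at_right 0)"
    proof (rule tendsto_mult)
      have "((\<lambda>t. t powr gap \<alpha>) \<longlongrightarrow> 0 powr gap \<alpha>) (at_right (0::real))"
        by (rule tendsto_powr'[OF _ tendsto_const]) 
           (use \<alpha> in \<open>auto intro: tendsto_ident_at eventually_mono[OF eventually_at_right_less]\<close>)
      then show "((\<lambda>t. t powr gap \<alpha>) \<longlongrightarrow> 0) (at_right (0::real))" by simp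
    qed (use puiseux_leading_term[OF nzF[OF \<alpha>(1)]] in \<open>simp add: lc_def\<close>)
    from lim0[OF \<alpha>(1) this] show ?thesis by simp
  qed
  have main: "\<forall>\<^sub>F t in at_right 0. \<forall>v. norm v = 1 \<longrightarrow> (\<forall>w\<in>range w. e \<le> \<bar>w \<bullet> v\<bar>) \<longrightarrow>
       (\<exists>x\<in>gauss_fibre A (eval_coeffs F t) v. \<forall>\<alpha>\<in>A - \<sigma>. \<forall>\<alpha>'\<in>\<sigma>.
          \<bar>eval_coeffs F t \<alpha> * mon \<alpha> x\<bar> < \<bar>eval_coeffs F t \<alpha>' * mon \<alpha>' x\<bar>)" if e: "e > 0" for e
  proof -
    define X where "X = {e} \<union> range (\<lambda>j. norm (w j)) \<union> (\<lambda>\<alpha>. \<bar>lc \<alpha>\<bar>) ` A"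
    have "finite X" using finA by (simp add: X_def)
    moreover have "x > 0" if "x \<in> X" for x using that e w(6) lc0 by (auto simp: X_def)
    ultimately obtain e' where e': "e' > 0" "\<forall>x\<in>X. e' < x \<and> x < 1/e'"
      using finite_positive_bounds by blast
    have e'X: "e' < x \<and> x < 1/e'" if "x \<in> X" for x using e'(2) that by blast
    have "range a \<subseteq> A" using a(2) \<sigma>A(1) by simp
    from perturbed_simplex_solution[OF a(1) gen' finA this w(1-5) e'(1)]
    obtain d where d: "d > 0" and sol: "\<forall>D v. (\<forall>j. e' \<le> \<bar>D (a j)\<bar> \<and> \<bar>D (a j)\<bar> \<le> 1/e') \<longrightarrow>
      (\<forall>\<alpha>\<in>A - range a. \<bar>D \<alpha>\<bar> < d) \<longrightarrow> (\<forall>j. e' \<le> \<bar>w j \<bullet> v\<bar> \<and> \<bar>w j \<bullet> v\<bar> \<le> 1/e') \<longrightarrow>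
      (\<exists>x \<in> gauss_fibre A D v. \<forall>\<alpha>\<in>A - range a. \<forall>j. \<bar>D \<alpha> * mon \<alpha> x\<bar> < \<bar>D (a j) * mon (a j) x\<bar>)"
      by (elim exE conjE)
    have "\<forall>\<^sub>F t in at_right 0. \<forall>j\<in>UNIV. e' \<le> \<bar>D t (a j)\<bar> \<and> \<bar>D t (a j)\<bar> \<le> 1/e'"
    proof (rule eventually_ball_finite, simp, rule ballI)
      fix j
      have j: "a j \<in> \<sigma>" "a j \<in> A" using a \<sigma>A by auto
      have lim: "((\<lambda>t. \<bar>D t (a j)\<bar>) \<longlongrightarrow> \<bar>lc (a j)\<bar>) (at_right 0)" by (intro tendsto_rabs D_in j)
      have "e' < \<bar>lc (a j)\<bar>" "\<bar>lc (a j)\<bar> < 1/e'" using e'X[of "\<bar>lc (a j)\<bar>"] j by (auto simp: X_def)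
      from order_tendstoD(1)[OF lim this(1)] order_tendstoD(2)[OF lim this(2)]
      show "\<forall>\<^sub>F t in at_right 0. e' \<le> \<bar>D t (a j)\<bar> \<and> \<bar>D t (a j)\<bar> \<le> 1/e'" by eventually_elim auto
    qed
    moreover have "\<forall>\<^sub>F t in at_right 0. \<forall>\<alpha>\<in>A - \<sigma>. \<bar>D t \<alpha>\<bar> < d"
    proof (rule eventually_ball_finite, simp add: finA, rule ballI)
      fix \<alpha> assume "\<alpha> \<in> A - \<sigma>"
      then have "((\<lambda>t. \<bar>D t \<alpha>\<bar>) \<longlongrightarrow> \<bar>0\<bar>) (at_right 0)" by (intro tendsto_rabs D_out)
      then show "\<forall>\<^sub>F t in at_right 0. \<bar>D t \<alpha>\<bar> < d" by (rule order_tendstoD(2)) (use d in simp)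
    qed
    moreover have "\<forall>\<^sub>F t in at_right 0. (0::real) < t" by (rule eventually_at_right_less)
    ultimately show ?thesis
    proof eventually_elim
      case (elim t)
      show ?case
      proof (intro allI impI)
        fix v :: "real ^ 'v" assume v: "norm v = 1" "\<forall>w\<in>range w. e \<le> \<bar>w \<bullet> v\<bar>"
        have wv: "\<forall>j. e' \<le> \<bar>w j \<bullet> v\<bar> \<and> \<bar>w j \<bullet> v\<bar> \<le> 1/e'"
        proof
          fix j
          have "\<bar>w j \<bullet> v\<bar> \<le> norm (w j)" using Cauchy_Schwarz_ineq2[of "w j" v] v by simp
          moreover have "e \<le> \<bar>w j \<bullet> v\<bar>" using v by auto
          ultimately show "e' \<le> \<bar>w j \<bullet> v\<bar> \<and> \<bar>w j \<bullet> v\<bar> \<le> 1/e'" using e'X[of e] e'X[of "norm (w j)"] by (auto simp: X_def)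
        qed
        have "\<forall>j. e' \<le> \<bar>D t (a j)\<bar> \<and> \<bar>D t (a j)\<bar> \<le> 1/e'" using elim(1) by simp
        moreover have "\<forall>\<alpha>\<in>A - range a. \<bar>D t \<alpha>\<bar> < d" using elim(2) a(2) by simp
        ultimately obtain y where y: "y \<in> gauss_fibre A (D t) v"
          "\<forall>\<alpha>\<in>A - range a. \<forall>j. \<bar>D t \<alpha> * mon \<alpha> y\<bar> < \<bar>D t (a j) * mon (a j) y\<bar>"
          using sol[THEN spec, THEN spec, of "D t" v] wv by (elim impE bexE)
        define x :: "real ^ 'v" where "x = (\<chi> i. y $ i * exp ((- ln t *\<^sub>R om) $ i))"
        have eq: "eval_coeffs F t \<alpha> * mon \<alpha> x = t powr (- trop_fun ?f om) * (D t \<alpha> * mon \<alpha> y)" for \<alpha>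
        proof -
          have "mon \<alpha> x = mon \<alpha> y * t powr (- (om \<bullet> exponent_vec \<alpha>))"
            unfolding x_def mon_exp using elim by (simp add: powr_def mult.commute)
          then show ?thesis by (simp add: D_def mult_ac flip: powr_add)
        qed
        have ynz: "y $ i \<noteq> 0" for i using y by (simp add: gauss_fibre_def)
        have "x \<in> gauss_fibre A (eval_coeffs F t) v"
          by (rule rescaled_fibre[OF _ _ eq y(1)]) (use ynz elim in \<open>auto simp: x_def\<close>)
        moreover have "\<forall>\<alpha>\<in>A - \<sigma>. \<forall>\<alpha>'\<in>\<sigma>. \<bar>eval_coeffs F t \<alpha> * mon \<alpha> x\<bar> < \<bar>eval_coeffs F t \<alpha>' * mon \<alpha>' x\<bar>"
          unfolding eq using y(2) elim a(2) by (auto simp: abs_mult)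
        ultimately show "\<exists>x\<in>gauss_fibre A (eval_coeffs F t) v. \<forall>\<alpha>\<in>A - \<sigma>. \<forall>\<alpha>'\<in>\<sigma>.
          \<bar>eval_coeffs F t \<alpha> * mon \<alpha> x\<bar> < \<bar>eval_coeffs F t \<alpha>' * mon \<alpha>' x\<bar>" by blast
      qed
    qed
  qed
  show ?thesis
    by (intro exI[of _ \<sigma>] exI[of _ "range w"] conjI allI impI main \<sigma>A(1) card\<sigma> Ch gen) (use w(6) in auto)
qed

text \<open>At the solution belonging to a cell the terms of its vertices dominate all the others. Two cells have
  equally many vertices, so each has a vertex that the other lacks, and a common solution would make both
  of these terms larger than each other.\<close>

lemma many_preimages:
  fixes F :: "('v::finite, real puiseux) mpolynomial"
  assumes ns: "trop_nonsingular (Trop F)"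
  shows "\<exists>W. finite W \<and> (0 :: real ^ 'v) \<notin> W \<and>
    (\<forall>e>0. \<forall>\<^sub>F t in at_right 0. \<forall>v. norm v = 1 \<longrightarrow> (\<forall>w\<in>W. e \<le> \<bar>w \<bullet> v\<bar>) \<longrightarrow>
      of_nat (card (full_cells (Trop F))) \<le>
        emeasure (count_space UNIV) (gauss_fibre (Poly_Mapping.keys F) (eval_coeffs F t) v))"
proof -
  let ?A = "Poly_Mapping.keys F" and ?c = "eval_coeffs F"
  have fin: "finite (full_cells (Trop F))"
    using finite_subdivision_cells[of "Trop F"] by (simp add: dom_Trop full_cells_def)
  define P where "P = (\<lambda>C \<sigma> W. \<sigma> \<subseteq> ?A \<and> card \<sigma> = Suc CARD('v) \<and> C = convex hull (exponent_vec ` \<sigma>) \<and> affinely_generates \<sigma> \<and>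
    finite W \<and> (0 :: real ^ 'v) \<notin> W \<and>
    (\<forall>e>0. \<forall>\<^sub>F t in at_right 0. \<forall>v. norm v = 1 \<longrightarrow> (\<forall>w\<in>W. e \<le> \<bar>w \<bullet> v\<bar>) \<longrightarrow>
       (\<exists>x\<in>gauss_fibre ?A (?c t) v. \<forall>\<alpha>\<in>?A - \<sigma>. \<forall>\<alpha>'\<in>\<sigma>.
          \<bar>?c t \<alpha> * mon \<alpha> x\<bar> < \<bar>?c t \<alpha>' * mon \<alpha>' x\<bar>)))"
  have "\<forall>C\<in>full_cells (Trop F). \<exists>p. P C (fst p) (snd p)"
  proof
    fix C assume "C \<in> full_cells (Trop F)"
    then have "\<exists>\<sigma> W. P C \<sigma> W" unfolding P_def by (rule full_cell_solutions[OF ns])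
    then obtain \<sigma> W where "P C \<sigma> W" by (elim exE)
    then show "\<exists>p. P C (fst p) (snd p)" by (intro exI[of _ "(\<sigma>, W)"]) simp
  qed
  from bchoice[OF this] obtain p where p: "\<forall>C\<in>full_cells (Trop F). P C (fst (p C)) (snd (p C))" by (rule exE)
  define \<sigma> W where "\<sigma> = (\<lambda>C. fst (p C))" and "W = (\<lambda>C. snd (p C))"
  have PC: "P C (\<sigma> C) (W C)" if "C \<in> full_cells (Trop F)" for C
    using bspec[OF p that] by (simp add: \<sigma>_def W_def)
  have s: "\<sigma> C \<subseteq> ?A \<and> card (\<sigma> C) = Suc CARD('v) \<and> C = convex hull (exponent_vec ` \<sigma> C)"
    and W: "finite (W C) \<and> (0 :: real ^ 'v) \<notin> W C"
    and sol: "\<forall>e>0. \<forall>\<^sub>F t in at_right 0. \<forall>v. norm v = 1 \<longrightarrow> (\<forall>w\<in>W C. e \<le> \<bar>w \<bullet> v\<bar>) \<longrightarrow>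
       (\<exists>x\<in>gauss_fibre ?A (?c t) v. \<forall>\<alpha>\<in>?A - \<sigma> C. \<forall>\<alpha>'\<in>\<sigma> C. \<bar>?c t \<alpha> * mon \<alpha> x\<bar> < \<bar>?c t \<alpha>' * mon \<alpha>' x\<bar>)"
    if "C \<in> full_cells (Trop F)" for C
    using PC[OF that] unfolding P_def by - (elim conjE, (intro conjI; assumption)?, assumption?)+
  show ?thesis
  proof (intro exI[of _ "\<Union>C\<in>full_cells (Trop F). W C"] conjI allI impI)
    show "finite (\<Union>C\<in>full_cells (Trop F). W C)" using fin W by auto
    show "0 \<notin> (\<Union>C\<in>full_cells (Trop F). W C)" using W by auto
    fix e :: real assume e: "e > 0"
    have "\<forall>\<^sub>F t in at_right 0. \<forall>C\<in>full_cells (Trop F). \<forall>v. norm v = 1 \<longrightarrow> (\<forall>w\<in>W C. e \<le> \<bar>w \<bullet> v\<bar>) \<longrightarrow>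
       (\<exists>x\<in>gauss_fibre ?A (?c t) v. \<forall>\<alpha>\<in>?A - \<sigma> C. \<forall>\<alpha>'\<in>\<sigma> C. \<bar>?c t \<alpha> * mon \<alpha> x\<bar> < \<bar>?c t \<alpha>' * mon \<alpha>' x\<bar>)"
      using sol e by (intro eventually_ball_finite fin ballI) simp
    then show "\<forall>\<^sub>F t in at_right 0. \<forall>v. norm v = 1 \<longrightarrow> (\<forall>w\<in>\<Union>C\<in>full_cells (Trop F). W C. e \<le> \<bar>w \<bullet> v\<bar>) \<longrightarrow>
      of_nat (card (full_cells (Trop F))) \<le> emeasure (count_space UNIV) (gauss_fibre ?A (?c t) v)"
    proof eventually_elim
      case (elim t)
      show ?case
      proof (intro allI impI)
        fix v :: "real ^ 'v" assume v: "norm v = 1" "\<forall>w\<in>\<Union>C\<in>full_cells (Trop F). W C. e \<le> \<bar>w \<bullet> v\<bar>"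
        then have "\<forall>C\<in>full_cells (Trop F). \<exists>x. x\<in>gauss_fibre ?A (?c t) v \<and> (\<forall>\<alpha>\<in>?A - \<sigma> C. \<forall>\<alpha>'\<in>\<sigma> C. \<bar>?c t \<alpha> * mon \<alpha> x\<bar> < \<bar>?c t \<alpha>' * mon \<alpha>' x\<bar>)"
          using elim by blast
        from bchoice[OF this] obtain x where x: "\<And>C. C \<in> full_cells (Trop F) \<Longrightarrow> x C \<in> gauss_fibre ?A (?c t) v"
          and dom: "\<And>C \<alpha> \<alpha>'. C \<in> full_cells (Trop F) \<Longrightarrow> \<alpha> \<in> ?A - \<sigma> C \<Longrightarrow> \<alpha>' \<in> \<sigma> C \<Longrightarrow> \<bar>?c t \<alpha> * mon \<alpha> (x C)\<bar> < \<bar>?c t \<alpha>' * mon \<alpha>' (x C)\<bar>"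
          by blast
        have "inj_on x (full_cells (Trop F))"
        proof (rule inj_onI, rule ccontr)
          fix C C' assume CC: "C \<in> full_cells (Trop F)" "C' \<in> full_cells (Trop F)" "x C = x C'" "C \<noteq> C'"
          then have "\<sigma> C \<noteq> \<sigma> C'" using s by metis
          moreover have "finite (\<sigma> C)" "finite (\<sigma> C')" using s[OF CC(1)] s[OF CC(2)] by (auto intro: finite_subset)
          moreover have "card (\<sigma> C) = card (\<sigma> C')" using s[OF CC(1)] s[OF CC(2)] by simp
          ultimately have "\<not> \<sigma> C \<subseteq> \<sigma> C'" "\<not> \<sigma> C' \<subseteq> \<sigma> C" by (metis card_subset_eq)+
          then obtain \<alpha> \<alpha>' where "\<alpha> \<in> \<sigma> C" "\<alpha> \<notin> \<sigma> C'" "\<alpha>' \<in> \<sigma> C'" "\<alpha>' \<notin> \<sigma> C" by blast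
          moreover from this have "\<alpha> \<in> ?A" "\<alpha>' \<in> ?A" using s[OF CC(1)] s[OF CC(2)] by blast+
          ultimately show False
            using dom[OF CC(1), of \<alpha>' \<alpha>] dom[OF CC(2), of \<alpha> \<alpha>'] CC(3) by simp
        qed
        then have "of_nat (card (full_cells (Trop F))) = emeasure (count_space UNIV) (x ` full_cells (Trop F))"
          using fin by (simp add: card_image)
        also have "\<dots> \<le> emeasure (count_space UNIV) (gauss_fibre ?A (?c t) v)"
          using x by (intro emeasure_mono) auto
        finally show "of_nat (card (full_cells (Trop F))) \<le> emeasure (count_space UNIV) (gauss_fibre ?A (?c t) v)" .
      qed
    qed
  qed
qed

section \<open>The measure on projective space\<close>

definition lines_of :: "'a::euclidean_space set \<Rightarrow> 'a set set" where
  "lines_of S = {span {v} |v. v \<in> S \<and> norm v = 1}"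

lemma unit_span_eq:
  fixes v u :: "'a::euclidean_space"
  assumes "norm v = 1" "norm u = 1" "span {v} = span {u}" shows "v = u \<or> v = - u"
proof -
  have "u \<noteq> 0" using assms by auto
  then obtain l where l: "v = l *\<^sub>R u" using span_singleton_eq_iff[of u v] assms by auto
  then have "\<bar>l\<bar> = 1" using assms by simp
  then show ?thesis using l by (cases "l \<ge> 0") auto
qed

lemma proj_space_unit:
  assumes "\<beta> \<in> (proj_space :: 'a::euclidean_space set set)"
  obtains v where "norm v = 1" "\<beta> = span {v}"
proof -
  obtain u where u: "u \<noteq> 0" "\<beta> = span {u}" using assms by (auto simp: proj_space_def)
  have "norm (sgn u) = 1" using u by (simp add: norm_sgn)
  moreover have "\<beta> = span {sgn u}" unfolding u(2)
    by (subst span_singleton_eq_iff) (use u in \<open>auto simp: sgn_zero_iff sgn_div_norm intro!: exI[of _ "norm u"]\<close>)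
  ultimately show ?thesis by (rule that)
qed

lemma space_proj_measure: "space (proj_measure :: 'a::euclidean_space set measure) = proj_space"
  by (simp add: proj_measure_def space_scale_measure proj_algebra_def space_measure_of_conv)

lemma span_in_proj_space: "norm v = 1 \<Longrightarrow> span {v} \<in> proj_space"
  unfolding proj_space_def by (rule CollectI, rule exI[of _ v]) auto

context
  fixes S :: "'a::euclidean_space set"
  assumes S: "S \<in> sets borel" and sym: "\<And>v. v \<in> S \<Longrightarrow> - v \<in> S"
begin

lemma sphere_vimage_lines_of: "{v \<in> sphere 0 1. span {v} \<in> lines_of S} = sphere 0 1 \<inter> S"
proof
  show "{v \<in> sphere 0 1. span {v} \<in> lines_of S} \<subseteq> sphere 0 1 \<inter> S"
  proof
    fix v assume v: "v \<in> {v \<in> sphere 0 1. span {v} \<in> lines_of S}"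
    then obtain u where u: "u \<in> S" "norm u = 1" "span {v} = span {u}" by (auto simp: lines_of_def)
    then show "v \<in> sphere 0 1 \<inter> S" using unit_span_eq[of v u] v sym[of u] by auto
  qed
qed (auto simp: lines_of_def)

lemma lines_of_measurable: "lines_of S \<in> sets (proj_measure :: 'a set measure)"
proof -
  have "lines_of S \<subseteq> proj_space" by (auto simp: lines_of_def span_in_proj_space)
  moreover have "{v \<in> sphere 0 1. span {v} \<in> lines_of S} \<in> sets borel"
    unfolding sphere_vimage_lines_of by (intro sets.Int S borel_closed[OF closed_sphere])
  ultimately have "lines_of S \<in> {A. A \<subseteq> proj_space \<and> {v \<in> sphere 0 1. span {v} \<in> A} \<in> sets borel}"
    by (intro CollectI conjI)
  then show ?thesis unfolding proj_measure_def proj_algebra_def by (auto simp: sets_measure_of_conv)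
qed

lemma emeasure_lines_of:
  "emeasure proj_measure (lines_of S) = 1/2 * emeasure sphere_measure (sphere 0 1 \<inter> S)"
proof -
  have m: "(\<lambda>v. span {v}) \<in> sphere_measure \<rightarrow>\<^sub>M (proj_algebra :: 'a set measure)"
    unfolding proj_algebra_def
  proof (rule measurable_measure_of)
    fix A :: "'a set set"
    assume "A \<in> {A. A \<subseteq> proj_space \<and> {v \<in> sphere 0 1. span {v} \<in> A} \<in> sets borel}"
    moreover have "(\<lambda>v. span {v}) -` A \<inter> space sphere_measure = {v \<in> sphere 0 1. span {v} \<in> A}"
      by auto
    ultimately show "(\<lambda>v. span {v}) -` A \<inter> space sphere_measure \<in> sets sphere_measure"
      by (auto simp: sets_restrict_space_iff)
  qed (auto simp: span_in_proj_space)
  have "lines_of S \<in> sets (proj_algebra :: 'a set measure)"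
    using lines_of_measurable by (simp add: proj_measure_def)
  then have "emeasure (distr sphere_measure proj_algebra (\<lambda>v. span {v})) (lines_of S)
      = emeasure sphere_measure ((\<lambda>v. span {v}) -` lines_of S \<inter> sphere 0 1)"
    using m by (subst emeasure_distr) auto
  also have "(\<lambda>v. span {v}) -` lines_of S \<inter> sphere 0 1 = {v \<in> sphere 0 1. span {v} \<in> lines_of S}"
    by blast
  also have "\<dots> = sphere 0 1 \<inter> S" by (rule sphere_vimage_lines_of)
  finally show ?thesis by (simp add: proj_measure_def)
qed

end

lemma emeasure_sphere_null:
  fixes B :: "'a::euclidean_space set"
  assumes "null_cone B" shows "emeasure sphere_measure (sphere 0 1 \<inter> B) = 0"
proof -
  have B: "B \<in> sets borel" "emeasure lborel B = 0"
    and cone: "\<And>v r. v \<in> B \<Longrightarrow> r \<noteq> 0 \<Longrightarrow> r *\<^sub>R v \<in> B" using assms by (auto simp: null_cone_def)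
  have s: "sphere 0 1 \<inter> B \<in> sets (restrict_space borel (sphere (0::'a) 1))"
    using B by (simp add: sets_restrict_space_iff)
  let ?D = "restrict_space lborel (ball 0 1 - {0 :: 'a})"
  let ?P = "sgn -` (sphere 0 1 \<inter> B) \<inter> (ball 0 1 - {0})"
  have PB: "?P \<subseteq> B"
  proof
    fix x assume x: "x \<in> ?P"
    then have "norm x *\<^sub>R sgn x \<in> B" by (intro cone) auto
    then show "x \<in> B" using x by (simp add: sgn_div_norm)
  qed
  have "emeasure (distr ?D (restrict_space borel (sphere 0 1)) sgn) (sphere 0 1 \<inter> B) = emeasure ?D ?P"
    by (subst emeasure_distr[OF measurable_sgn_sphere s]) (simp add: space_restrict_space)
  also have "\<dots> = emeasure lborel ?P"
    by (rule emeasure_restrict_space) auto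
  also have "\<dots> = 0" using emeasure_mono[OF PB, of lborel] B by simp
  finally show ?thesis by (simp add: sphere_measure_def)
qed

lemma AE_proj_measure_not_null_cone:
  fixes B :: "'a::euclidean_space set"
  assumes "null_cone B"
  shows "AE \<beta> in proj_measure. \<exists>v. v \<notin> B \<and> norm v = 1 \<and> \<beta> = span {v}"
proof (rule AE_I)
  have B: "B \<in> sets borel" and cone: "\<And>v r. v \<in> B \<Longrightarrow> r \<noteq> 0 \<Longrightarrow> r *\<^sub>R v \<in> B"
    using assms by (auto simp: null_cone_def)
  have neg: "- v \<in> B" if "v \<in> B" for v using cone[OF that, of "- 1"] by simp
  show "lines_of B \<in> sets proj_measure" by (rule lines_of_measurable[OF B neg])
  show "emeasure proj_measure (lines_of B) = 0"
    using emeasure_lines_of[OF B neg] emeasure_sphere_null[OF assms] by simp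
  show "{\<beta> \<in> space proj_measure. \<not> (\<exists>v. v \<notin> B \<and> norm v = 1 \<and> \<beta> = span {v})} \<subseteq> lines_of B"
  proof
    fix \<beta> assume b: "\<beta> \<in> {\<beta> \<in> space proj_measure. \<not> (\<exists>v. v \<notin> B \<and> norm v = 1 \<and> \<beta> = span {v})}"
    then obtain v where "norm v = 1" "\<beta> = span {v}" using proj_space_unit by (auto simp: space_proj_measure)
    then show "\<beta> \<in> lines_of B" using b by (auto simp: lines_of_def)
  qed
qed

section \<open>Total curvatures\<close>

abbreviation lattice_volume :: "('v::finite, real puiseux) mpolynomial \<Rightarrow> real" where
  "lattice_volume F \<equiv> fact CARD('v) * measure lborel (newton_polytope (Trop F))"

lemma real_amoeba_curvature_le:
  fixes F :: "('v::finite, real puiseux) mpolynomial"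
  assumes ns: "trop_nonsingular (Trop F)"
  shows "real_amoeba_curvature (mpoly_at F t) \<le>
    ennreal (lattice_volume F) * emeasure proj_measure (proj_space :: (real ^ 'v) set set)"
proof -
  let ?A = "Poly_Mapping.keys F"
  obtain C where C: "C \<in> full_cells (Trop F)" using nonsingular_full_cells(1)[OF _ ns] by (auto simp: dom_Trop)
  obtain \<sigma> where \<sigma>: "\<sigma> \<subseteq> ?A" "card \<sigma> = Suc CARD('v)" "affinely_generates \<sigma>"
    using full_cell_solutions[OF ns C] by (elim exE conjE)
  have gen: "affinely_generates ?A" using affinely_generates_mono[OF \<sigma>(3,1)] by simp
  have ne: "?A \<noteq> {}" using \<sigma> by auto
  obtain B where B: "null_cone B" "0 \<in> B" and bound: "\<forall>v. v \<notin> B \<longrightarrow> finite (gauss_fibre ?A (eval_coeffs F t) v) \<and>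
     real (card (gauss_fibre ?A (eval_coeffs F t) v)) \<le> fact CARD('v) * measure lborel (convex hull (exponent_vec ` ?A))"
    using kushnirenko_gauss_bound[OF finite_keys ne gen, of "eval_coeffs F t"] by (elim exE conjE)
  have V: "fact CARD('v) * measure lborel (convex hull (exponent_vec ` ?A)) = lattice_volume F"
    by (simp add: newton_polytope_def dom_Trop)
  have "real_amoeba_curvature (mpoly_at F t) \<le> (\<integral>\<^sup>+\<beta>. ennreal (lattice_volume F) \<partial>(proj_measure :: (real ^ 'v) set measure))"
    unfolding real_amoeba_curvature_def
  proof (rule nn_integral_mono_AE, rule AE_mp[OF AE_proj_measure_not_null_cone[OF B(1)]], rule AE_I2, rule impI)
    fix \<beta> :: "(real ^ 'v) set" assume "\<exists>v. v \<notin> B \<and> norm v = 1 \<and> \<beta> = span {v}"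
    then obtain v where v: "v \<notin> B" "\<beta> = span {v}" by blast
    then have v0: "v \<noteq> 0" using B by auto
    have f: "finite (gauss_fibre ?A (eval_coeffs F t) v)" "real (card (gauss_fibre ?A (eval_coeffs F t) v)) \<le> lattice_volume F"
      using bound v(1) unfolding V by auto
    show "emeasure (count_space UNIV) {x \<in> real_zero_set (mpoly_at F t). log_gauss_map (mpoly_at F t) x = \<beta>} \<le> ennreal (lattice_volume F)"
      unfolding v(2) log_gauss_fibre[OF v0] using f
      by (simp add: emeasure_count_space_finite ennreal_of_nat_eq_real_of_nat ennreal_leI)
  qed
  also have "\<dots> = ennreal (lattice_volume F) * emeasure proj_measure (proj_space :: (real ^ 'v) set set)"
    by (simp add: space_proj_measure)
  finally show ?thesis .
qed

lemma null_cone_hyperplane: "w \<noteq> 0 \<Longrightarrow> null_cone {v. w \<bullet> v = (0::real)}"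
  using negligible_hyperplane[of w 0] borel_closed[OF closed_hyperplane[of w 0]]
  by (auto simp: null_cone_def null_sets_def negligible_iff_null_sets emeasure_completion)

text \<open>For fixed \<open>e\<close>, the lines on which all functionals of \<open>W\<close> are at least \<open>e\<close> have enough preimages for all
  small \<open>t\<close>. As \<open>e\<close> tends to \<open>0\<close> these lines exhaust projective space up to finitely many hyperplanes.\<close>

lemma real_total_curvature_ge:
  fixes F :: "('v::finite, real puiseux) mpolynomial"
  assumes ns: "trop_nonsingular (Trop F)"
  shows "of_nat (card (full_cells (Trop F))) * emeasure proj_measure (proj_space :: (real ^ 'v) set set)
    \<le> real_total_curvature F"
proof -
  let ?m = "of_nat (card (full_cells (Trop F))) :: ennreal"
  obtain W where W: "finite W" "(0 :: real ^ 'v) \<notin> W"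
    and many: "\<forall>e>0. \<forall>\<^sub>F t in at_right 0. \<forall>v. norm v = 1 \<longrightarrow> (\<forall>w\<in>W. e \<le> \<bar>w \<bullet> v\<bar>) \<longrightarrow>
      ?m \<le> emeasure (count_space UNIV) (gauss_fibre (Poly_Mapping.keys F) (eval_coeffs F t) v)"
    using many_preimages[OF ns] by (elim exE conjE)
  define S where "S = (\<lambda>k. {v :: real ^ 'v. \<forall>w\<in>W. 1 / real (Suc k) \<le> \<bar>w \<bullet> v\<bar>})"
  have S: "S k \<in> sets borel" for k
  proof -
    have "S k = (\<Inter>w\<in>W. {v. 1 / real (Suc k) \<le> \<bar>w \<bullet> v\<bar>})" by (auto simp: S_def)
    moreover have "closed \<dots>" by (intro closed_INT ballI closed_Collect_le continuous_intros)
    ultimately show ?thesis by simp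
  qed
  have sym: "- v \<in> S k" if "v \<in> S k" for v k using that by (simp add: S_def)
  note meas = lines_of_measurable[OF S sym]
  have le: "?m * emeasure proj_measure (lines_of (S k)) \<le> real_total_curvature F" for k
  proof -
    have "\<forall>\<^sub>F t in at_right 0. ?m * emeasure proj_measure (lines_of (S k)) \<le> real_amoeba_curvature (mpoly_at F t)"
      using many[rule_format, of "1 / real (Suc k)", simplified]
    proof eventually_elim
      case (elim t)
      have "?m * emeasure proj_measure (lines_of (S k)) = (\<integral>\<^sup>+\<beta>. ?m * indicator (lines_of (S k)) \<beta> \<partial>proj_measure)"
        using meas by (simp add: nn_integral_cmult_indicator)
      also have "\<dots> \<le> real_amoeba_curvature (mpoly_at F t)"
        unfolding real_amoeba_curvature_def
      proof (rule nn_integral_mono)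
        fix \<beta> :: "(real ^ 'v) set"
        show "?m * indicator (lines_of (S k)) \<beta> \<le> emeasure (count_space UNIV) {x \<in> real_zero_set (mpoly_at F t). log_gauss_map (mpoly_at F t) x = \<beta>}"
        proof (cases "\<beta> \<in> lines_of (S k)")
          case True
          then obtain v where v: "v \<in> S k" "norm v = 1" "\<beta> = span {v}" by (auto simp: lines_of_def)
          then have "v \<noteq> 0" by auto
          then show ?thesis using True elim v unfolding v(3) by (simp add: log_gauss_fibre S_def)
        qed simp
      qed
      finally show ?case .
    qed
    then have "?m * emeasure proj_measure (lines_of (S k)) \<le> Liminf (at_right 0) (\<lambda>t. real_amoeba_curvature (mpoly_at F t))"
      by (intro Liminf_bounded)
    also have "\<dots> \<le> real_total_curvature F"
      unfolding real_total_curvature_def by (intro Liminf_le_Limsup trivial_limit_at_right_real)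
    finally show ?thesis .
  qed
  have inc: "incseq (\<lambda>k. lines_of (S k))"
  proof (rule incseq_SucI)
    fix k
    have "S k \<subseteq> S (Suc k)"
    proof
      fix v assume v: "v \<in> S k"
      have "1 / real (Suc (Suc k)) \<le> 1 / real (Suc k)" by (intro divide_left_mono) auto
      then show "v \<in> S (Suc k)" using v unfolding S_def by (auto intro: order_trans simp del: of_nat_Suc)
    qed
    then show "lines_of (S k) \<subseteq> lines_of (S (Suc k))" by (auto simp: lines_of_def)
  qed
  have "null_cone (\<Union>w\<in>W. {v. w \<bullet> v = 0})"
    using W by (intro null_cone_UN null_cone_hyperplane) (auto intro: countable_finite)
  from AE_proj_measure_not_null_cone[OF this]
  have ae: "AE \<beta> in proj_measure. \<beta> \<in> (\<Union>k. lines_of (S k)) \<longleftrightarrow> \<beta> \<in> (proj_space :: (real ^ 'v) set set)"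
  proof (rule AE_mp, intro AE_I2 impI)
    fix \<beta> :: "(real ^ 'v) set"
    assume sp: "\<beta> \<in> space proj_measure" and "\<exists>v. v \<notin> (\<Union>w\<in>W. {v. w \<bullet> v = 0}) \<and> norm v = 1 \<and> \<beta> = span {v}"
    then obtain v where v: "\<forall>w\<in>W. w \<bullet> v \<noteq> 0" "norm v = 1" "\<beta> = span {v}" by auto
    have "\<exists>e>0. \<forall>x\<in>(\<lambda>w. \<bar>w \<bullet> v\<bar>) ` W. e < x \<and> x < 1/e"
      by (rule finite_positive_bounds) (use W(1) v(1) in auto)
    then obtain e where e: "e > 0" "\<forall>x\<in>(\<lambda>w. \<bar>w \<bullet> v\<bar>) ` W. e < x \<and> x < 1/e" by (elim exE conjE)
    obtain k where "1 / real (Suc k) < e" using nat_approx_posE[OF e(1)] by auto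
    then have "v \<in> S k" using e(2) unfolding S_def by (auto intro: less_imp_le less_trans simp del: of_nat_Suc)
    then show "\<beta> \<in> (\<Union>k. lines_of (S k)) \<longleftrightarrow> \<beta> \<in> proj_space"
      using v sp by (auto simp: lines_of_def space_proj_measure)
  qed
  have "emeasure proj_measure (proj_space :: (real ^ 'v) set set) = emeasure proj_measure (\<Union>k. lines_of (S k))"
  proof (rule emeasure_eq_AE)
    show "AE \<beta> in proj_measure. \<beta> \<in> (proj_space :: (real ^ 'v) set set) \<longleftrightarrow> \<beta> \<in> (\<Union>k. lines_of (S k))"
      using ae by (rule AE_mp) (simp add: AE_I2)
    show "(proj_space :: (real ^ 'v) set set) \<in> sets proj_measure" using sets.top[of proj_measure] by (simp add: space_proj_measure)
  qed (use meas in auto)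
  also have "\<dots> = (SUP k. emeasure proj_measure (lines_of (S k)))"
    using meas inc by (intro SUP_emeasure_incseq[symmetric]) auto
  finally have "?m * emeasure proj_measure (proj_space :: (real ^ 'v) set set)
      = (SUP k. ?m * emeasure proj_measure (lines_of (S k)))" by (simp add: SUP_mult_left_ennreal)
  also have "\<dots> \<le> real_total_curvature F" by (intro SUP_least le)
  finally show ?thesis .
qed

lemma real_total_curvature_eq:
  fixes F :: "('v::finite, real puiseux) mpolynomial"
  assumes ns: "trop_nonsingular (Trop F)"
  shows "real_total_curvature F = ennreal (lattice_volume F) * ennreal (sphere_vol (CARD('v) - 1) / 2)"
proof (rule antisym)
  let ?P = "emeasure proj_measure (proj_space :: (real ^ 'v) set set)"
  have P: "?P = ennreal (sphere_vol (CARD('v) - 1) / 2)" by (subst emeasure_proj_measure) simp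
  have "real_total_curvature F \<le> ennreal (lattice_volume F) * ?P"
    unfolding real_total_curvature_def
    by (intro Limsup_bounded always_eventually allI real_amoeba_curvature_le[OF ns])
  then show "real_total_curvature F \<le> ennreal (lattice_volume F) * ennreal (sphere_vol (CARD('v) - 1) / 2)"
    unfolding P .
  have "ennreal (lattice_volume F) \<le> of_nat (card (full_cells (Trop F)))"
    using volume_le_card_full_cells[OF _ ns] by (simp add: dom_Trop ennreal_of_nat_eq_real_of_nat ennreal_leI)
  then have "ennreal (lattice_volume F) * ?P \<le> of_nat (card (full_cells (Trop F))) * ?P"
    by (rule mult_right_mono) simp
  also have "\<dots> \<le> real_total_curvature F" by (rule real_total_curvature_ge[OF ns])
  finally show "ennreal (lattice_volume F) * ennreal (sphere_vol (CARD('v) - 1) / 2) \<le> real_total_curvature F"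
    unfolding P .
qed

lemma sphere_vol_pos: "sphere_vol m > 0"
  by (simp add: sphere_vol_def)

lemma sphere_vol_1: "sphere_vol 1 = 2 * pi"
  by (simp add: sphere_vol_def unit_ball_vol_2)

theorem theorem4p10:
  fixes n :: nat and F :: "('v::finite, real puiseux) mpolynomial"
  assumes "n \<ge> 1" and "CARD('v) = n + 1"
    and "trop_nonsingular (Trop F)"
  shows "ennreal (sphere_vol (2 * n) / sphere_vol n) * real_total_curvature F =
         ennreal (total_abs_curvature n (Trop F))"
proof -
  let ?M = "lattice_volume F"
  have "ennreal (sphere_vol (2 * n) / sphere_vol n) * real_total_curvature F
      = ennreal (sphere_vol (2 * n) / sphere_vol n * (?M * (sphere_vol n / 2)))"
    unfolding real_total_curvature_eq[OF assms(3)] using assms(2) sphere_vol_pos[of n] sphere_vol_pos[of "2 * n"]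
    by (simp add: less_imp_le flip: ennreal_mult)
  also have "sphere_vol (2 * n) / sphere_vol n * (?M * (sphere_vol n / 2)) = sphere_vol (2 * n) / 2 * ?M"
    using sphere_vol_pos[of n] by (simp add: field_simps)
  also have "\<dots> = total_abs_curvature n (Trop F)"
  proof -
    have "curvature_const n * CP_vol n = sphere_vol (2 * n) / 2"
      unfolding curvature_const_def CP_vol_def sphere_vol_1 using sphere_vol_pos[of "2 * n + 1"] by simp
    moreover have "(- 1 :: real) ^ n * (- 1) ^ n = 1" by (simp flip: power_add mult_2)
    moreover have "total_abs_curvature n (Trop F)
        = ((- 1) ^ n * (- 1) ^ n) * (curvature_const n * CP_vol n) * ?M"
      unfolding total_abs_curvature_def total_curvature_def assms(2) by (simp only: mult_ac)
    ultimately show ?thesis by simp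
  qed
  finally show ?thesis .
qed

end
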